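(* For any apparatus (described by a CP instrument $\mathcal{I}$ on a Hilbert space $\mathcal{H}$, with POVM $\Pi$ and nonselective operation $T$) and any observables $A$ and $B$ on $\mathcal{H}$, if the apparatus precisely measures $A$, then $$\sigma(A,\rho)\,\eta(B,\rho)\ \ge\ \frac12\big|\mathrm{Tr}([A,B]\rho)\big|$$ for any state $\rho$ for which all the relevant terms are finite.
   Context: $\mathcal{H}$ is a separable complex Hilbert space; an observable is a (possibly unbounded) self-adjoint operator $A$ with spectral measure $E^{A}$; a state is a density operator $\rho$ (positive, trace one). $\tau c(\mathcal{H})$ is the space of trace-class operators. $\sigma(A,\rho)=(\mathrm{Tr}[A^2\rho]-\mathrm{Tr}[A\rho]^2)^{1/2}$ is the standard deviation. A CP instrument is a map $\mathcal{I}$ from Borel sets $\Delta\subseteq\mathbb{R}$ to bounded completely positive linear maps $\mathcal{I}(\Delta)$ on $\tau c(\mathcal{H})$ that is countably additive (strongly, in trace norm) with $\mathcal{I}(\mathbb{R})$ trace-preserving. The statistics of an apparatus with output variable $\mathbf{x}$ are described by a CP instrument: $\Pr\{\mathbf{x}\in\Delta\|\rho\}=\mathrm{Tr}[\mathcal{I}(\Delta)\rho]$, with output state $\mathcal{I}(\Delta)\rho/\mathrm{Tr}[\mathcal{I}(\Delta)\rho]$. The dual $S^{*}$ of a bounded linear map $S$ on $\tau c(\mathcal{H})$ acts on bounded operators by $\mathrm{Tr}[X\,S\rho]=\mathrm{Tr}[(S^{*}X)\rho]$. The POVM of the apparatus is $\Pi(\Delta)=\mathcal{I}(\Delta)^{*}I$;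 its nonselective operation is $T=\mathcal{I}(\mathbb{R})$. The apparatus precisely measures $A$ if $\Pr\{\mathbf{x}\in\Delta\|\rho\}=\mathrm{Tr}[E^{A}(\Delta)\rho]$ for all $\Delta,\rho$, i.e. $\Pi=E^{A}$. For a POVM $\Pi$ on $\mathbb{R}$: $O(\Pi)=\int x\,d\Pi(x)$ is the symmetric operator with $\langle\xi|O(\Pi)|\eta\rangle=\int x\,d\langle\xi|\Pi(x)|\eta\rangle$ for $\xi,\eta$ in the domain $\{\xi:\int x^2d\langle\xi|\Pi(x)|\xi\rangle<\infty\}$, and $O^{(2)}(\Pi)=\int x^2d\Pi(x)$. The distance of $\Pi$ from an observable $B$ in $\rho$ is $$d_\rho(\Pi,B)=\mathrm{Tr}[(O^{(2)}(\Pi)-O(\Pi)B-BO(\Pi)+B^2)\rho]^{1/2}.$$ The rms disturbance is $\eta(B,\rho)=d_\rho(T^{*}E^{B},B)$, where $T^{*}E^{B}$ is the POVM $\Delta\mapsto T^{*}[E^{B}(\Delta)]$. Conventions for unbounded operators: "all the relevant terms are finite" means $\mathrm{Tr}[A^2\rho]$, $\mathrm{Tr}[B^2\rho]$ and $\int x^2\,\mathrm{Tr}[d(T^{*}E^{B})(x)\rho]$ are finite; for symmetric $X,Y$, $\mathrm{Tr}[XY\rho]$ is read as $\mathrm{Tr}[(X\sqrt\rho)^\dagger(Y\sqrt\rho)]$ and $[X,Y]=XY-YX$ accordingly. *)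

theory Defs
  imports "HOL-Analysis.Analysis"
begin

section \<open>Separable complex Hilbert spaces\<close>

class scaleC =
  fixes scaleC :: "complex \<Rightarrow> 'a \<Rightarrow> 'a" (infixr "*\<^sub>C" 75)

class complex_vector = scaleC + ab_group_add +
  assumes scaleC_add_right: "c *\<^sub>C (x + y) = c *\<^sub>C x + c *\<^sub>C y"
    and scaleC_add_left: "(c + d) *\<^sub>C x = c *\<^sub>C x + d *\<^sub>C x"
    and scaleC_scaleC: "c *\<^sub>C d *\<^sub>C x = (c * d) *\<^sub>C x"
    and scaleC_one: "1 *\<^sub>C x = x"

text \<open>Inner products are antilinear in the first argument. Completeness comes from \<^class>\<open>banach\<close>,
  separability from \<^class>\<open>second_countable_topology\<close>.\<close>

class complex_hilbert = complex_vector + banach + second_countable_topology +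
  fixes cinner :: "'a \<Rightarrow> 'a \<Rightarrow> complex"
  assumes scaleR_scaleC: "r *\<^sub>R x = complex_of_real r *\<^sub>C x"
    and cinner_commute: "cinner x y = cnj (cinner y x)"
    and cinner_add_right: "cinner x (y + z) = cinner x y + cinner x z"
    and cinner_scaleC_right: "cinner x (c *\<^sub>C y) = c * cinner x y"
    and cinner_self: "cinner x x = complex_of_real ((norm x)\<^sup>2)"

instantiation complex :: complex_hilbert
begin

definition scaleC_complex :: "complex \<Rightarrow> complex \<Rightarrow> complex" where
  "scaleC_complex c x = c * x"

definition cinner_complex :: "complex \<Rightarrow> complex \<Rightarrow> complex" where
  "cinner_complex x y = cnj x * y"

instance
  by standard
    (auto simp: scaleC_complex_def cinner_complex_def algebra_simps scaleR_conv_of_real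
      complex_norm_square[symmetric])

end

section \<open>Bounded operators\<close>

definition bounded_clinear :: "('a::complex_hilbert \<Rightarrow> 'a) \<Rightarrow> bool" where
  "bounded_clinear f \<longleftrightarrow> bounded_linear f \<and> (\<forall>c x. f (c *\<^sub>C x) = c *\<^sub>C f x)"

typedef (overloaded) 'a bop = "{f :: 'a::complex_hilbert \<Rightarrow> 'a. bounded_clinear f}"
  morphisms bop_apply Bop
  by (rule exI[of _ "\<lambda>x. x"]) (simp add: bounded_clinear_def bounded_linear_ident)

setup_lifting type_definition_bop

notation bop_apply (infixr "*\<^sub>V" 70)

lemma scaleC_zero_right: "c *\<^sub>C (0 :: 'a::complex_vector) = 0"
  using scaleC_add_right[of c "0 :: 'a" 0] by simp

lemma scaleC_minus_right: "c *\<^sub>C (- x) = - (c *\<^sub>C (x :: 'a::complex_vector))"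
  using scaleC_add_right[of c x "- x"] scaleC_zero_right[of c, where 'a='a]
  by (simp add: eq_neg_iff_add_eq_0 add.commute)

lemma norm_scaleC: "norm (c *\<^sub>C x) = cmod c * norm (x :: 'a::complex_hilbert)"
proof -
  have "cinner (c *\<^sub>C x) (c *\<^sub>C x) = c * cnj c * cinner x x"
    by (metis cinner_commute cinner_scaleC_right complex_cnj_mult mult.assoc mult.commute)
  then have "complex_of_real ((norm (c *\<^sub>C x))\<^sup>2) = complex_of_real ((cmod c * norm x)\<^sup>2)"
    by (simp add: cinner_self complex_norm_square[symmetric] power_mult_distrib del: of_real_power)
  then show ?thesis
    by (simp only: of_real_eq_iff) (simp add: power2_eq_iff_nonneg)
qed

lemma bounded_linear_scaleC: "bounded_linear (\<lambda>x :: 'a::complex_hilbert. c *\<^sub>C x)"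
  by (rule bounded_linear_intro[of _ "cmod c"])
    (simp_all add: scaleC_add_right scaleR_scaleC scaleC_scaleC norm_scaleC mult.commute)

instantiation bop :: (complex_hilbert) complex_vector
begin

lift_definition zero_bop :: "'a bop" is "\<lambda>x. 0"
  by (simp add: bounded_clinear_def scaleC_zero_right bounded_linear_zero)

lift_definition plus_bop :: "'a bop \<Rightarrow> 'a bop \<Rightarrow> 'a bop" is "\<lambda>f g x. f x + g x"
  by (simp add: bounded_clinear_def scaleC_add_right bounded_linear_add)

lift_definition uminus_bop :: "'a bop \<Rightarrow> 'a bop" is "\<lambda>f x. - f x"
  by (simp add: bounded_clinear_def scaleC_minus_right bounded_linear_minus)

definition minus_bop :: "'a bop \<Rightarrow> 'a bop \<Rightarrow> 'a bop" where
  "minus_bop S T = S + - T"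

lift_definition scaleC_bop :: "complex \<Rightarrow> 'a bop \<Rightarrow> 'a bop" is "\<lambda>c f x. c *\<^sub>C f x"
  by (auto simp: bounded_clinear_def scaleC_scaleC mult.commute
      intro: bounded_linear_compose[OF bounded_linear_scaleC])

instance
  by standard
    (simp_all add: minus_bop_def, (transfer, simp add: fun_eq_iff algebra_simps
      scaleC_add_right scaleC_add_left scaleC_scaleC scaleC_one)+)

end

lift_definition id_bop :: "'a::complex_hilbert bop" is "\<lambda>x. x"
  by (simp add: bounded_clinear_def bounded_linear_ident)

lift_definition comp_bop :: "'a::complex_hilbert bop \<Rightarrow> 'a bop \<Rightarrow> 'a bop" (infixl "o\<^sub>B" 67)
  is "\<lambda>f g x. f (g x)"
  by (simp add: bounded_clinear_def bounded_linear_compose)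

definition adj :: "'a::complex_hilbert bop \<Rightarrow> 'a bop" where
  "adj T = (THE S. \<forall>x y. cinner x (T *\<^sub>V y) = cinner (S *\<^sub>V x) y)"

definition positive :: "'a::complex_hilbert bop \<Rightarrow> bool" where
  "positive T \<longleftrightarrow> (\<forall>x. cinner x (T *\<^sub>V x) \<in> \<real>\<^sub>\<ge>\<^sub>0)"

definition sqrt_op :: "'a::complex_hilbert bop \<Rightarrow> 'a bop" where
  "sqrt_op T = (THE S. positive S \<and> S o\<^sub>B S = T)"

definition abs_op :: "'a::complex_hilbert bop \<Rightarrow> 'a bop" where
  "abs_op T = sqrt_op (adj T o\<^sub>B T)"

section \<open>Trace class\<close>

definition is_onb :: "'a::complex_hilbert set \<Rightarrow> bool" where
  "is_onb B \<longleftrightarrow> (\<forall>e\<in>B. \<forall>f\<in>B. cinner e f = (if e = f then 1 else 0)) \<and>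
     (\<forall>x. (\<forall>e\<in>B. cinner e x = 0) \<longrightarrow> x = 0)"

text \<open>The trace and the trace class do not depend on the choice of the basis.\<close>

definition some_onb :: "'a::complex_hilbert set" where
  "some_onb = (SOME B. is_onb B)"

definition trace_class :: "'a::complex_hilbert bop \<Rightarrow> bool" where
  "trace_class T \<longleftrightarrow> (\<lambda>e. cinner e (abs_op T *\<^sub>V e)) summable_on some_onb"

definition tr :: "'a::complex_hilbert bop \<Rightarrow> complex" where
  "tr T = (\<Sum>\<^sub>\<infinity>e\<in>some_onb. cinner e (T *\<^sub>V e))"

definition trace_norm :: "'a::complex_hilbert bop \<Rightarrow> real" where
  "trace_norm T = Re (tr (abs_op T))"

definition state :: "'a::complex_hilbert bop \<Rightarrow> bool" where
  "state \<rho> \<longleftrightarrow> positive \<rho> \<and> trace_class \<rho> \<and> tr \<rho> = 1"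

section \<open>Unbounded operators\<close>

text \<open>A not necessarily everywhere defined operator is a partial map; its domain is \<^const>\<open>dom\<close>.\<close>

type_synonym 'a pop = "'a \<rightharpoonup> 'a"

definition linear_pop :: "'a::complex_hilbert pop \<Rightarrow> bool" where
  "linear_pop A \<longleftrightarrow> A 0 = Some 0 \<and>
     (\<forall>x\<in>dom A. \<forall>y\<in>dom A. A (x + y) = Some (the (A x) + the (A y))) \<and>
     (\<forall>c. \<forall>x\<in>dom A. A (c *\<^sub>C x) = Some (c *\<^sub>C the (A x)))"

definition adj_pop :: "'a::complex_hilbert pop \<Rightarrow> 'a pop" where
  "adj_pop A = (\<lambda>y. if \<exists>z. \<forall>x\<in>dom A. cinner y (the (A x)) = cinner z x
     then Some (THE z. \<forall>x\<in>dom A. cinner y (the (A x)) = cinner z x) else None)"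

definition self_adjoint :: "'a::complex_hilbert pop \<Rightarrow> bool" where
  "self_adjoint A \<longleftrightarrow> linear_pop A \<and> closure (dom A) = UNIV \<and> adj_pop A = A"

section \<open>Positive operator valued measures on the real line\<close>

text \<open>Operator valued set functions are constrained only on the Borel sets.\<close>

definition is_povm :: "(real set \<Rightarrow> 'a::complex_hilbert bop) \<Rightarrow> bool" where
  "is_povm P \<longleftrightarrow> (\<forall>\<Delta>\<in>sets borel. positive (P \<Delta>)) \<and> P UNIV = id_bop \<and>
     (\<forall>D. range D \<subseteq> sets borel \<and> disjoint_family D \<longrightarrow>
       (\<forall>x y. (\<lambda>n. cinner x (P (D n) *\<^sub>V y)) sums cinner x (P (\<Union>n. D n) *\<^sub>V y)))"

definition is_pvm :: "(real set \<Rightarrow> 'a::complex_hilbert bop) \<Rightarrow> bool" where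
  "is_pvm E \<longleftrightarrow> is_povm E \<and> (\<forall>\<Delta>\<in>sets borel. E \<Delta> o\<^sub>B E \<Delta> = E \<Delta>)"

text \<open>The measures \<open>\<langle>\<xi>|P(\<Delta>)|\<xi>\<rangle>\<close> and \<open>Tr[P(\<Delta>)\<rho>]\<close>.\<close>

definition vector_measure :: "(real set \<Rightarrow> 'a::complex_hilbert bop) \<Rightarrow> 'a \<Rightarrow> real measure" where
  "vector_measure P x = measure_of UNIV (sets borel) (\<lambda>\<Delta>. ennreal (Re (cinner x (P \<Delta> *\<^sub>V x))))"

definition state_measure :: "(real set \<Rightarrow> 'a::complex_hilbert bop) \<Rightarrow> 'a bop \<Rightarrow> real measure" where
  "state_measure P \<rho> = measure_of UNIV (sets borel) (\<lambda>\<Delta>. ennreal (Re (tr (P \<Delta> o\<^sub>B \<rho>))))"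

text \<open>Integral of \<open>f\<close> with respect to a complex Borel measure \<open>\<nu>\<close>. Every complex measure has the form
  \<open>d\<nu> = h dM\<close> with \<open>M\<close> finite and positive and \<open>h\<close> integrable; then \<open>d|\<nu>| = |h| dM\<close>, and neither
  integrability nor the value of \<open>\<integral> f h dM\<close> depends on the representation.\<close>

definition has_cmeasure_integral ::
  "(real \<Rightarrow> real) \<Rightarrow> (real set \<Rightarrow> complex) \<Rightarrow> complex \<Rightarrow> bool" where
  "has_cmeasure_integral f \<nu> I \<longleftrightarrow>
     (\<exists>M h. sets M = sets borel \<and> finite_measure M \<and> integrable M h \<and>
        (\<forall>\<Delta>\<in>sets borel. \<nu> \<Delta> = (LINT x:\<Delta>|M. h x)) \<and>
        integrable M (\<lambda>x. complex_of_real (f x) * h x) \<and>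
        I = (LINT x|M. complex_of_real (f x) * h x))"

text \<open>The operator \<open>O(P) = \<integral> x dP(x)\<close>. The vector \<open>O(P)y\<close> is tested against all \<open>x\<close> of the space, not
  only those in the domain: the domain need not be dense for a general POVM, while
  \<open>\<langle>x|P(\<Delta>)|y\<rangle>\<close> integrates the identity for every \<open>x\<close> as soon as \<open>y\<close> is in the domain.\<close>

definition povm_mean :: "(real set \<Rightarrow> 'a::complex_hilbert bop) \<Rightarrow> 'a pop" where
  "povm_mean P = (\<lambda>y. if (\<integral>\<^sup>+t. ennreal (t\<^sup>2) \<partial>vector_measure P y) < \<infinity>
     then Some (THE z. \<forall>x. has_cmeasure_integral (\<lambda>t. t) (\<lambda>\<Delta>. cinner x (P \<Delta> *\<^sub>V y)) (cinner x z))
     else None)"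

text \<open>\<open>E\<close> is the spectral measure of \<open>A\<close>, that is \<open>A = \<integral> x dE(x)\<close> including the domains.\<close>

definition is_spectral_measure :: "'a::complex_hilbert pop \<Rightarrow> (real set \<Rightarrow> 'a bop) \<Rightarrow> bool" where
  "is_spectral_measure A E \<longleftrightarrow> is_pvm E \<and> povm_mean E = A"

section \<open>Moments in a state\<close>

text \<open>The operator \<open>X\<surd>\<rho>\<close>, which is meaningful if it is everywhere defined and bounded.\<close>

definition times_sqrt :: "'a::complex_hilbert pop \<Rightarrow> 'a bop \<Rightarrow> 'a bop" where
  "times_sqrt X \<rho> = (THE R. \<forall>x. X (sqrt_op \<rho> *\<^sub>V x) = Some (R *\<^sub>V x))"

text \<open>\<open>Tr[X\<^sup>2\<rho>] < \<infinity>\<close>, that is \<open>X\<surd>\<rho>\<close> is an everywhere defined Hilbert-Schmidt operator.\<close>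

definition finite_second_moment :: "'a::complex_hilbert pop \<Rightarrow> 'a bop \<Rightarrow> bool" where
  "finite_second_moment X \<rho> \<longleftrightarrow>
     (\<exists>R. (\<forall>x. X (sqrt_op \<rho> *\<^sub>V x) = Some (R *\<^sub>V x)) \<and> trace_class (adj R o\<^sub>B R))"

text \<open>\<open>Tr[XY\<rho>]\<close>, read as \<open>Tr[(X\<surd>\<rho>)\<^sup>\<dagger>(Y\<surd>\<rho>)]\<close>, and \<open>Tr[X\<rho>]\<close>, which is the case of the identity
  (the total map \<^const>\<open>Some\<close>) in the first place.\<close>

definition tr_prod :: "'a::complex_hilbert pop \<Rightarrow> 'a pop \<Rightarrow> 'a bop \<Rightarrow> complex" where
  "tr_prod X Y \<rho> = tr (adj (times_sqrt X \<rho>) o\<^sub>B times_sqrt Y \<rho>)"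

definition tr_mean :: "'a::complex_hilbert pop \<Rightarrow> 'a bop \<Rightarrow> complex" where
  "tr_mean X \<rho> = tr_prod Some X \<rho>"

definition tr_commutator :: "'a::complex_hilbert pop \<Rightarrow> 'a pop \<Rightarrow> 'a bop \<Rightarrow> complex" where
  "tr_commutator X Y \<rho> = tr_prod X Y \<rho> - tr_prod Y X \<rho>"

text \<open>Below, \<^const>\<open>Re\<close> is applied only to traces that are real for symmetric operators.\<close>

definition std_dev :: "'a::complex_hilbert pop \<Rightarrow> 'a bop \<Rightarrow> real" where
  "std_dev A \<rho> = sqrt (Re (tr_prod A A \<rho>) - (Re (tr_mean A \<rho>))\<^sup>2)"

text \<open>\<open>Tr[O\<^sup>(\<^sup>2\<^sup>)(P)\<rho>]\<close> is \<open>\<integral> x\<^sup>2 Tr[dP(x)\<rho>]\<close>.\<close>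

definition povm_distance ::
  "'a::complex_hilbert bop \<Rightarrow> (real set \<Rightarrow> 'a bop) \<Rightarrow> 'a pop \<Rightarrow> real" where
  "povm_distance \<rho> P B = sqrt ((LINT t|state_measure P \<rho>. t\<^sup>2)
     - Re (tr_prod (povm_mean P) B \<rho> + tr_prod B (povm_mean P) \<rho>) + Re (tr_prod B B \<rho>))"

definition finite_povm_second_moment ::
  "(real set \<Rightarrow> 'a::complex_hilbert bop) \<Rightarrow> 'a bop \<Rightarrow> bool" where
  "finite_povm_second_moment P \<rho> \<longleftrightarrow> (\<integral>\<^sup>+t. ennreal (t\<^sup>2) \<partial>state_measure P \<rho>) < \<infinity>"

section \<open>Instruments\<close>

text \<open>Maps on the trace class are functions on all bounded operators, constrained only on trace class
  arguments.\<close>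

definition bounded_linear_tc :: "('a::complex_hilbert bop \<Rightarrow> 'a bop) \<Rightarrow> bool" where
  "bounded_linear_tc S \<longleftrightarrow>
     (\<forall>T. trace_class T \<longrightarrow> trace_class (S T)) \<and>
     (\<forall>T U. trace_class T \<and> trace_class U \<longrightarrow> S (T + U) = S T + S U) \<and>
     (\<forall>c T. trace_class T \<longrightarrow> S (c *\<^sub>C T) = c *\<^sub>C S T) \<and>
     (\<exists>K. \<forall>T. trace_class T \<longrightarrow> trace_norm (S T) \<le> K * trace_norm T)"

text \<open>A trace class operator on the n-fold direct sum (the tensor product with an n-dimensional
  space) is an n by n matrix of trace class operators, on which the ampliation of \<open>S\<close> acts
  entrywise.\<close>

definition positive_matrix :: "nat \<Rightarrow> (nat \<Rightarrow> nat \<Rightarrow> 'a::complex_hilbert bop) \<Rightarrow> bool" where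
  "positive_matrix n T \<longleftrightarrow>
     (\<forall>x :: nat \<Rightarrow> 'a. (\<Sum>i<n. \<Sum>j<n. cinner (x i) (T i j *\<^sub>V x j)) \<in> \<real>\<^sub>\<ge>\<^sub>0)"

definition completely_positive_tc :: "('a::complex_hilbert bop \<Rightarrow> 'a bop) \<Rightarrow> bool" where
  "completely_positive_tc S \<longleftrightarrow>
     (\<forall>n T. (\<forall>i<n. \<forall>j<n. trace_class (T i j)) \<and> positive_matrix n T
        \<longrightarrow> positive_matrix n (\<lambda>i j. S (T i j)))"

definition cp_instrument :: "(real set \<Rightarrow> 'a::complex_hilbert bop \<Rightarrow> 'a bop) \<Rightarrow> bool" where
  "cp_instrument \<I> \<longleftrightarrow>
     (\<forall>\<Delta>\<in>sets borel. bounded_linear_tc (\<I> \<Delta>) \<and> completely_positive_tc (\<I> \<Delta>)) \<and>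
     (\<forall>D T. range D \<subseteq> sets borel \<and> disjoint_family D \<and> trace_class T \<longrightarrow>
        (\<lambda>n. trace_norm ((\<Sum>k<n. \<I> (D k) T) - \<I> (\<Union>k. D k) T)) \<longlonglongrightarrow> 0) \<and>
     (\<forall>T. trace_class T \<longrightarrow> tr (\<I> UNIV T) = tr T)"

definition dual_map :: "('a::complex_hilbert bop \<Rightarrow> 'a bop) \<Rightarrow> 'a bop \<Rightarrow> 'a bop" where
  "dual_map S X = (THE Y. \<forall>T. trace_class T \<longrightarrow> tr (X o\<^sub>B S T) = tr (Y o\<^sub>B T))"

definition nonselective :: "(real set \<Rightarrow> 'a::complex_hilbert bop \<Rightarrow> 'a bop) \<Rightarrow> 'a bop \<Rightarrow> 'a bop" where
  "nonselective \<I> = \<I> UNIV"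

text \<open>The apparatus with instrument \<open>\<I>\<close> precisely measures the observable with spectral measure \<open>E\<close>:
  \<open>Tr[\<I>(\<Delta>)\<rho>]\<close> is the probability of the outcome \<open>\<Delta>\<close>.\<close>

definition precisely_measures ::
  "(real set \<Rightarrow> 'a::complex_hilbert bop \<Rightarrow> 'a bop) \<Rightarrow> (real set \<Rightarrow> 'a bop) \<Rightarrow> bool" where
  "precisely_measures \<I> E \<longleftrightarrow>
     (\<forall>\<Delta>\<in>sets borel. \<forall>\<rho>. state \<rho> \<longrightarrow> tr (\<I> \<Delta> \<rho>) = tr (E \<Delta> o\<^sub>B \<rho>))"

definition disturbed_povm ::
  "(real set \<Rightarrow> 'a::complex_hilbert bop \<Rightarrow> 'a bop) \<Rightarrow> (real set \<Rightarrow> 'a bop) \<Rightarrow> real set \<Rightarrow> 'a bop" where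
  "disturbed_povm \<I> E \<Delta> = dual_map (nonselective \<I>) (E \<Delta>)"

definition rms_disturbance ::
  "(real set \<Rightarrow> 'a::complex_hilbert bop \<Rightarrow> 'a bop) \<Rightarrow> 'a pop \<Rightarrow> (real set \<Rightarrow> 'a bop) \<Rightarrow> 'a bop \<Rightarrow> real"
  where "rms_disturbance \<I> B E \<rho> = povm_distance \<rho> (disturbed_povm \<I> E) B"

end

theory Submission
  imports Defs
begin

text \<open>Let \<open>\<Pi> = E\<^sub>A\<close> be the POVM of the instrument and \<open>C = O(T\<^sup>*E\<^sub>B)\<close>. Since \<open>\<Pi>\<close> is projection valued, every
  \<open>T\<^sup>*X\<close> commutes with it: for \<open>0 \<le> X \<le> 1\<close> the operator \<open>\<I>(\<Delta>)\<^sup>*X\<close> lies between \<open>0\<close> and the projection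
  \<open>\<Pi>(\<Delta>)\<close>, and \<open>\<I>(-\<Delta>)\<^sup>*X\<close> between \<open>0\<close> and its complement. Hence \<open>[A,C]\<close> vanishes in \<open>\<rho>\<close> and
  \<open>Tr([A,B]\<rho>) = Tr([A - a, B - C]\<rho>)\<close> for real \<open>a\<close>. The Cauchy-Schwarz inequality for the
  Hilbert-Schmidt operators \<open>(A - a)\<surd>\<rho>\<close> and \<open>(B - C)\<surd>\<rho>\<close> bounds this by \<open>2\<parallel>(A - a)\<surd>\<rho>\<parallel> \<parallel>(B - C)\<surd>\<rho>\<parallel>\<close>.
  For \<open>a = Tr(A\<rho>)\<close> the first norm is \<open>\<sigma>(A,\<rho>)\<close>; the second is at most \<open>\<eta>(B,\<rho>)\<close>, because
  \<open>\<parallel>Cy\<parallel>\<^sup>2 \<le> \<integral> t\<^sup>2 d\<langle>y|T\<^sup>*E\<^sub>B(t)|y\<rangle>\<close>.\<close>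

section \<open>Inner products\<close>

text \<open>\<open>A\<close>, \<open>B\<close> and C may be unbounded, and the moment hypotheses
  control them only on the range of the root of \<rho>, where a product such as AC need not be
  defined. So each operator X is replaced by the Hilbert-Schmidt operator X times that root, and the
  vanishing of [A, C] becomes the statement that <Ay, Cy> is real, which survives limits of finite
  sums of the operators in the two measures. The bound on the norm of Cy rests on Cauchy-Schwarz for
  densities: if p, q and h are the densities of <x|P|x>, <y|P|y> and <x|P|y>, then |h|^2 is at most
  pq almost everywhere. For a POVM that is not projection valued the bound can be strict, so the
  disturbance only dominates the Hilbert-Schmidt norm. The shift by a is harmless because
  Tr(B\<rho>) and Tr(C\<rho>) are real, so that the imaginary part of the inner product is
  unchanged. Adjoint, root, dual map and mean are definite descriptions, each of which says
  something only after existence and uniqueness are shown. Roots come from an iteration, adjoints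
  and duals from Riesz representation, means from step functions.\<close>

lemma cinner_add_left: "cinner (x + y) (z :: 'a::complex_hilbert) = cinner x z + cinner y z"
  by (metis cinner_add_right cinner_commute complex_cnj_add)

lemma cinner_scaleC_left: "cinner (c *\<^sub>C x) (y :: 'a::complex_hilbert) = cnj c * cinner x y"
  by (metis cinner_commute cinner_scaleC_right complex_cnj_mult)

lemma cinner_zero_right: "cinner x (0 :: 'a::complex_hilbert) = 0"
  using cinner_add_right[of x 0 0] by simp

lemma norm_sq_add:
  "(norm (x + y))\<^sup>2 = (norm x)\<^sup>2 + 2 * Re (cinner x y) + (norm (y :: 'a::complex_hilbert))\<^sup>2"
proof -
  have "cinner (x + y) (x + y) = cinner x x + (cinner x y + cinner y x) + cinner y y"
    by (simp add: cinner_add_left cinner_add_right)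
  also have "cinner x y + cinner y x = complex_of_real (2 * Re (cinner x y))"
    by (subst cinner_commute[of y x]) (simp add: complex_add_cnj)
  finally have "complex_of_real ((norm (x + y))\<^sup>2)
      = complex_of_real ((norm x)\<^sup>2 + 2 * Re (cinner x y) + (norm y)\<^sup>2)"
    unfolding cinner_self of_real_add .
  then show ?thesis
    by (simp only: of_real_eq_iff)
qed

lemma cinner_cauchy_schwarz: "cmod (cinner x y) \<le> norm x * norm (y :: 'a::complex_hilbert)"
proof (cases "y = 0")
  case True
  then show ?thesis by (simp add: cinner_zero_right)
next
  case False
  \<comment> \<open>This \<open>c\<close> makes \<open>x + c *\<^sub>C y\<close> orthogonal to
    \<open>y\<close>, so its squared norm is the gap in the inequality divided by the squared norm
    of \<open>y\<close>.\<close>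
  define c where "c = - (cinner y x / (norm y)\<^sup>2)"
  have ny: "(norm y)\<^sup>2 > 0" using False by simp
  have "cinner x y * cinner y x = complex_of_real ((cmod (cinner x y))\<^sup>2)"
    by (metis cinner_commute complex_norm_square)
  then have "c * cinner x y = - complex_of_real ((cmod (cinner x y))\<^sup>2 / (norm y)\<^sup>2)"
    by (simp add: c_def mult.commute)
  then have 1: "Re (cinner x (c *\<^sub>C y)) = - (cmod (cinner x y))\<^sup>2 / (norm y)\<^sup>2"
    by (simp add: cinner_scaleC_right del: of_real_divide of_real_power)
  have "cmod c = cmod (cinner x y) / (norm y)\<^sup>2"
    unfolding c_def by (subst cinner_commute) (simp add: norm_divide norm_power)
  then have "(norm (c *\<^sub>C y))\<^sup>2 = (cmod (cinner x y))\<^sup>2 / (norm y)\<^sup>2"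
    using ny by (simp add: norm_scaleC power_mult_distrib power_divide)
      (simp add: divide_simps flip: power_add)
  then have "(norm (x + c *\<^sub>C y))\<^sup>2 = (norm x)\<^sup>2 - (cmod (cinner x y))\<^sup>2 / (norm y)\<^sup>2"
    unfolding norm_sq_add 1 by simp
  then have "(cmod (cinner x y))\<^sup>2 / (norm y)\<^sup>2 \<le> (norm x)\<^sup>2"
    by (metis diff_ge_0_iff_ge zero_le_power2)
  then have "(cmod (cinner x y))\<^sup>2 \<le> (norm x * norm y)\<^sup>2"
    using ny by (simp add: divide_le_eq power_mult_distrib)
  then show ?thesis
    by (simp add: power2_le_iff_abs_le)
qed

lemma bounded_bilinear_cinner: "bounded_bilinear (cinner :: 'a::complex_hilbert \<Rightarrow> 'a \<Rightarrow> complex)"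
proof
  show "\<exists>K. \<forall>a b :: 'a. norm (cinner a b) \<le> norm a * norm b * K"
    by (rule exI[of _ 1]) (simp add: cinner_cauchy_schwarz)
qed (simp_all add: cinner_add_left cinner_add_right scaleR_scaleC cinner_scaleC_left
    cinner_scaleC_right scaleC_complex_def)

interpretation cinner: bounded_bilinear "cinner :: 'a::complex_hilbert \<Rightarrow> 'a \<Rightarrow> complex"
  by (rule bounded_bilinear_cinner)

lemma bounded_bilinear_scaleC:
  "bounded_bilinear (scaleC :: complex \<Rightarrow> 'a::complex_hilbert \<Rightarrow> 'a)"
proof
  show "\<exists>K. \<forall>a (b :: 'a). norm (a *\<^sub>C b) \<le> norm a * norm b * K"
    by (rule exI[of _ 1]) (simp add: norm_scaleC)
qed (simp_all add: scaleC_add_left scaleC_add_right scaleR_scaleC scaleC_scaleC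
    scaleC_complex_def mult.commute)

interpretation scaleC: bounded_bilinear "scaleC :: complex \<Rightarrow> 'a::complex_hilbert \<Rightarrow> 'a"
  by (rule bounded_bilinear_scaleC)

lemma Re_cinner_self: "Re (cinner x x) = (norm (x :: 'a::complex_hilbert))\<^sup>2"
  by (simp add: cinner_self del: of_real_power)

lemma norm_sq_diff:
  "(norm (x - y))\<^sup>2 = (norm x)\<^sup>2 - 2 * Re (cinner x y) + (norm (y :: 'a::complex_hilbert))\<^sup>2"
  using norm_sq_add[of x "- y"] by (simp add: cinner.minus_right)

lemma cinner_eqI: "(\<And>z. cinner z x = cinner z y) \<Longrightarrow> x = (y :: 'a::complex_hilbert)"
  using cinner_self[of "x - y"] by (simp add: cinner.diff_right del: of_real_power)

lemma norm_leI_cinner: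
  fixes x :: "'a::complex_hilbert"
  assumes "\<And>z. cmod (cinner z x) \<le> K * norm z" "0 \<le> K"
  shows "norm x \<le> K"
proof (cases "x = 0")
  case False
  have "norm x * norm x \<le> K * norm x"
    using assms(1)[of x] by (simp add: cinner_self power2_eq_square norm_mult)
  then show ?thesis using False by simp
qed (use assms in simp)

text \<open>All four vectors are \<open>x\<close> plus a scalar multiple of \<open>y\<close>, which
  matches the densities indexed by scalars in \<open>povm_density\<close>.\<close>

lemma cinner_polarization:
  fixes f :: "'a::complex_hilbert \<Rightarrow> 'a \<Rightarrow> complex"
  assumes "\<And>x y z. f (x + y) z = f x z + f y z" "\<And>x y z. f x (y + z) = f x y + f x z"
    and "\<And>c x y. f (c *\<^sub>C x) y = cnj c * f x y" "\<And>c x y. f x (c *\<^sub>C y) = c * f x y"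
  shows "f x y = (f (x + y) (x + y) - f (x + (-1) *\<^sub>C y) (x + (-1) *\<^sub>C y)
    - \<i> * f (x + \<i> *\<^sub>C y) (x + \<i> *\<^sub>C y) + \<i> * f (x + (-\<i>) *\<^sub>C y) (x + (-\<i>) *\<^sub>C y)) / 4"
  unfolding assms by (simp add: algebra_simps)

section \<open>Bounded operators\<close>

lemma bounded_clinear_bop: "bounded_clinear (bop_apply T)"
  using bop_apply by simp

lemma bounded_linear_bop: "bounded_linear (bop_apply T)"
  using bounded_clinear_bop bounded_clinear_def by blast

lemma bop_scaleC: "T *\<^sub>V (c *\<^sub>C x) = c *\<^sub>C (T *\<^sub>V x)"
  using bounded_clinear_bop bounded_clinear_def by blast

lemmas bop_add = linear_add[OF bounded_linear.linear[OF bounded_linear_bop]]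
lemmas bop_diff = linear_diff[OF bounded_linear.linear[OF bounded_linear_bop]]
lemmas bop_zero = linear_0[OF bounded_linear.linear[OF bounded_linear_bop]]
lemmas bop_sum = linear_sum[OF bounded_linear.linear[OF bounded_linear_bop]]
lemma bop_eqI: "(\<And>x. S *\<^sub>V x = T *\<^sub>V x) \<Longrightarrow> S = T"
  by (metis bop_apply_inject ext)

lemma bop_eqI_cinner: "(\<And>x y. cinner x (S *\<^sub>V y) = cinner x (T *\<^sub>V y)) \<Longrightarrow> S = T"
  by (rule bop_eqI, rule cinner_eqI)

lemma bop_apply_simps [simp]:
  "0 *\<^sub>V x = 0" "(S + T) *\<^sub>V x = S *\<^sub>V x + T *\<^sub>V x" "(- S) *\<^sub>V x = - (S *\<^sub>V x)"
  "(S - T) *\<^sub>V x = S *\<^sub>V x - T *\<^sub>V x" "(c *\<^sub>C S) *\<^sub>V x = c *\<^sub>C (S *\<^sub>V x)"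
  "id_bop *\<^sub>V x = x" "(S o\<^sub>B T) *\<^sub>V x = S *\<^sub>V (T *\<^sub>V x)"
  by (simp_all add: zero_bop.rep_eq plus_bop.rep_eq uminus_bop.rep_eq
      scaleC_bop.rep_eq id_bop.rep_eq comp_bop.rep_eq diff_conv_add_uminus
      del: add_uminus_conv_diff)

lemma bop_apply_sum: "(\<Sum>i\<in>I. F i) *\<^sub>V x = (\<Sum>i\<in>I. F i *\<^sub>V x)"
  by (induction I rule: infinite_finite_induct) simp_all

lemma bop_bounded:
  obtains K where "0 \<le> K" "\<And>x. norm (T *\<^sub>V x) \<le> K * norm x"
  using bounded_linear.nonneg_bounded[OF bounded_linear_bop, of T] by (metis mult.commute)

lemma bop_of_fun:
  fixes f :: "'a::complex_hilbert \<Rightarrow> 'a"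
  assumes "\<And>x y. f (x + y) = f x + f y" "\<And>c x. f (c *\<^sub>C x) = c *\<^sub>C f x"
    and "\<And>x. norm (f x) \<le> K * norm x"
  obtains T where "\<And>x. T *\<^sub>V x = f x"
proof -
  have "bounded_clinear f"
    unfolding bounded_clinear_def
    using assms
    by (intro conjI allI bounded_linear_intro[of f K]) (simp_all add: scaleR_scaleC mult.commute[of _ K])
  then show ?thesis
    using that[of "Bop f"] by (simp add: Bop_inverse)
qed

section \<open>Orthonormal expansions\<close>

definition orthonormal :: "'a::complex_hilbert set \<Rightarrow> bool" where
  "orthonormal B \<longleftrightarrow> (\<forall>e\<in>B. \<forall>f\<in>B. cinner e f = (if e = f then 1 else 0))"

lemma orthonormal_cinner_sum:
  assumes "orthonormal B" "finite F" "F \<subseteq> B" "e \<in> B"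
  shows "cinner e (\<Sum>f\<in>F. c f *\<^sub>C f) = (if e \<in> F then c e else 0)"
proof -
  have "cinner e (\<Sum>f\<in>F. c f *\<^sub>C f) = (\<Sum>f\<in>F. if e = f then c f else 0)"
    unfolding cinner.sum_right
    using assms by (intro sum.cong) (auto simp: orthonormal_def cinner_scaleC_right)
  then show ?thesis
    using assms(2) by (simp add: sum.delta)
qed

lemma orthonormal_cinner_sum_sum:
  assumes "orthonormal B" "finite F" "F \<subseteq> B"
  shows "cinner (\<Sum>e\<in>F. c e *\<^sub>C e) (\<Sum>f\<in>F. d f *\<^sub>C f) = (\<Sum>e\<in>F. cnj (c e) * d e)"
  unfolding cinner.sum_left using assms
  by (intro sum.cong) (auto simp: cinner_scaleC_left orthonormal_cinner_sum[of B] subset_iff)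

lemma orthonormal_norm_sum:
  assumes "orthonormal B" "finite F" "F \<subseteq> B"
  shows "(norm (\<Sum>e\<in>F. c e *\<^sub>C e))\<^sup>2 = (\<Sum>e\<in>F. (cmod (c e))\<^sup>2)"
proof -
  have "complex_of_real ((norm (\<Sum>e\<in>F. c e *\<^sub>C e))\<^sup>2) = complex_of_real (\<Sum>e\<in>F. (cmod (c e))\<^sup>2)"
    unfolding cinner_self[symmetric] orthonormal_cinner_sum_sum[OF assms]
    by (simp add: complex_norm_square mult.commute del: of_real_power)
  then show ?thesis
    by (simp only: of_real_eq_iff)
qed

lemma bessel_remainder:
  assumes "orthonormal B" "finite F" "F \<subseteq> B"
  shows "(norm (x - (\<Sum>e\<in>F. cinner e x *\<^sub>C e)))\<^sup>2 = (norm x)\<^sup>2 - (\<Sum>e\<in>F. (cmod (cinner e x))\<^sup>2)"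
proof -
  have "cinner x (\<Sum>e\<in>F. cinner e x *\<^sub>C e) = (\<Sum>e\<in>F. cinner e x * cnj (cinner e x))"
    unfolding cinner.sum_right cinner_scaleC_right by (simp flip: cinner_commute)
  then have "Re (cinner x (\<Sum>e\<in>F. cinner e x *\<^sub>C e)) = (\<Sum>e\<in>F. (cmod (cinner e x))\<^sup>2)"
    by (simp flip: complex_norm_square of_real_power of_real_sum)
  then show ?thesis
    unfolding norm_sq_diff orthonormal_norm_sum[OF assms] by simp
qed

lemma bessel:
  assumes "orthonormal B"
  shows "(\<lambda>e. (cmod (cinner e x))\<^sup>2) summable_on B"
    and "finite F \<Longrightarrow> F \<subseteq> B \<Longrightarrow> (\<Sum>e\<in>F. (cmod (cinner e x))\<^sup>2) \<le> (norm x)\<^sup>2"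
proof -
  show *: "(\<Sum>e\<in>F. (cmod (cinner e x))\<^sup>2) \<le> (norm x)\<^sup>2" if "finite F" "F \<subseteq> B" for F
    using bessel_remainder[OF assms that, of x]
      zero_le_power2[of "norm (x - (\<Sum>e\<in>F. cinner e x *\<^sub>C e))"] by linarith
  show "(\<lambda>e. (cmod (cinner e x))\<^sup>2) summable_on B"
    by (intro nonneg_bdd_above_summable_on bdd_aboveI2[of _ _ "(norm x)\<^sup>2"]) (auto intro!: *)
qed

text \<open>Riesz-Fischer: for nested finite sets the squared distance of the partial sums is the
  sum of the squared coefficients over the difference. Square summability thus makes the partial
  sums a Cauchy net, and completeness does the rest.\<close>

lemma orthonormal_summable:
  assumes B: "orthonormal B" and c: "(\<lambda>e. (cmod (c e))\<^sup>2) summable_on B"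
  shows "(\<lambda>e. c e *\<^sub>C (e :: 'a::complex_hilbert)) summable_on B"
proof -
  let ?f = "\<lambda>e :: 'a. c e *\<^sub>C e" and ?g = "\<lambda>e. (cmod (c e))\<^sup>2"
  have "\<exists>P. eventually P (finite_subsets_at_top B) \<and>
      (\<forall>F F'. P F \<and> P F' \<longrightarrow> dist (sum ?f F) (sum ?f F') < \<epsilon>)" if "\<epsilon> > 0" for \<epsilon>
  proof -
    \<comment> \<open>The partial sum over any finite set between \<open>F0\<close> and
      \<open>B\<close> is within a third of \<epsilon> of the one over \<open>F0\<close>, so two
      such sums differ by at most two thirds.\<close>
    obtain F0 where F0: "finite F0" "F0 \<subseteq> B" "dist (sum ?g F0) (infsum ?g B) \<le> (\<epsilon> / 3)\<^sup>2"
      using infsum_finite_approximation[OF c zero_less_power, of "\<epsilon> / 3" 2] \<open>\<epsilon> > 0\<close> by auto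
    define P where "P F \<longleftrightarrow> finite F \<and> F0 \<subseteq> F \<and> F \<subseteq> B" for F
    have "dist (sum ?f F) (sum ?f F0) \<le> \<epsilon> / 3" if "P F" for F
    proof -
      from that have F: "finite F" "F0 \<subseteq> F" "F \<subseteq> B" by (auto simp: P_def)
      then have "sum ?f F - sum ?f F0 = sum ?f (F - F0)"
        by (simp add: sum_diff)
      then have "(dist (sum ?f F) (sum ?f F0))\<^sup>2 = sum ?g (F - F0)"
        using orthonormal_norm_sum[OF B, of "F - F0" c] F by (auto simp: dist_norm)
      also have "\<dots> = sum ?g F - sum ?g F0"
        using F by (simp add: sum_diff)
      also have "sum ?g F \<le> infsum ?g B"
        using F by (intro finite_sum_le_infsum c) auto
      also have "infsum ?g B - sum ?g F0 \<le> (\<epsilon> / 3)\<^sup>2"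
        using F0(3) by (simp add: dist_real_def)
      finally show ?thesis
        using \<open>\<epsilon> > 0\<close> by (simp add: power2_le_iff_abs_le)
    qed
    note close = this
    have "dist (sum ?f F) (sum ?f F') < \<epsilon>" if "P F" "P F'" for F F'
      using close[of F] close[of F'] that \<open>\<epsilon> > 0\<close>
        dist_triangle2[of "sum ?f F" "sum ?f F'" "sum ?f F0"] by linarith
    moreover have "eventually P (finite_subsets_at_top B)"
      unfolding P_def eventually_finite_subsets_at_top using F0 by blast
    ultimately show ?thesis by blast
  qed
  then have "cauchy_filter (filtermap (sum ?f) (finite_subsets_at_top B))"
    by (simp add: cauchy_filter_metric_filtermap)
  moreover have "complete (UNIV :: 'a set)"
    by (meson Cauchy_convergent UNIV_I complete_def convergent_def)
  ultimately obtain L where "(sum ?f \<longlongrightarrow> L) (finite_subsets_at_top B)"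
    using complete_uniform[where S = UNIV] by (force simp add: filterlim_def)
  then show ?thesis
    using summable_on_def has_sum_def by blast
qed

section \<open>Subspaces, orthonormal bases, projections and Riesz representation\<close>

definition csubspace :: "'a::complex_hilbert set \<Rightarrow> bool" where
  "csubspace M \<longleftrightarrow> 0 \<in> M \<and> (\<forall>x\<in>M. \<forall>y\<in>M. x + y \<in> M) \<and> (\<forall>c. \<forall>x\<in>M. c *\<^sub>C x \<in> M)"

lemma csubspace_diff: "csubspace M \<Longrightarrow> x \<in> M \<Longrightarrow> y \<in> M \<Longrightarrow> x - y \<in> M"
  unfolding csubspace_def
  by (metis add_uminus_conv_diff scaleC.minus_left scaleC_one)

lemma csubspace_sum: "csubspace M \<Longrightarrow> (\<And>i. i \<in> I \<Longrightarrow> f i \<in> M) \<Longrightarrow> sum f I \<in> M"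
  by (induction I rule: infinite_finite_induct) (auto simp: csubspace_def)

lemma csubspace_has_sum:
  assumes "csubspace M" "closed M" "\<And>i. i \<in> I \<Longrightarrow> f i \<in> M" "(f has_sum s) I"
  shows "s \<in> M"
proof (rule Lim_in_closed_set[OF assms(2)])
  show "(sum f \<longlongrightarrow> s) (finite_subsets_at_top I)"
    using assms(4) by (simp add: has_sum_def)
  show "\<forall>\<^sub>F F in finite_subsets_at_top I. sum f F \<in> M"
    using assms by (intro eventually_finite_subsets_at_top_weakI csubspace_sum) auto
qed simp

lemma csubspace_UNIV: "csubspace UNIV"
  by (simp add: csubspace_def)

text \<open>A maximal orthonormal subset of \<open>M\<close>, given by Zorn's lemma, is total: a
  nonzero vector of \<open>M\<close> orthogonal to it could be normalized and adjoined.\<close>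

lemma ex_orthonormal_basis:
  fixes M :: "'a::complex_hilbert set"
  assumes M: "csubspace M"
  shows "\<exists>B\<subseteq>M. orthonormal B \<and> (\<forall>x\<in>M. (\<forall>e\<in>B. cinner e x = 0) \<longrightarrow> x = 0)"
proof -
  let ?A = "{B. B \<subseteq> M \<and> orthonormal B}"
  have "\<exists>B\<in>?A. \<forall>X\<in>?A. B \<subseteq> X \<longrightarrow> X = B"
  proof (rule subset_Zorn_nonempty)
    show "?A \<noteq> {}" by (auto simp: orthonormal_def intro: exI[of _ "{}"])
    fix \<C> assume "\<C> \<noteq> {}" and ch: "subset.chain ?A \<C>"
    have "orthonormal (\<Union>\<C>)"
      unfolding orthonormal_def
    proof (intro ballI)
      fix e f assume "e \<in> \<Union>\<C>" "f \<in> \<Union>\<C>"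
      then obtain X where "X \<in> \<C>" "e \<in> X" "f \<in> X"
        using ch by (auto simp: subset_chain_def) blast
      then show "cinner e f = (if e = f then 1 else 0)"
        using ch by (auto simp: subset_chain_def orthonormal_def)
    qed
    then show "\<Union>\<C> \<in> ?A"
      using ch by (auto simp: subset_chain_def)
  qed
  then obtain B where "B \<in> ?A" and "\<forall>X\<in>?A. B \<subseteq> X \<longrightarrow> X = B" ..
  then have B: "B \<subseteq> M" "orthonormal B" and
    max: "\<And>X. X \<subseteq> M \<Longrightarrow> orthonormal X \<Longrightarrow> B \<subseteq> X \<Longrightarrow> X = B" by simp_all
  have "x = 0" if x: "x \<in> M" "\<forall>e\<in>B. cinner e x = 0" for x
  proof (rule ccontr)
    assume "x \<noteq> 0"
    define u where "u = complex_of_real (1 / norm x) *\<^sub>C x"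
    have u: "u \<in> M" "cinner u u = 1"
      using M x(1) \<open>x \<noteq> 0\<close>
      by (auto simp: u_def csubspace_def cinner_self norm_scaleC norm_divide)
    have "cinner e u = 0" "cinner u e = 0" if "e \<in> B" for e
      using x(2) that cinner_commute[of x e] by (auto simp: u_def cinner_scaleC_left cinner_scaleC_right)
    then have "orthonormal (insert u B)"
      using B(2) u by (auto simp: orthonormal_def)
    then have "insert u B = B"
      using u B by (intro max) auto
    then have "u \<in> B" by blast
    then show False
      using \<open>\<And>e. e \<in> B \<Longrightarrow> cinner e u = 0\<close>[of u] u by simp
  qed
  with B show ?thesis by blast
qed

lemma orthonormal_has_sum_orthogonal:
  assumes "orthonormal B" "((\<lambda>e. cinner e x *\<^sub>C e) has_sum p) B" "f \<in> B"
  shows "cinner f (x - p) = 0"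
proof -
  have "((\<lambda>e. cinner f (cinner e x *\<^sub>C e)) has_sum cinner f p) B"
    using has_sum_bounded_linear[OF cinner.bounded_linear_right assms(2)] by (simp add: o_def)
  moreover have "((\<lambda>e. cinner f (cinner e x *\<^sub>C e)) has_sum cinner f x) B"
    using assms by (intro has_sum_finite_neutralI[of "{f}"])
      (auto simp: orthonormal_def cinner_scaleC_right)
  ultimately have "cinner f p = cinner f x"
    using has_sum_unique by blast
  then show ?thesis by (simp add: cinner.diff_right)
qed

lemma orthonormal_expansion:
  assumes M: "csubspace M" "closed M" and B: "B \<subseteq> M" "orthonormal B"
    and total: "\<forall>x\<in>M. (\<forall>e\<in>B. cinner e x = 0) \<longrightarrow> x = 0" and x: "x \<in> M"
  shows "((\<lambda>e. cinner e x *\<^sub>C e) has_sum x) B"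
proof -
  let ?p = "\<Sum>\<^sub>\<infinity>e\<in>B. cinner e x *\<^sub>C e"
  have p: "((\<lambda>e. cinner e x *\<^sub>C e) has_sum ?p) B"
    by (intro has_sum_infsum orthonormal_summable B bessel)
  have "?p \<in> M"
    using M B p by (intro csubspace_has_sum[OF _ _ _ p]) (auto simp: csubspace_def)
  then have "x - ?p = 0"
    using total csubspace_diff[OF M(1) x] orthonormal_has_sum_orthogonal[OF B(2) p] by blast
  then show ?thesis using p by simp
qed

text \<open>Bessel's inequality bounds the partial sums of the expansion along a basis of
  \<open>M\<close>, and closedness keeps the limit in \<open>M\<close>. The operator serves to
  extend maps from the closure of a range to the whole space.\<close>

lemma ex_projection:
  fixes M :: "'a::complex_hilbert set"
  assumes M: "csubspace M" "closed M"
  obtains P :: "'a bop"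
  where "\<And>x. P *\<^sub>V x \<in> M" "\<And>x. x \<in> M \<Longrightarrow> P *\<^sub>V x = x" "\<And>x. norm (P *\<^sub>V x) \<le> norm x"
proof -
  obtain B where B: "B \<subseteq> M" "orthonormal B" "\<forall>x\<in>M. (\<forall>e\<in>B. cinner e x = 0) \<longrightarrow> x = 0"
    using ex_orthonormal_basis[OF M(1)] by blast
  define p where "p x = (\<Sum>\<^sub>\<infinity>e\<in>B. cinner e x *\<^sub>C e)" for x
  have p: "((\<lambda>e. cinner e x *\<^sub>C e) has_sum p x) B" for x
    unfolding p_def by (intro has_sum_infsum orthonormal_summable B bessel)
  have add: "p (x + y) = p x + p y" for x y
    using has_sum_add[OF p[of x] p[of y]] has_sum_unique[OF p]
    by (simp add: cinner_add_right scaleC_add_left)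
  have scale: "p (c *\<^sub>C x) = c *\<^sub>C p x" for c x
    using has_sum_bounded_linear[OF bounded_linear_scaleC p[of x], of c] has_sum_unique[OF p]
    by (simp add: o_def scaleC_scaleC cinner_scaleC_right)
  have "norm (p x) \<le> 1 * norm x" for x
  proof (rule tendsto_upperbound)
    show "((\<lambda>F. norm (\<Sum>e\<in>F. cinner e x *\<^sub>C e)) \<longlongrightarrow> norm (p x)) (finite_subsets_at_top B)"
      using p[of x] by (intro tendsto_norm) (simp add: has_sum_def)
    show "\<forall>\<^sub>F F in finite_subsets_at_top B. norm (\<Sum>e\<in>F. cinner e x *\<^sub>C e) \<le> 1 * norm x"
    proof (rule eventually_finite_subsets_at_top_weakI)
      fix F assume F: "finite F" "F \<subseteq> B"
      have "(norm (\<Sum>e\<in>F. cinner e x *\<^sub>C e))\<^sup>2 \<le> (norm x)\<^sup>2"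
        unfolding orthonormal_norm_sum[OF B(2) F] using F B by (intro bessel)
      then show "norm (\<Sum>e\<in>F. cinner e x *\<^sub>C e) \<le> 1 * norm x"
        by (simp add: power2_le_iff_abs_le)
    qed
  qed simp
  with add scale obtain P where P: "\<And>x. P *\<^sub>V x = p x"
    using bop_of_fun by blast
  show ?thesis
  proof
    show "P *\<^sub>V x \<in> M" for x
      unfolding P using M B by (intro csubspace_has_sum[OF _ _ _ p]) (auto simp: csubspace_def)
    show "P *\<^sub>V x = x" if "x \<in> M" for x
      unfolding P using orthonormal_expansion[OF M B that] p has_sum_unique by blast
    show "norm (P *\<^sub>V x) \<le> norm x" for x
      unfolding P using \<open>\<And>x. norm (p x) \<le> 1 * norm x\<close>[of x] by simp
  qed
qed

lemma is_onb_orthonormal: "is_onb B \<Longrightarrow> orthonormal B"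
  by (simp add: is_onb_def orthonormal_def)

lemma is_onb_some_onb: "is_onb (some_onb :: 'a::complex_hilbert set)"
proof -
  obtain B :: "'a set" where "B \<subseteq> UNIV" "orthonormal B"
    "\<forall>x\<in>UNIV. (\<forall>e\<in>B. cinner e x = 0) \<longrightarrow> x = 0"
    using ex_orthonormal_basis[OF csubspace_UNIV] by blast
  then have "is_onb B" by (simp add: is_onb_def orthonormal_def)
  then show ?thesis unfolding some_onb_def by (rule someI)
qed

lemma onb_expansion: "is_onb B \<Longrightarrow> ((\<lambda>e. cinner e x *\<^sub>C e) has_sum x) B"
  by (rule orthonormal_expansion[OF csubspace_UNIV]) (auto simp: is_onb_def orthonormal_def)

lemma parseval_cinner: "is_onb B \<Longrightarrow> ((\<lambda>e. cinner x e * cinner e y) has_sum cinner x y) B"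
  using has_sum_bounded_linear[OF cinner.bounded_linear_right onb_expansion, of B x y]
  by (simp add: o_def cinner_scaleC_right mult.commute)

lemma parseval: "is_onb B \<Longrightarrow> ((\<lambda>e. (cmod (cinner e x))\<^sup>2) has_sum (norm x)\<^sup>2) B"
proof -
  assume "is_onb B"
  then have "((\<lambda>e. cinner x e * cinner e x) has_sum complex_of_real ((norm x)\<^sup>2)) B"
    using parseval_cinner[of B x x] by (simp add: cinner_self)
  moreover have "cinner x e * cinner e x = complex_of_real ((cmod (cinner e x))\<^sup>2)" for e
    by (subst cinner_commute) (simp add: complex_norm_square mult.commute del: of_real_power)
  ultimately show ?thesis
    by (simp only: has_sum_of_real_iff)
qed

text \<open>The representing vector must have the coefficients \<open>cnj (f e)\<close>; the point
  is their square summability, which the bound on \<open>f\<close> forces.\<close>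

lemma riesz_representation:
  fixes f :: "'a::complex_hilbert \<Rightarrow> complex"
  assumes add: "\<And>x y. f (x + y) = f x + f y" and scale: "\<And>c x. f (c *\<^sub>C x) = c * f x"
    and bound: "\<And>x. cmod (f x) \<le> K * norm x"
  obtains z where "\<And>x. f x = cinner z x"
proof -
  obtain B :: "'a set" where onb: "is_onb B" using is_onb_some_onb by blast
  note B = is_onb_orthonormal[OF onb]
  have lin: "bounded_linear f"
    by (rule bounded_linear_intro[of f K])
      (use add scale bound in \<open>simp_all add: scaleR_scaleC scaleC_complex_def mult.commute\<close>)
  have "(\<Sum>e\<in>F. (cmod (f e))\<^sup>2) \<le> K\<^sup>2" if F: "finite F" "F \<subseteq> B" for F
  proof -
    \<comment> \<open>For this \<open>?v\<close> both \<open>f ?v\<close> and the squared norm of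
      \<open>?v\<close> equal \<open>?s\<close>, so the bound on \<open>f\<close> reads
      \<open>?s \<le> K * sqrt ?s\<close>.\<close>
    let ?s = "\<Sum>e\<in>F. (cmod (f e))\<^sup>2" and ?v = "\<Sum>e\<in>F. cnj (f e) *\<^sub>C e"
    have "f ?v = (\<Sum>e\<in>F. cnj (f e) * f e)"
      by (simp add: linear_sum[OF bounded_linear.linear[OF lin]] scale)
    also have "\<dots> = complex_of_real ?s"
      by (simp add: complex_norm_square mult.commute del: of_real_power)
    finally have "?s \<le> K * norm ?v"
      using bound[of ?v] by (simp add: abs_of_nonneg sum_nonneg del: of_real_sum)
    then have "?s\<^sup>2 \<le> (K * norm ?v)\<^sup>2"
      by (intro power_mono sum_nonneg) auto
    also have "\<dots> = K\<^sup>2 * ?s"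
      using orthonormal_norm_sum[OF B F, of "\<lambda>e. cnj (f e)"] by (simp add: power_mult_distrib)
    finally have "?s * ?s \<le> K\<^sup>2 * ?s" by (simp add: power2_eq_square)
    moreover have "?s \<ge> 0" by (simp add: sum_nonneg)
    ultimately show ?thesis
      by (cases "?s = 0") (simp, metis less_eq_real_def mult_le_cancel_right_pos)
  qed
  then have "(\<lambda>e. (cmod (cnj (f e)))\<^sup>2) summable_on B"
    by (intro nonneg_bdd_above_summable_on bdd_aboveI2[of _ _ "K\<^sup>2"]) auto
  then have "(\<lambda>e. cnj (f e) *\<^sub>C e) summable_on B"
    by (rule orthonormal_summable[OF B])
  then obtain z where z: "((\<lambda>e. cnj (f e) *\<^sub>C e) has_sum z) B"
    by (auto simp: summable_on_def)
  have ze: "f e = cinner z e" if "e \<in> B" for e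
  proof -
    have "((\<lambda>d. cinner e (cnj (f d) *\<^sub>C d)) has_sum cinner e z) B"
      using has_sum_bounded_linear[OF cinner.bounded_linear_right z] by (simp add: o_def)
    moreover have "((\<lambda>d. cinner e (cnj (f d) *\<^sub>C d)) has_sum cnj (f e)) B"
      using that B by (intro has_sum_finite_neutralI[of "{e}"])
        (auto simp: orthonormal_def cinner_scaleC_right)
    ultimately have "cinner e z = cnj (f e)" by (rule has_sum_unique)
    then show ?thesis by (subst cinner_commute) simp
  qed
  have "f x = cinner z x" for x
  proof (rule has_sum_unique)
    show "((\<lambda>e. f (cinner e x *\<^sub>C e)) has_sum f x) B"
      using has_sum_bounded_linear[OF lin onb_expansion[OF onb]] by (simp add: o_def)
    have "((\<lambda>e. cinner z e * cinner e x) has_sum cinner z x) B"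
      by (rule parseval_cinner[OF onb])
    then show "((\<lambda>e. f (cinner e x *\<^sub>C e)) has_sum cinner z x) B"
      by (rule has_sum_cong[THEN iffD1, rotated]) (simp add: scale ze mult.commute)
  qed
  then show ?thesis using that by blast
qed

lemma bop_of_form:
  fixes b :: "'a::complex_hilbert \<Rightarrow> 'a \<Rightarrow> complex"
  assumes "\<And>x y z. b (x + y) z = b x z + b y z" "\<And>x y z. b x (y + z) = b x y + b x z"
    and "\<And>c x y. b (c *\<^sub>C x) y = cnj c * b x y" "\<And>c x y. b x (c *\<^sub>C y) = c * b x y"
    and bound: "\<And>x y. cmod (b x y) \<le> K * norm x * norm y"
  obtains T where "\<And>x y. cinner x (T *\<^sub>V y) = b x y"
proof -
  have "\<exists>z. \<forall>x. cnj (b x y) = cinner z x" for y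
    by (rule riesz_representation[of "\<lambda>x. cnj (b x y)" "K * norm y"])
      (use assms in \<open>auto simp: mult_ac\<close>)
  then obtain f where f: "\<And>x y. cnj (b x y) = cinner (f y) x" by metis
  have f: "cinner x (f y) = b x y" for x y
    using f[of x y] cinner_commute[of x "f y"] by (metis complex_cnj_cnj)
  have "f (y + z) = f y + f z" for y z
    by (rule cinner_eqI) (simp add: cinner_add_right f assms)
  moreover have "f (c *\<^sub>C y) = c *\<^sub>C f y" for c y
    by (rule cinner_eqI) (simp add: cinner_scaleC_right f assms)
  moreover have "norm (f y) \<le> \<bar>K\<bar> * norm y" for y
  proof (rule norm_leI_cinner)
    fix z
    have "cmod (cinner z (f y)) \<le> K * norm z * norm y"
      unfolding f by (rule bound)
    also have "\<dots> \<le> \<bar>K\<bar> * norm z * norm y"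
      by (intro mult_right_mono) auto
    finally show "cmod (cinner z (f y)) \<le> \<bar>K\<bar> * norm y * norm z"
      by (simp add: mult_ac)
  qed simp
  ultimately obtain T where "\<And>y. T *\<^sub>V y = f y"
    using bop_of_fun by blast
  then show ?thesis by (intro that[of T]) (simp add: f)
qed

section \<open>Adjoints\<close>

text \<open>Since \<open>adj\<close> is a definite description, an operator with this property has
  to be exhibited first. It represents the form \<open>cinner (T *\<^sub>V x) y\<close>.\<close>

lemma cinner_bop_left: "cinner x (T *\<^sub>V y) = cinner (adj T *\<^sub>V x) y"
proof -
  obtain K where K: "\<And>x. norm (T *\<^sub>V x) \<le> K * norm x" using bop_bounded by blast
  have "cmod (cinner (T *\<^sub>V x) y) \<le> K * norm x * norm y" for x y
    using cinner_cauchy_schwarz[of "T *\<^sub>V x" y] mult_right_mono[OF K[of x] norm_ge_zero[of y]]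
    by linarith
  then obtain S where S: "\<And>x y. cinner x (S *\<^sub>V y) = cinner (T *\<^sub>V x) y"
    using bop_of_form[of "\<lambda>x y. cinner (T *\<^sub>V x) y" K]
    by (auto simp: bop_add bop_scaleC cinner_add_left cinner_add_right cinner_scaleC_left
        cinner_scaleC_right)
  have "\<forall>x y. cinner x (T *\<^sub>V y) = cinner (adj T *\<^sub>V x) y"
    unfolding adj_def
  proof (rule theI)
    show S': "\<forall>x y. cinner x (T *\<^sub>V y) = cinner (S *\<^sub>V x) y"
      using S by (metis cinner_commute)
    fix R assume R: "\<forall>x y. cinner x (T *\<^sub>V y) = cinner (R *\<^sub>V x) y"
    show "R = S"
      by (rule bop_eqI_cinner) (metis R S' cinner_commute)
  qed
  then show ?thesis by blast
qed

lemma cinner_adj_right: "cinner x (adj T *\<^sub>V y) = cinner (T *\<^sub>V x) y"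
  by (subst (1 2) cinner_commute) (simp add: cinner_bop_left)

lemma adj_eqI: "(\<And>x y. cinner x (T *\<^sub>V y) = cinner (S *\<^sub>V x) y) \<Longrightarrow> adj T = S"
  by (rule bop_eqI_cinner) (simp add: cinner_adj_right, metis cinner_commute)

lemma adj_adj [simp]: "adj (adj T) = T"
  by (rule adj_eqI) (rule cinner_adj_right)

lemma adj_comp: "adj (S o\<^sub>B T) = adj T o\<^sub>B adj S"
  by (rule adj_eqI) (simp add: cinner_bop_left)

lemma adj_id [simp]: "adj id_bop = id_bop"
  by (rule adj_eqI) simp

lemma adj_add: "adj (S + T) = adj S + adj T"
  by (rule adj_eqI) (simp add: cinner_add_left cinner_add_right cinner_bop_left)

lemma adj_diff: "adj (S - T) = adj S - adj T"
  by (rule adj_eqI) (simp add: cinner.diff_left cinner.diff_right cinner_bop_left)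

lemma adj_scaleC: "adj (c *\<^sub>C T) = cnj c *\<^sub>C adj T"
  by (rule adj_eqI) (simp add: cinner_scaleC_left cinner_scaleC_right cinner_bop_left)

section \<open>Positive operators and square roots\<close>

lemma positive_iff: "positive T \<longleftrightarrow> (\<forall>x. 0 \<le> Re (cinner x (T *\<^sub>V x)) \<and> Im (cinner x (T *\<^sub>V x)) = 0)"
  by (simp add: positive_def complex_nonneg_Reals_iff)

lemma positive_Re: "positive T \<Longrightarrow> 0 \<le> Re (cinner x (T *\<^sub>V x))"
  by (simp add: positive_iff)

lemma positive_of_real: "positive T \<Longrightarrow> complex_of_real (Re (cinner x (T *\<^sub>V x))) = cinner x (T *\<^sub>V x)"
  by (simp add: positive_iff complex_eq_iff)

lemma cinner_bop_polarization:
  "cinner x (R *\<^sub>V y) = (cinner (x + y) (R *\<^sub>V (x + y))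
      - cinner (x + (-1) *\<^sub>C y) (R *\<^sub>V (x + (-1) *\<^sub>C y))
      - \<i> * cinner (x + \<i> *\<^sub>C y) (R *\<^sub>V (x + \<i> *\<^sub>C y))
      + \<i> * cinner (x + (-\<i>) *\<^sub>C y) (R *\<^sub>V (x + (-\<i>) *\<^sub>C y))) / 4"
  by (rule cinner_polarization[of "\<lambda>x y. cinner x (R *\<^sub>V y)"])
    (simp_all add: bop_add bop_scaleC cinner_add_left cinner_add_right cinner_scaleC_left
      cinner_scaleC_right)

lemma bop_eqI_quadratic:
  fixes S T :: "'a::complex_hilbert bop"
  assumes "\<And>x. cinner x (S *\<^sub>V x) = cinner x (T *\<^sub>V x)"
  shows "S = T"
  by (rule bop_eqI_cinner) (subst (1 2) cinner_bop_polarization, simp only: assms)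

lemma self_adjoint_iff_real: "adj T = T \<longleftrightarrow> (\<forall>x. Im (cinner x (T *\<^sub>V x)) = 0)"
proof -
  have *: "cinner x (adj T *\<^sub>V x) = cnj (cinner x (T *\<^sub>V x))" for x
    by (simp add: cinner_adj_right flip: cinner_commute)
  have "adj T = T \<longleftrightarrow> (\<forall>x. cinner x (adj T *\<^sub>V x) = cinner x (T *\<^sub>V x))"
    using bop_eqI_quadratic[of "adj T" T] by auto
  then show ?thesis
    by (simp add: * complex_eq_iff)
qed

lemma positive_adj: "positive T \<Longrightarrow> adj T = T"
  by (simp add: self_adjoint_iff_real positive_iff)

lemma positive_adj_comp: "positive (adj T o\<^sub>B T)"
  by (simp add: positive_iff cinner_adj_right cinner_self del: of_real_power)

text \<open>For a self-adjoint operator the diagonal controls the norm: the diagonal values at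
  \<open>y + z\<close> and \<open>y - z\<close> differ by four times the real part of the
  off-diagonal value, and the parallelogram law adds up the two bounds.\<close>

lemma self_adjoint_norm_le:
  assumes T: "adj T = T" and bound: "\<And>x. \<bar>Re (cinner x (T *\<^sub>V x))\<bar> \<le> m * (norm x)\<^sup>2"
  shows "norm (T *\<^sub>V x) \<le> m * norm x"
proof (cases "T *\<^sub>V x = 0")
  case False
  then have "x \<noteq> 0" by (auto simp: bop_zero)
  have polar: "2 * Re (cinner z (T *\<^sub>V y)) \<le> m * ((norm y)\<^sup>2 + (norm z)\<^sup>2)" for y z
  proof -
    have "cinner y (T *\<^sub>V z) = cnj (cinner z (T *\<^sub>V y))"
      by (metis T cinner_bop_left cinner_commute)
    then have "Re (cinner (y + z) (T *\<^sub>V (y + z))) - Re (cinner (y - z) (T *\<^sub>V (y - z)))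
        = 4 * Re (cinner z (T *\<^sub>V y))"
      by (simp add: bop_add bop_diff cinner_add_left cinner_add_right cinner.diff_left
          cinner.diff_right)
    moreover have "(norm (y + z))\<^sup>2 + (norm (y - z))\<^sup>2 = 2 * ((norm y)\<^sup>2 + (norm z)\<^sup>2)"
      by (simp add: norm_sq_add norm_sq_diff)
    then have "m * (norm (y + z))\<^sup>2 + m * (norm (y - z))\<^sup>2 = 2 * (m * ((norm y)\<^sup>2 + (norm z)\<^sup>2))"
      by (simp only: flip: distrib_left)
    ultimately show ?thesis
      using bound[of "y + z"] bound[of "y - z"] by linarith
  qed
  \<comment> \<open>The rescaling gives the two vectors in \<open>polar\<close> equal norms, where
    the mean of their squared norms is the product of the norms.\<close>
  define c where "c = norm x / norm (T *\<^sub>V x)"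
  have "norm (complex_of_real c *\<^sub>C (T *\<^sub>V x)) = norm x"
    using False by (simp add: c_def norm_scaleC norm_divide)
  moreover have "Re (cinner (complex_of_real c *\<^sub>C (T *\<^sub>V x)) (T *\<^sub>V x)) = norm x * norm (T *\<^sub>V x)"
    using False by (simp add: c_def cinner_scaleC_left Re_cinner_self power2_eq_square flip: of_real_divide)
  ultimately have "2 * (norm x * norm (T *\<^sub>V x)) \<le> m * ((norm x)\<^sup>2 + (norm x)\<^sup>2)"
    using polar[of "complex_of_real c *\<^sub>C (T *\<^sub>V x)" x] by simp
  then have "norm x * norm (T *\<^sub>V x) \<le> norm x * (m * norm x)"
    by (simp add: power2_eq_square algebra_simps)
  then show ?thesis using \<open>x \<noteq> 0\<close> by simp
next
  case True
  have "0 \<le> m * (norm x)\<^sup>2" using bound[of x] by linarith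
  then show ?thesis
    by (cases "x = 0") (use True in \<open>simp_all add: zero_le_mult_iff\<close>)
qed

section \<open>Existence and uniqueness of the positive square root\<close>

lemma bop_limit:
  fixes Y :: "nat \<Rightarrow> 'a::complex_hilbert bop"
  assumes conv: "\<And>x. convergent (\<lambda>n. Y n *\<^sub>V x)" and bound: "\<And>n x. norm (Y n *\<^sub>V x) \<le> K * norm x"
  obtains Z where "\<And>x. (\<lambda>n. Y n *\<^sub>V x) \<longlonglongrightarrow> Z *\<^sub>V x"
proof -
  obtain f where f: "\<And>x. (\<lambda>n. Y n *\<^sub>V x) \<longlonglongrightarrow> f x"
    using conv unfolding convergent_def by metis
  have "f (x + y) = f x + f y" for x y
    using LIMSEQ_unique[OF f[of "x + y"]] tendsto_add[OF f[of x] f[of y]] by (simp add: bop_add)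
  moreover have "f (c *\<^sub>C x) = c *\<^sub>C f x" for c x
    using LIMSEQ_unique[OF f[of "c *\<^sub>C x"]] scaleC.tendsto[OF tendsto_const f[of x]]
    by (simp add: bop_scaleC)
  moreover have "norm (f x) \<le> K * norm x" for x
    using tendsto_upperbound[OF tendsto_norm[OF f[of x]]] bound by simp
  ultimately obtain Z where "\<And>x. Z *\<^sub>V x = f x"
    using bop_of_fun by blast
  then show ?thesis using that[of Z] f by simp
qed

lemma ex_sqrt_contraction:
  fixes T :: "'a::complex_hilbert bop"
  assumes T: "positive T" and T1: "\<And>x. norm (T *\<^sub>V x) \<le> norm x"
  shows "\<exists>S. positive S \<and> S o\<^sub>B S = T"
proof -
  define C where "C = id_bop - T"
  have C_adj: "adj C = C"
    using T by (simp add: C_def adj_diff positive_adj)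
  have C1: "norm (C *\<^sub>V x) \<le> norm x" for x
  proof -
    have "\<bar>Re (cinner x (C *\<^sub>V x))\<bar> \<le> 1 * (norm x)\<^sup>2" for x
    proof -
      have "Re (cinner x (T *\<^sub>V x)) \<le> norm x * norm (T *\<^sub>V x)"
        by (meson abs_Re_le_cmod abs_le_D1 cinner_cauchy_schwarz order_trans)
      also have "\<dots> \<le> norm x * norm x"
        by (intro mult_left_mono T1) simp
      finally show ?thesis
        using positive_Re[OF T, of x]
        by (simp add: C_def cinner.diff_right Re_cinner_self) (simp add: power2_eq_square)
    qed
    from self_adjoint_norm_le[OF C_adj this] show ?thesis by simp
  qed
  \<comment> \<open>The iteration for \<open>Z = 1 - \<surd>T\<close>, which solves \<open>Z = (C + Z\<^sup>2) / 2\<close>. It is dominated in norm by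
    the same iteration for the number \<open>1\<close>.\<close>
  define Y where "Y = rec_nat 0 (\<lambda>_ R. (1 / 2) *\<^sub>C (C + R o\<^sub>B R))"
  define y where "y = rec_nat 0 (\<lambda>_ r :: real. (1 + r\<^sup>2) / 2)"
  have Y: "Y 0 = 0" "\<And>n. Y (Suc n) = (1 / 2) *\<^sub>C (C + Y n o\<^sub>B Y n)"
    and y: "y 0 = 0" "\<And>n. y (Suc n) = (1 + (y n)\<^sup>2) / 2"
    by (simp_all add: Y_def y_def)
  have y01: "0 \<le> y n \<and> y n \<le> 1" for n
    by (induction n) (auto simp: y power_le_one)
  have y_mono: "y n \<le> y (Suc n)" for n
  proof -
    have "y (Suc n) - y n = (1 - y n)\<^sup>2 / 2"
      by (simp add: y power2_eq_square field_simps)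
    moreover have "(1 - y n)\<^sup>2 / 2 \<ge> 0" by simp
    ultimately show ?thesis by linarith
  qed
  have Y_norm: "norm (Y n *\<^sub>V x) \<le> y n * norm x" for n x
  proof (induction n arbitrary: x)
    case (Suc n)
    have "norm (Y n *\<^sub>V Y n *\<^sub>V x) \<le> y n * (y n * norm x)"
      using Suc[of "Y n *\<^sub>V x"] mult_left_mono[OF Suc[of x], of "y n"] y01[of n] by linarith
    then have "norm (C *\<^sub>V x + Y n *\<^sub>V Y n *\<^sub>V x) \<le> (1 + (y n)\<^sup>2) * norm x"
      using norm_triangle_ineq[of "C *\<^sub>V x" "Y n *\<^sub>V Y n *\<^sub>V x"] C1[of x]
      by (simp add: power2_eq_square algebra_simps)
    then show ?case
      by (simp add: Y y norm_scaleC norm_divide)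
  qed (simp add: Y y)
  \<comment> \<open>Steps of the operator iteration are dominated by those of the scalar one. The
    induction rests on \<open>Q o\<^sub>B Q - R o\<^sub>B R = Q o\<^sub>B (Q - R) + (Q - R)
    o\<^sub>B R\<close>, which holds without commutativity.\<close>
  have Y_step: "norm (Y (Suc n) *\<^sub>V x - Y n *\<^sub>V x) \<le> (y (Suc n) - y n) * norm x" for n x
  proof (induction n arbitrary: x)
    case 0
    show ?case
      using C1[of x] by (simp add: Y y bop_zero norm_scaleC norm_divide)
  next
    case (Suc n)
    let ?D = "Y (Suc n) - Y n"
    have "norm (Y (Suc n) *\<^sub>V ?D *\<^sub>V x) \<le> y (Suc n) * ((y (Suc n) - y n) * norm x)"
      using Y_norm[of "Suc n" "?D *\<^sub>V x"] mult_left_mono[OF Suc[of x], of "y (Suc n)"]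
        y01[of "Suc n"] by simp
    moreover have "norm (?D *\<^sub>V Y n *\<^sub>V x) \<le> (y (Suc n) - y n) * (y n * norm x)"
      using Suc[of "Y n *\<^sub>V x"] mult_left_mono[OF Y_norm[of n x], of "y (Suc n) - y n"]
        y_mono[of n] by simp
    moreover have "Y (Suc (Suc n)) *\<^sub>V x - Y (Suc n) *\<^sub>V x
        = (1 / 2) *\<^sub>C (Y (Suc n) *\<^sub>V ?D *\<^sub>V x + ?D *\<^sub>V Y n *\<^sub>V x)"
      by (subst Y(2)[of "Suc n"], subst (2) Y(2)[of n])
        (simp add: bop_diff flip: scaleC.diff_right)
    ultimately have "norm (Y (Suc (Suc n)) *\<^sub>V x - Y (Suc n) *\<^sub>V x)
        \<le> (y (Suc n) * ((y (Suc n) - y n) * norm x) + (y (Suc n) - y n) * (y n * norm x)) / 2"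
      using norm_triangle_ineq[of "Y (Suc n) *\<^sub>V ?D *\<^sub>V x" "?D *\<^sub>V Y n *\<^sub>V x"]
      by (simp add: norm_scaleC norm_divide)
    also have "\<dots> = (y (Suc (Suc n)) - y (Suc n)) * norm x"
      by (simp add: y(2)[of "Suc n"], subst (3) y(2)[of n])
        (simp add: power2_eq_square field_simps)
    finally show ?case .
  qed
  have Y_dist: "norm (Y (n + k) *\<^sub>V x - Y n *\<^sub>V x) \<le> (y (n + k) - y n) * norm x" for n k x
  proof (induction k)
    case (Suc k)
    show ?case
      using Suc Y_step[of "n + k" x]
        norm_triangle_ineq[of "Y (Suc (n + k)) *\<^sub>V x - Y (n + k) *\<^sub>V x" "Y (n + k) *\<^sub>V x - Y n *\<^sub>V x"]
      by (simp add: algebra_simps)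
  qed simp
  have "incseq y"
    by (rule incseq_SucI) (rule y_mono)
  then obtain L where "y \<longlonglongrightarrow> L"
    using incseq_convergent[of y 1] y01 by blast
  then have "Cauchy y" by (rule LIMSEQ_imp_Cauchy)
  have "convergent (\<lambda>n. Y n *\<^sub>V x)" for x
  proof (rule Cauchy_convergent, rule metric_CauchyI)
    fix \<epsilon> :: real assume "\<epsilon> > 0"
    then obtain N where N: "\<And>m n. m \<ge> N \<Longrightarrow> n \<ge> N \<Longrightarrow> dist (y m) (y n) < \<epsilon> / (norm x + 1)"
      using metric_CauchyD[OF \<open>Cauchy y\<close>, of "\<epsilon> / (norm x + 1)"]
      by (metis add_nonneg_pos divide_pos_pos norm_ge_zero zero_less_one)
    have "norm (Y m *\<^sub>V x - Y n *\<^sub>V x) < \<epsilon>" if "m \<ge> n" "n \<ge> N" for m n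
    proof -
      have "norm (Y m *\<^sub>V x - Y n *\<^sub>V x) \<le> (y m - y n) * norm x"
        using Y_dist[of n "m - n" x] that by simp
      also have "\<dots> \<le> dist (y m) (y n) * (norm x + 1)"
        by (intro mult_mono) (auto simp: dist_real_def)
      also have "\<dots> < \<epsilon>"
        using N[of m n] that by (simp add: pos_less_divide_eq add_nonneg_pos)
      finally show ?thesis .
    qed
    then show "\<exists>M. \<forall>m\<ge>M. \<forall>n\<ge>M. dist (Y m *\<^sub>V x) (Y n *\<^sub>V x) < \<epsilon>"
      by (metis dist_norm dist_commute nle_le)
  qed
  moreover have Y1: "norm (Y n *\<^sub>V x) \<le> 1 * norm x" for n x
    using Y_norm[of n x] mult_right_mono[of "y n" 1 "norm x"] y01[of n] by simp
  ultimately obtain Z where Z: "\<And>x. (\<lambda>n. Y n *\<^sub>V x) \<longlonglongrightarrow> Z *\<^sub>V x"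
    using bop_limit by blast
  have Z1: "norm (Z *\<^sub>V x) \<le> norm x" for x
    using tendsto_upperbound[OF tendsto_norm[OF Z[of x]]] Y1 by simp
  \<comment> \<open>Strong limits multiply here because the \<open>Y n\<close> are contractions: the
    error \<open>Y n *\<^sub>V (Y n *\<^sub>V x - Z *\<^sub>V x)\<close> is no longer than
    \<open>Y n *\<^sub>V x - Z *\<^sub>V x\<close>.\<close>
  have ZZ: "(\<lambda>n. Y n *\<^sub>V Y n *\<^sub>V x) \<longlonglongrightarrow> Z *\<^sub>V Z *\<^sub>V x" for x
  proof -
    have "(\<lambda>n. norm (Y n *\<^sub>V x - Z *\<^sub>V x)) \<longlonglongrightarrow> 0"
      using tendsto_diff[OF Z[of x] tendsto_const[of "Z *\<^sub>V x"]] by (simp add: tendsto_norm_zero)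
    then have "(\<lambda>n. Y n *\<^sub>V (Y n *\<^sub>V x - Z *\<^sub>V x)) \<longlonglongrightarrow> 0"
      by (rule Lim_null_comparison[rotated]) (use Y1 in simp)
    from tendsto_add[OF this Z[of "Z *\<^sub>V x"]] show ?thesis
      by (simp add: bop_diff)
  qed
  have Z_eq: "2 *\<^sub>C (Z *\<^sub>V x) = C *\<^sub>V x + Z *\<^sub>V Z *\<^sub>V x" for x
  proof (rule LIMSEQ_unique)
    show "(\<lambda>n. 2 *\<^sub>C (Y (Suc n) *\<^sub>V x)) \<longlonglongrightarrow> 2 *\<^sub>C (Z *\<^sub>V x)"
      by (intro scaleC.tendsto tendsto_const LIMSEQ_Suc Z)
    show "(\<lambda>n. 2 *\<^sub>C (Y (Suc n) *\<^sub>V x)) \<longlonglongrightarrow> C *\<^sub>V x + Z *\<^sub>V Z *\<^sub>V x"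
      by (simp add: Y scaleC_scaleC scaleC_one) (intro tendsto_add tendsto_const ZZ)
  qed
  have Y_adj: "adj (Y n) = Y n" for n
    by (induction n) (auto simp: Y adj_scaleC adj_add adj_comp C_adj cinner.zero_left cinner.zero_right intro!: adj_eqI)
  have "adj Z = Z"
  proof (rule adj_eqI)
    fix x y
    have "(\<lambda>n. cinner x (Y n *\<^sub>V y)) \<longlonglongrightarrow> cinner x (Z *\<^sub>V y)"
      by (intro cinner.tendsto tendsto_const Z)
    moreover have "(\<lambda>n. cinner x (Y n *\<^sub>V y)) \<longlonglongrightarrow> cinner (Z *\<^sub>V x) y"
      unfolding cinner_bop_left Y_adj by (intro cinner.tendsto tendsto_const Z)
    ultimately show "cinner x (Z *\<^sub>V y) = cinner (Z *\<^sub>V x) y"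
      by (rule LIMSEQ_unique)
  qed
  define S where "S = id_bop - Z"
  have "positive S"
    unfolding positive_iff
  proof (intro allI conjI)
    fix x
    have "Re (cinner x (Z *\<^sub>V x)) \<le> norm x * norm (Z *\<^sub>V x)"
      by (meson abs_Re_le_cmod abs_le_D1 cinner_cauchy_schwarz order_trans)
    also have "\<dots> \<le> norm x * norm x"
      by (intro mult_left_mono Z1) simp
    finally show "0 \<le> Re (cinner x (S *\<^sub>V x))"
      by (simp add: S_def cinner.diff_right Re_cinner_self) (simp add: power2_eq_square)
    have "adj S = S"
      using \<open>adj Z = Z\<close> by (simp add: S_def adj_diff)
    then show "Im (cinner x (S *\<^sub>V x)) = 0"
      by (simp add: self_adjoint_iff_real)
  qed
  moreover have "S o\<^sub>B S = T"
  proof (rule bop_eqI)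
    fix x
    have "2 *\<^sub>C (Z *\<^sub>V x) = Z *\<^sub>V x + Z *\<^sub>V x"
      by (metis one_add_one scaleC_add_left scaleC_one)
    then show "(S o\<^sub>B S) *\<^sub>V x = T *\<^sub>V x"
      using Z_eq[of x] by (simp add: S_def C_def bop_diff algebra_simps)
  qed
  ultimately show ?thesis by blast
qed

lemma positive_scaleC: "positive T \<Longrightarrow> 0 \<le> r \<Longrightarrow> positive (complex_of_real r *\<^sub>C T)"
  by (simp add: positive_iff cinner_scaleC_right)

lemma ex_sqrt:
  assumes T: "positive T"
  shows "\<exists>S. positive S \<and> S o\<^sub>B S = T"
proof -
  obtain K0 where K0: "0 \<le> K0" "\<And>x. norm (T *\<^sub>V x) \<le> K0 * norm x" using bop_bounded by blast
  \<comment> \<open>The added one makes \<open>K\<close> positive, so that \<open>T\<close> can be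
    divided by it even when \<open>K0 = 0\<close>.\<close>
  define K where "K = K0 + 1"
  have K: "K > 0" "\<And>x. norm (T *\<^sub>V x) \<le> K * norm x"
    using K0 by (auto simp: K_def algebra_simps intro: add_increasing)
  let ?T = "complex_of_real (1 / K) *\<^sub>C T"
  have "norm (?T *\<^sub>V x) \<le> norm x" for x
    using K(2)[of x] K(1) by (simp add: norm_scaleC norm_divide divide_le_eq mult.commute)
  then obtain S where S: "positive S" "S o\<^sub>B S = ?T"
    using ex_sqrt_contraction positive_scaleC[OF T, of "1 / K"] K(1) by (metis less_imp_le zero_le_divide_1_iff)
  have SS: "S *\<^sub>V S *\<^sub>V x = complex_of_real (1 / K) *\<^sub>C (T *\<^sub>V x)" for x
    using S(2) by (metis bop_apply_simps(5) bop_apply_simps(7))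
  have "complex_of_real (sqrt K) * (complex_of_real (sqrt K) * complex_of_real (1 / K)) = 1"
    using K(1) by (simp flip: of_real_mult)
  then have "(complex_of_real (sqrt K) *\<^sub>C S) o\<^sub>B (complex_of_real (sqrt K) *\<^sub>C S) = T"
    by (intro bop_eqI) (simp add: bop_scaleC SS scaleC_scaleC scaleC_one del: of_real_divide)
  then show ?thesis
    using positive_scaleC[OF S(1), of "sqrt K"] K(1) by auto
qed

text \<open>With \<open>K = S + P\<close> and \<open>D = S - P\<close> one has \<open>KD + DK = 0\<close>. Approximate eigenvectors \<open>x\<close> of \<open>D\<close> for
  \<open>\<plusminus>\<parallel>D\<parallel>\<close> then make \<open>\<langle>x, Kx\<rangle>\<close> small, and with it \<open>\<langle>x, Dx\<rangle>\<close>, unless \<open>D = 0\<close>.\<close>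

lemma sqrt_unique:
  fixes S P :: "'a::complex_hilbert bop"
  assumes S: "positive S" and P: "positive P" and eq: "S o\<^sub>B S = P o\<^sub>B P"
  shows "S = P"
proof -
  define D where "D = S - P"
  define K where "K = S + P"
  define N where "N = onorm (bop_apply D)"
  have D_adj: "adj D = D" and K_adj: "adj K = K"
    using S P by (simp_all add: D_def K_def adj_diff adj_add positive_adj)
  have N: "norm (D *\<^sub>V x) \<le> N * norm x" for x
    unfolding N_def by (rule onorm[OF bounded_linear_bop])
  have "0 \<le> N" unfolding N_def by (rule onorm_pos_le[OF bounded_linear_bop])
  obtain \<kappa> where \<kappa>: "0 \<le> \<kappa>" "\<And>x. norm (K *\<^sub>V x) \<le> \<kappa> * norm x" using bop_bounded by blast
  \<comment> \<open>\<open>KD + DK\<close> is twice the difference of the squares of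
    \<open>S\<close> and \<open>P\<close>, hence zero; for self-adjoint \<open>K\<close> and
    \<open>D\<close> this makes the inner product purely imaginary.\<close>
  have anti: "Re (cinner (K *\<^sub>V x) (D *\<^sub>V x)) = 0" for x
  proof -
    have "S *\<^sub>V S *\<^sub>V x = P *\<^sub>V P *\<^sub>V x"
      using eq by (metis bop_apply_simps(7))
    then have "K *\<^sub>V D *\<^sub>V x + D *\<^sub>V K *\<^sub>V x = 0"
      by (simp add: K_def D_def bop_add bop_diff)
    then have "cinner x (K *\<^sub>V D *\<^sub>V x) + cinner x (D *\<^sub>V K *\<^sub>V x) = 0"
      by (metis cinner_add_right cinner_zero_right)
    then have "cinner (K *\<^sub>V x) (D *\<^sub>V x) + cnj (cinner (K *\<^sub>V x) (D *\<^sub>V x)) = 0"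
      by (simp add: cinner_bop_left K_adj D_adj flip: cinner_commute)
    then show ?thesis by (simp add: complex_add_cnj)
  qed
  have small: "N * (N - \<epsilon>) \<le> \<kappa> * sqrt (2 * N * \<epsilon>)" if "\<epsilon> > 0" "\<epsilon> \<le> N" for \<epsilon>
  proof -
    \<comment> \<open>Otherwise \<open>self_adjoint_norm_le\<close> would push the operator norm of
      \<open>D\<close> below \<open>N\<close>.\<close>
    have "\<exists>x. \<bar>Re (cinner x (D *\<^sub>V x))\<bar> > (N - \<epsilon>) * (norm x)\<^sup>2"
    proof (rule ccontr)
      assume "\<not> ?thesis"
      then have "norm (D *\<^sub>V x) \<le> (N - \<epsilon>) * norm x" for x
        by (intro self_adjoint_norm_le D_adj) (auto simp: not_less)
      then have "N \<le> N - \<epsilon>"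
        unfolding N_def[symmetric] by (subst (1) N_def, intro onorm_bound) (use that in auto)
      then show False using that by simp
    qed
    then obtain x where x: "\<bar>Re (cinner x (D *\<^sub>V x))\<bar> > (N - \<epsilon>) * (norm x)\<^sup>2" by blast
    then have "x \<noteq> 0" by (auto simp: bop_zero cinner_zero_right)
    \<comment> \<open>The sign decides whether \<open>x\<close> is an approximate eigenvector for
      \<open>N\<close> or for \<open>- N\<close>; the residual \<open>w\<close> then has squared
      norm at most \<open>2 * N * \<epsilon>\<close> times that of \<open>x\<close>.\<close>
    define l where "l = N * sgn (Re (cinner x (D *\<^sub>V x)))"
    have l: "\<bar>l\<bar> = N"
      using x \<open>0 \<le> N\<close> that by (auto simp: l_def abs_mult sgn_real_def mult_less_0_iff split: if_splits)
    have l_mult: "l * Re (cinner x (D *\<^sub>V x)) = N * \<bar>Re (cinner x (D *\<^sub>V x))\<bar>"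
      by (simp add: l_def abs_sgn mult_ac)
    define w where "w = D *\<^sub>V x - complex_of_real l *\<^sub>C x"
    have "(norm w)\<^sup>2 = (norm (D *\<^sub>V x))\<^sup>2 - 2 * (l * Re (cinner x (D *\<^sub>V x))) + l\<^sup>2 * (norm x)\<^sup>2"
    proof -
      have "Re (cinner (D *\<^sub>V x) x) = Re (cinner x (D *\<^sub>V x))"
        by (subst cinner_commute) simp
      then show ?thesis
        by (simp add: w_def norm_sq_diff cinner_scaleC_right norm_scaleC power_mult_distrib)
    qed
    also have "\<dots> \<le> (N * norm x)\<^sup>2 - 2 * (N * ((N - \<epsilon>) * (norm x)\<^sup>2)) + N\<^sup>2 * (norm x)\<^sup>2"
    proof -
      have "(norm (D *\<^sub>V x))\<^sup>2 \<le> (N * norm x)\<^sup>2"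
        by (intro power_mono N) simp
      moreover have "N * ((N - \<epsilon>) * (norm x)\<^sup>2) \<le> N * \<bar>Re (cinner x (D *\<^sub>V x))\<bar>"
        using x \<open>0 \<le> N\<close> by (intro mult_left_mono) auto
      moreover have "l\<^sup>2 = N\<^sup>2"
        using l by (metis power2_abs)
      ultimately show ?thesis
        unfolding l_mult by simp
    qed
    also have "\<dots> = 2 * N * \<epsilon> * (norm x)\<^sup>2"
      by (simp add: power2_eq_square algebra_simps)
    finally have "norm w \<le> sqrt (2 * N * \<epsilon> * (norm x)\<^sup>2)"
      by (rule real_le_rsqrt)
    then have w: "norm w \<le> sqrt (2 * N * \<epsilon>) * norm x"
      by (simp add: real_sqrt_mult)
    have "cinner (K *\<^sub>V x) w = cinner (K *\<^sub>V x) (D *\<^sub>V x) - complex_of_real l * cinner x (K *\<^sub>V x)"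
      by (simp add: w_def cinner.diff_right cinner_scaleC_right cinner_bop_left K_adj)
    then have "l * Re (cinner x (K *\<^sub>V x)) = - Re (cinner (K *\<^sub>V x) w)"
      by (simp add: anti)
    then have "N * \<bar>Re (cinner x (K *\<^sub>V x))\<bar> = \<bar>Re (cinner (K *\<^sub>V x) w)\<bar>"
      by (metis abs_minus abs_mult l)
    also have "\<dots> \<le> norm (K *\<^sub>V x) * norm w"
      using abs_Re_le_cmod cinner_cauchy_schwarz order_trans by blast
    also have "\<dots> \<le> (\<kappa> * norm x) * (sqrt (2 * N * \<epsilon>) * norm x)"
      by (intro mult_mono \<kappa> w) (use \<kappa> in auto)
    finally have 1: "N * \<bar>Re (cinner x (K *\<^sub>V x))\<bar> \<le> \<kappa> * sqrt (2 * N * \<epsilon>) * (norm x)\<^sup>2"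
      by (simp add: power2_eq_square mult_ac)
    \<comment> \<open>Positivity of \<open>S\<close> and \<open>P\<close> enters here: the diagonal
      of their difference is dominated by that of their sum.\<close>
    have "\<bar>Re (cinner x (D *\<^sub>V x))\<bar> \<le> \<bar>Re (cinner x (K *\<^sub>V x))\<bar>"
      using positive_Re[OF S, of x] positive_Re[OF P, of x]
      by (simp add: D_def K_def cinner_add_right cinner.diff_right)
    with x have "N * ((N - \<epsilon>) * (norm x)\<^sup>2) \<le> N * \<bar>Re (cinner x (K *\<^sub>V x))\<bar>"
      using \<open>0 \<le> N\<close> by (intro mult_left_mono) auto
    with 1 have "N * (N - \<epsilon>) * (norm x)\<^sup>2 \<le> \<kappa> * sqrt (2 * N * \<epsilon>) * (norm x)\<^sup>2"
      by simp
    then show ?thesis using \<open>x \<noteq> 0\<close> by simp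
  qed
  have "N = 0"
  proof (rule ccontr)
    assume "N \<noteq> 0"
    with \<open>0 \<le> N\<close> have "N > 0" by simp
    define \<epsilon> where "\<epsilon> n = N * inverse (real (Suc n))" for n
    have \<epsilon>: "\<epsilon> \<longlonglongrightarrow> 0"
      unfolding \<epsilon>_def using tendsto_mult_right_zero[OF LIMSEQ_inverse_real_of_nat] by simp
    have "(\<lambda>n. N * (N - \<epsilon> n)) \<longlonglongrightarrow> N * (N - 0)"
      by (intro tendsto_intros \<epsilon>)
    moreover have "(\<lambda>n. \<kappa> * sqrt (2 * N * \<epsilon> n)) \<longlonglongrightarrow> \<kappa> * sqrt (2 * N * 0)"
      by (intro tendsto_intros \<epsilon>)
    moreover have "N * (N - \<epsilon> n) \<le> \<kappa> * sqrt (2 * N * \<epsilon> n)" for n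
      using \<open>N > 0\<close> by (intro small) (auto simp: \<epsilon>_def divide_simps)
    ultimately have "N * (N - 0) \<le> \<kappa> * sqrt (2 * N * 0)"
      by (intro LIMSEQ_le) auto
    then show False using \<open>N > 0\<close> by (simp add: mult_le_0_iff)
  qed
  then have "D *\<^sub>V x = 0" for x
    using N[of x] by simp
  then show ?thesis
    by (intro bop_eqI) (simp add: D_def)
qed

lemma sqrt_op_eqI: "positive S \<Longrightarrow> S o\<^sub>B S = T \<Longrightarrow> sqrt_op T = S"
  unfolding sqrt_op_def by (rule the_equality) (auto intro: sqrt_unique)

lemma sqrt_op:
  assumes "positive T"
  shows "positive (sqrt_op T)" "sqrt_op T o\<^sub>B sqrt_op T = T"
proof -
  obtain S where S: "positive S" "S o\<^sub>B S = T"
    using ex_sqrt[OF assms] by blast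
  then show "positive (sqrt_op T)" "sqrt_op T o\<^sub>B sqrt_op T = T"
    using sqrt_op_eqI[OF S] by simp_all
qed

lemma sqrt_op_apply: "positive T \<Longrightarrow> sqrt_op T *\<^sub>V sqrt_op T *\<^sub>V x = T *\<^sub>V x"
  by (metis sqrt_op(2) bop_apply_simps(7))

lemma cinner_positive: "positive T \<Longrightarrow> cinner x (T *\<^sub>V y) = cinner (sqrt_op T *\<^sub>V x) (sqrt_op T *\<^sub>V y)"
  by (metis cinner_bop_left positive_adj sqrt_op(1) sqrt_op_apply)

lemma positive_norm_sqrt: "positive T \<Longrightarrow> Re (cinner x (T *\<^sub>V x)) = (norm (sqrt_op T *\<^sub>V x))\<^sup>2"
  by (simp add: cinner_positive Re_cinner_self)

lemma positive_abs_op: "positive (abs_op T)"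
  unfolding abs_op_def by (intro sqrt_op positive_adj_comp)

lemma abs_op_positive: "positive T \<Longrightarrow> abs_op T = T"
  unfolding abs_op_def by (rule sqrt_op_eqI) (simp_all add: positive_adj)

lemma norm_abs_op: "norm (abs_op T *\<^sub>V x) = norm (T *\<^sub>V x)"
proof -
  have "(norm (abs_op T *\<^sub>V x))\<^sup>2 = Re (cinner x ((adj T o\<^sub>B T) *\<^sub>V x))"
    unfolding abs_op_def by (simp only: positive_norm_sqrt positive_adj_comp)
  also have "\<dots> = (norm (T *\<^sub>V x))\<^sup>2"
    by (simp add: cinner_adj_right Re_cinner_self)
  finally show ?thesis by simp
qed

section \<open>Factorization through a range and polar decomposition\<close>

lemma csubspace_range: "csubspace (range (bop_apply S))"
  unfolding csubspace_def
  by (auto simp: image_iff bop_zero simp flip: bop_add bop_scaleC intro: exI[of _ 0])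

lemma csubspace_closure:
  assumes "csubspace M"
  shows "csubspace (closure M)"
  unfolding csubspace_def
proof (intro conjI ballI allI)
  show "0 \<in> closure M"
    using assms closure_subset by (auto simp: csubspace_def)
  show "x + y \<in> closure M" if xy: "x \<in> closure M" "y \<in> closure M" for x y
  proof -
    obtain f g where "\<forall>n. f n \<in> M" "f \<longlonglongrightarrow> x" "\<forall>n. g n \<in> M" "g \<longlonglongrightarrow> y"
      using xy unfolding closure_sequential by blast
    then have "\<forall>n. f n + g n \<in> M" "(\<lambda>n. f n + g n) \<longlonglongrightarrow> x + y"
      using assms by (auto simp: csubspace_def intro: tendsto_add)
    then show ?thesis unfolding closure_sequential by (intro exI conjI)
  qed
  show "c *\<^sub>C x \<in> closure M" if x: "x \<in> closure M" for c x
  proof -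
    obtain f where "\<forall>n. f n \<in> M" "f \<longlonglongrightarrow> x"
      using x unfolding closure_sequential by blast
    then have "\<forall>n. c *\<^sub>C f n \<in> M" "(\<lambda>n. c *\<^sub>C f n) \<longlonglongrightarrow> c *\<^sub>C x"
      using assms by (auto simp: csubspace_def intro: scaleC.tendsto[OF tendsto_const])
    then show ?thesis unfolding closure_sequential by (intro exI conjI)
  qed
qed

definition contraction :: "'a::complex_hilbert bop \<Rightarrow> bool" where
  "contraction V \<longleftrightarrow> (\<forall>x. norm (V *\<^sub>V x) \<le> norm x)"

lemma contraction_comp: "contraction V \<Longrightarrow> contraction W \<Longrightarrow> contraction (V o\<^sub>B W)"
  unfolding contraction_def by (metis bop_apply_simps(7) order_trans)

text \<open>By the hypothesis, sending \<open>S *\<^sub>V x\<close> to \<open>T *\<^sub>V x\<close>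
  is well defined, linear and contractive on the range of \<open>S\<close>. It extends to the
  closure by uniform continuity, and the orthogonal projection onto the closure makes it
  total.\<close>

lemma douglas_factorization:
  fixes S T :: "'a::complex_hilbert bop"
  assumes le: "\<And>x. norm (T *\<^sub>V x) \<le> norm (S *\<^sub>V x)"
  obtains V where "contraction V" "T = V o\<^sub>B S"
proof -
  define f where "f y = T *\<^sub>V (SOME x. S *\<^sub>V x = y)" for y
  have f: "f (S *\<^sub>V x) = T *\<^sub>V x" for x
  proof -
    have "S *\<^sub>V (SOME z. S *\<^sub>V z = S *\<^sub>V x) = S *\<^sub>V x"
      by (rule someI[of _ x]) simp
    then have "T *\<^sub>V ((SOME z. S *\<^sub>V z = S *\<^sub>V x) - x) = 0"
      using le[of "(SOME z. S *\<^sub>V z = S *\<^sub>V x) - x"] by (simp add: bop_diff)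
    then show ?thesis by (simp add: f_def bop_diff)
  qed
  let ?R = "range (bop_apply S)"
  have lip: "dist (f y) (f z) \<le> dist y z" if "y \<in> ?R" "z \<in> ?R" for y z
    using that le by (auto simp: f dist_norm simp flip: bop_diff)
  then have "uniformly_continuous_on ?R f"
    unfolding uniformly_continuous_on_def by (meson le_less_trans)
  then obtain g where g: "uniformly_continuous_on (closure ?R) g" "\<And>y. y \<in> ?R \<Longrightarrow> f y = g y"
    by (rule uniformly_continuous_on_extension_on_closure) blast
  have gS: "g (S *\<^sub>V x) = T *\<^sub>V x" for x
    using g(2)[of "S *\<^sub>V x"] f[of x] by simp
  have cont: "continuous_on (closure ?R) g"
    using g(1) by (rule uniformly_continuous_imp_continuous)
  \<comment> \<open>One sequence of preimages computes both the point and the value of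
    \<open>g\<close> there, so linearity and the norm bound on the closure reduce to properties of
    \<open>S\<close> and \<open>T\<close>.\<close>
  have approx: "\<exists>x. (\<lambda>n. S *\<^sub>V x n) \<longlonglongrightarrow> y \<and> (\<lambda>n. T *\<^sub>V x n) \<longlonglongrightarrow> g y" if "y \<in> closure ?R" for y
  proof -
    obtain h where h: "\<forall>n. h n \<in> ?R" "h \<longlonglongrightarrow> y"
      using \<open>y \<in> closure ?R\<close> unfolding closure_sequential by blast
    then have "\<forall>n. \<exists>x. h n = S *\<^sub>V x" by blast
    then obtain x where x: "h = (\<lambda>n. S *\<^sub>V x n)" by metis
    have "(\<lambda>n. g (h n)) \<longlonglongrightarrow> g y"
      using h(1) \<open>y \<in> closure ?R\<close> subsetD[OF closure_subset, of _ ?R]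
      by (intro continuous_on_tendsto_compose[OF cont h(2)] always_eventually) blast+
    then show ?thesis using h(2) unfolding x gS by blast
  qed
  note M = csubspace_closure[OF csubspace_range[of S]]
  have g_eq: "g y = z" if "y \<in> closure ?R" "(\<lambda>n. S *\<^sub>V x n) \<longlonglongrightarrow> y" "(\<lambda>n. T *\<^sub>V x n) \<longlonglongrightarrow> z" for x y z
  proof (rule LIMSEQ_unique)
    show "(\<lambda>n. T *\<^sub>V x n) \<longlonglongrightarrow> z" by fact
    have "(\<lambda>n. g (S *\<^sub>V x n)) \<longlonglongrightarrow> g y"
      using that
      by (intro continuous_on_tendsto_compose[OF cont] always_eventually allI
          subsetD[OF closure_subset rangeI])
    then show "(\<lambda>n. T *\<^sub>V x n) \<longlonglongrightarrow> g y" by (simp add: gS)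
  qed
  have g_add: "g (y + z) = g y + g z" if y: "y \<in> closure ?R" and z: "z \<in> closure ?R" for y z
  proof -
    obtain a b where a: "(\<lambda>n. S *\<^sub>V a n) \<longlonglongrightarrow> y" "(\<lambda>n. T *\<^sub>V a n) \<longlonglongrightarrow> g y"
      and b: "(\<lambda>n. S *\<^sub>V b n) \<longlonglongrightarrow> z" "(\<lambda>n. T *\<^sub>V b n) \<longlonglongrightarrow> g z"
      using approx[OF y] approx[OF z] by blast
    have "y + z \<in> closure ?R"
      using M y z by (auto simp: csubspace_def)
    then show ?thesis
      by (rule g_eq[where x = "\<lambda>n. a n + b n"]) (simp_all add: bop_add tendsto_add a b)
  qed
  have g_scale: "g (c *\<^sub>C y) = c *\<^sub>C g y" if y: "y \<in> closure ?R" for c y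
  proof -
    obtain a where a: "(\<lambda>n. S *\<^sub>V a n) \<longlonglongrightarrow> y" "(\<lambda>n. T *\<^sub>V a n) \<longlonglongrightarrow> g y"
      using approx[OF y] by blast
    have "c *\<^sub>C y \<in> closure ?R"
      using M y by (auto simp: csubspace_def)
    then show ?thesis
      by (rule g_eq[where x = "\<lambda>n. c *\<^sub>C a n"])
        (simp_all add: bop_scaleC scaleC.tendsto[OF tendsto_const] a)
  qed
  have g_norm: "norm (g y) \<le> norm y" if y: "y \<in> closure ?R" for y
  proof -
    obtain a where a: "(\<lambda>n. S *\<^sub>V a n) \<longlonglongrightarrow> y" "(\<lambda>n. T *\<^sub>V a n) \<longlonglongrightarrow> g y"
      using approx[OF y] by blast
    show ?thesis
      using le by (intro LIMSEQ_le[OF tendsto_norm[OF a(2)] tendsto_norm[OF a(1)]]) auto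
  qed
  obtain P :: "'a bop" where P: "\<And>x. P *\<^sub>V x \<in> closure ?R" "\<And>x. x \<in> closure ?R \<Longrightarrow> P *\<^sub>V x = x"
    "\<And>x. norm (P *\<^sub>V x) \<le> norm x"
    using ex_projection[OF M closed_closure] by metis
  have "norm (g (P *\<^sub>V x)) \<le> 1 * norm x" for x
    using g_norm[OF P(1)[of x]] P(3)[of x] by simp
  then obtain V where V: "\<And>x. V *\<^sub>V x = g (P *\<^sub>V x)"
    using bop_of_fun[of "\<lambda>x. g (P *\<^sub>V x)" 1] by (auto simp: bop_add bop_scaleC g_add g_scale P)
  show ?thesis
  proof
    show "contraction V"
      unfolding contraction_def V using \<open>\<And>x. norm (g (P *\<^sub>V x)) \<le> 1 * norm x\<close> by simp
    have "S *\<^sub>V x \<in> closure ?R" for x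
      by (rule subsetD[OF closure_subset rangeI])
    then show "T = V o\<^sub>B S"
      by (intro bop_eqI) (simp add: V P gS)
  qed
qed

text \<open>\<open>T\<close> and \<open>abs_op T\<close> have the same norm at every vector, so each
  factors through the other. Contractions suffice for the trace estimates, and partial isometries
  are avoided.\<close>

lemma polar_decomposition:
  obtains V W where "contraction V" "T = V o\<^sub>B abs_op T" "contraction W" "abs_op T = W o\<^sub>B T"
  by (metis douglas_factorization norm_abs_op order_refl)

section \<open>Hilbert-Schmidt operators\<close>

definition hilbert_schmidt :: "'a::complex_hilbert bop \<Rightarrow> bool" where
  "hilbert_schmidt R \<longleftrightarrow> (\<lambda>e. (norm (R *\<^sub>V e))\<^sup>2) summable_on some_onb"

definition hs_norm_sq :: "'a::complex_hilbert bop \<Rightarrow> real" where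
  "hs_norm_sq R = (\<Sum>\<^sub>\<infinity>e\<in>some_onb. (norm (R *\<^sub>V e))\<^sup>2)"

lemma hs_norm_sq_nonneg: "0 \<le> hs_norm_sq R"
  unfolding hs_norm_sq_def by (rule infsum_nonneg) simp

lemma hilbert_schmidt_has_sum:
  "hilbert_schmidt R \<Longrightarrow> ((\<lambda>e. (norm (R *\<^sub>V e))\<^sup>2) has_sum hs_norm_sq R) some_onb"
  by (simp add: hilbert_schmidt_def hs_norm_sq_def)

lemma hilbert_schmidt_bound:
  assumes "hilbert_schmidt S" "\<And>e. norm (R *\<^sub>V e) \<le> K * norm (S *\<^sub>V e)"
  shows "hilbert_schmidt R" "hs_norm_sq R \<le> K\<^sup>2 * hs_norm_sq S"
proof -
  have le: "(norm (R *\<^sub>V e))\<^sup>2 \<le> K\<^sup>2 * (norm (S *\<^sub>V e))\<^sup>2" for e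
    using power_mono[OF assms(2)[of e], of 2] by (simp add: power_mult_distrib)
  have S: "((\<lambda>e. K\<^sup>2 * (norm (S *\<^sub>V e))\<^sup>2) has_sum K\<^sup>2 * hs_norm_sq S) some_onb"
    by (intro has_sum_cmult_right hilbert_schmidt_has_sum assms)
  show "hilbert_schmidt R"
    unfolding hilbert_schmidt_def using le
    by (intro summable_on_comparison_test[OF has_sum_imp_summable[OF S]]) auto
  then show "hs_norm_sq R \<le> K\<^sup>2 * hs_norm_sq S"
    by (intro has_sum_mono[OF hilbert_schmidt_has_sum S] le)
qed

lemma hilbert_schmidt_comp_left:
  assumes "hilbert_schmidt S"
  shows "hilbert_schmidt (V o\<^sub>B S)"
proof -
  obtain K where "\<And>x. norm (V *\<^sub>V x) \<le> K * norm x" using bop_bounded by blast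
  then show ?thesis by (intro hilbert_schmidt_bound[OF assms]) simp
qed

lemma hilbert_schmidt_add:
  assumes "hilbert_schmidt R" "hilbert_schmidt S"
  shows "hilbert_schmidt (R + S)"
  unfolding hilbert_schmidt_def
proof (rule summable_on_comparison_test)
  show "(\<lambda>e. 2 * (norm (R *\<^sub>V e))\<^sup>2 + 2 * (norm (S *\<^sub>V e))\<^sup>2) summable_on some_onb"
    using assms by (intro summable_on_add summable_on_cmult_right) (simp_all add: hilbert_schmidt_def)
  fix e
  have "(norm ((R + S) *\<^sub>V e))\<^sup>2 \<le> (norm (R *\<^sub>V e) + norm (S *\<^sub>V e))\<^sup>2"
    by (intro power_mono) (simp_all add: norm_triangle_ineq)
  also have "\<dots> \<le> 2 * (norm (R *\<^sub>V e))\<^sup>2 + 2 * (norm (S *\<^sub>V e))\<^sup>2"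
    using zero_le_power2[of "norm (R *\<^sub>V e) - norm (S *\<^sub>V e)"]
    by (simp add: power2_eq_square algebra_simps)
  finally show "(norm ((R + S) *\<^sub>V e))\<^sup>2 \<le> 2 * (norm (R *\<^sub>V e))\<^sup>2 + 2 * (norm (S *\<^sub>V e))\<^sup>2" .
qed simp

lemma hilbert_schmidt_scaleC: "hilbert_schmidt R \<Longrightarrow> hilbert_schmidt (c *\<^sub>C R)"
  by (rule hilbert_schmidt_bound(1)[of R _ "cmod c"]) (simp_all add: norm_scaleC)

lemma hilbert_schmidt_diff: "hilbert_schmidt R \<Longrightarrow> hilbert_schmidt S \<Longrightarrow> hilbert_schmidt (R - S)"
proof -
  assume "hilbert_schmidt R" "hilbert_schmidt S"
  then have "hilbert_schmidt (R + (-1) *\<^sub>C S)"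
    by (intro hilbert_schmidt_add hilbert_schmidt_scaleC)
  also have "R + (-1) *\<^sub>C S = R - S"
    by (rule bop_eqI) (simp add: scaleC.minus_left scaleC_one)
  finally show ?thesis .
qed

text \<open>Both operators have the same squared matrix entries up to transposition; one sum runs by
  rows and the other by columns.\<close>

lemma has_sum_adj:
  fixes R :: "'a::complex_hilbert bop"
  assumes "hilbert_schmidt R"
  shows "((\<lambda>e. (norm (adj R *\<^sub>V e))\<^sup>2) has_sum hs_norm_sq R) some_onb"
    and summable_matrix:
      "(\<lambda>(e, f). (cmod (cinner f (R *\<^sub>V e)))\<^sup>2) summable_on (some_onb \<times> some_onb)"
proof -
  let ?B = "some_onb :: 'a set"
  let ?g = "\<lambda>(e, f). (cmod (cinner f (R *\<^sub>V e)))\<^sup>2"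
  have row: "((\<lambda>f. ?g (e, f)) has_sum (norm (R *\<^sub>V e))\<^sup>2) ?B" for e
    using parseval[OF is_onb_some_onb, of "R *\<^sub>V e"] by simp
  show s: "?g summable_on (?B \<times> ?B)"
    by (rule summable_on_SigmaI[OF row]) (use assms in \<open>auto simp: hilbert_schmidt_def\<close>)
  have "(?g has_sum hs_norm_sq R) (?B \<times> ?B)"
    by (rule has_sum_SigmaI[OF row hilbert_schmidt_has_sum[OF assms] s])
  then have "((\<lambda>(f, e). ?g (e, f)) has_sum hs_norm_sq R) (?B \<times> ?B)"
    by (subst has_sum_swap) simp
  then show "((\<lambda>e. (norm (adj R *\<^sub>V e))\<^sup>2) has_sum hs_norm_sq R) ?B"
  proof (rule has_sum_SigmaD)
    fix f
    have "((\<lambda>e. (cmod (cinner e (adj R *\<^sub>V f)))\<^sup>2) has_sum (norm (adj R *\<^sub>V f))\<^sup>2) ?B"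
      by (rule parseval[OF is_onb_some_onb])
    moreover have "cmod (cinner e (adj R *\<^sub>V f)) = cmod (cinner f (R *\<^sub>V e))" for e
      unfolding cinner_adj_right by (metis cinner_commute complex_mod_cnj)
    ultimately show "((\<lambda>e. case (f, e) of (f, e) \<Rightarrow> ?g (e, f)) has_sum (norm (adj R *\<^sub>V f))\<^sup>2) ?B"
      by simp
  qed
qed

lemma hilbert_schmidt_adj: "hilbert_schmidt R \<Longrightarrow> hilbert_schmidt (adj R)"
  unfolding hilbert_schmidt_def[of "adj R"] using has_sum_adj(1) has_sum_imp_summable by blast

lemma hs_norm_sq_adj: "hilbert_schmidt R \<Longrightarrow> hs_norm_sq (adj R) = hs_norm_sq R"
  unfolding hs_norm_sq_def[of "adj R"] by (rule infsumI) (rule has_sum_adj(1))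

lemma hilbert_schmidt_comp_right: "hilbert_schmidt S \<Longrightarrow> hilbert_schmidt (S o\<^sub>B V)"
  using hilbert_schmidt_adj[OF hilbert_schmidt_comp_left[OF hilbert_schmidt_adj], of S "adj V"]
  by (simp add: adj_comp)

text \<open>Each coefficient of \<open>R *\<^sub>V x\<close> is at most
  \<open>norm (adj R *\<^sub>V e) * norm x\<close>, and the adjoint has the same Hilbert-Schmidt
  norm.\<close>

lemma hilbert_schmidt_norm_le:
  assumes "hilbert_schmidt R"
  shows "(norm (R *\<^sub>V x))\<^sup>2 \<le> hs_norm_sq R * (norm x)\<^sup>2"
proof (rule has_sum_mono[OF parseval[OF is_onb_some_onb]])
  show "((\<lambda>e. (norm (adj R *\<^sub>V e))\<^sup>2 * (norm x)\<^sup>2) has_sum hs_norm_sq R * (norm x)\<^sup>2) some_onb"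
    by (intro has_sum_cmult_left has_sum_adj assms)
  show "(cmod (cinner e (R *\<^sub>V x)))\<^sup>2 \<le> (norm (adj R *\<^sub>V e))\<^sup>2 * (norm x)\<^sup>2" for e
    unfolding cinner_bop_left power_mult_distrib[symmetric]
    by (intro power_mono cinner_cauchy_schwarz) simp
qed

lemma hs_inner_abs_summable:
  assumes "hilbert_schmidt L" "hilbert_schmidt M"
  shows "(\<lambda>e. norm (cinner (L *\<^sub>V e) (M *\<^sub>V e))) summable_on some_onb"
proof (rule Infinite_Sum.abs_summable_on_comparison_test')
  show "(\<lambda>e. (norm (L *\<^sub>V e))\<^sup>2 + (norm (M *\<^sub>V e))\<^sup>2) summable_on some_onb"
    using assms by (intro summable_on_add) (simp_all add: hilbert_schmidt_def)
  fix e
  have "0 \<le> norm (L *\<^sub>V e) * norm (M *\<^sub>V e)" by simp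
  then have "norm (L *\<^sub>V e) * norm (M *\<^sub>V e) \<le> (norm (L *\<^sub>V e))\<^sup>2 + (norm (M *\<^sub>V e))\<^sup>2"
    using sum_squares_bound[of "norm (L *\<^sub>V e)" "norm (M *\<^sub>V e)"] by linarith
  then show "norm (cinner (L *\<^sub>V e) (M *\<^sub>V e)) \<le> (norm (L *\<^sub>V e))\<^sup>2 + (norm (M *\<^sub>V e))\<^sup>2"
    using cinner_cauchy_schwarz order_trans by blast
qed

lemma tr_adj_comp: "tr (adj L o\<^sub>B M) = (\<Sum>\<^sub>\<infinity>e\<in>some_onb. cinner (L *\<^sub>V e) (M *\<^sub>V e))"
  by (simp add: tr_def cinner_adj_right)

lemma hs_inner_has_sum:
  assumes "hilbert_schmidt L" "hilbert_schmidt M"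
  shows "((\<lambda>e. cinner (L *\<^sub>V e) (M *\<^sub>V e)) has_sum tr (adj L o\<^sub>B M)) some_onb"
  unfolding tr_adj_comp
  by (rule has_sum_infsum[OF abs_summable_summable[OF hs_inner_abs_summable[OF assms]]])

lemma hs_cauchy_schwarz:
  assumes L: "hilbert_schmidt L" and M: "hilbert_schmidt M"
  shows "cmod (tr (adj L o\<^sub>B M)) \<le> sqrt (hs_norm_sq L) * sqrt (hs_norm_sq M)"
proof -
  note s = hs_inner_abs_summable[OF L M]
  have "cmod (tr (adj L o\<^sub>B M)) \<le> (\<Sum>\<^sub>\<infinity>e\<in>some_onb. norm (cinner (L *\<^sub>V e) (M *\<^sub>V e)))"
    unfolding tr_adj_comp by (rule norm_infsum_bound[OF s])
  also have "\<dots> \<le> sqrt (hs_norm_sq L) * sqrt (hs_norm_sq M)"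
  proof (rule infsum_le_finite_sums[OF s])
    fix F :: "'a set" assume F: "finite F" "F \<subseteq> some_onb"
    have le: "L2_set (\<lambda>e. norm (R *\<^sub>V e)) F \<le> sqrt (hs_norm_sq R)" if "hilbert_schmidt R" for R :: "'a bop"
      unfolding L2_set_def using F hilbert_schmidt_has_sum[OF that]
      by (intro real_sqrt_le_mono finite_sum_le_has_sum) auto
    have "(\<Sum>e\<in>F. norm (cinner (L *\<^sub>V e) (M *\<^sub>V e))) \<le> (\<Sum>e\<in>F. \<bar>norm (L *\<^sub>V e)\<bar> * \<bar>norm (M *\<^sub>V e)\<bar>)"
      by (intro sum_mono) (simp add: cinner_cauchy_schwarz)
    also have "\<dots> \<le> L2_set (\<lambda>e. norm (L *\<^sub>V e)) F * L2_set (\<lambda>e. norm (M *\<^sub>V e)) F"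
      by (rule L2_set_mult_ineq)
    also have "\<dots> \<le> sqrt (hs_norm_sq L) * sqrt (hs_norm_sq M)"
      by (intro mult_mono le L M) (simp_all add: hs_norm_sq_nonneg)
    finally show "(\<Sum>e\<in>F. norm (cinner (L *\<^sub>V e) (M *\<^sub>V e))) \<le> sqrt (hs_norm_sq L) * sqrt (hs_norm_sq M)" .
  qed
  finally show ?thesis .
qed

text \<open>Inserting a basis between the factors by Parseval turns both traces into one double sum
  in two orders. Square summability of the two matrices makes it absolutely summable.\<close>

lemma tr_hs_commute:
  fixes L M :: "'a::complex_hilbert bop"
  assumes L: "hilbert_schmidt L" and M: "hilbert_schmidt M"
  shows "tr (adj L o\<^sub>B M) = tr (M o\<^sub>B adj L)"
proof -
  let ?B = "some_onb :: 'a set"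
  let ?g = "\<lambda>e f. cinner (L *\<^sub>V e) f * cinner f (M *\<^sub>V e)"
  have "(\<lambda>p. norm (case p of (e, f) \<Rightarrow> ?g e f)) summable_on (?B \<times> ?B)"
  proof (rule Infinite_Sum.abs_summable_on_comparison_test')
    show "(\<lambda>p. (case p of (e, f) \<Rightarrow> (cmod (cinner f (L *\<^sub>V e)))\<^sup>2)
        + (case p of (e, f) \<Rightarrow> (cmod (cinner f (M *\<^sub>V e)))\<^sup>2)) summable_on (?B \<times> ?B)"
      by (intro summable_on_add summable_matrix L M)
    have "cmod a * cmod b \<le> (cmod a)\<^sup>2 + (cmod b)\<^sup>2" for a b
      using sum_squares_bound[of "cmod a" "cmod b"]
        mult_nonneg_nonneg[OF norm_ge_zero[of a] norm_ge_zero[of b]] by linarith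
    moreover have "cmod (cinner (L *\<^sub>V e) f) = cmod (cinner f (L *\<^sub>V e))" for e f
      by (metis cinner_commute complex_mod_cnj)
    ultimately show "norm (case p of (e, f) \<Rightarrow> ?g e f) \<le> (case p of (e, f) \<Rightarrow> (cmod (cinner f (L *\<^sub>V e)))\<^sup>2)
        + (case p of (e, f) \<Rightarrow> (cmod (cinner f (M *\<^sub>V e)))\<^sup>2)" for p
      by (simp add: norm_mult split: prod.split)
  qed
  then have "(\<Sum>\<^sub>\<infinity>e\<in>?B. \<Sum>\<^sub>\<infinity>f\<in>?B. ?g e f) = (\<Sum>\<^sub>\<infinity>f\<in>?B. \<Sum>\<^sub>\<infinity>e\<in>?B. ?g e f)"
    by (rule infsum_swap_banach[OF abs_summable_summable])
  moreover have "(\<Sum>\<^sub>\<infinity>f\<in>?B. ?g e f) = cinner (L *\<^sub>V e) (M *\<^sub>V e)" for e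
    by (intro infsumI parseval_cinner is_onb_some_onb)
  moreover have "(\<Sum>\<^sub>\<infinity>e\<in>?B. ?g e f) = cinner f (M *\<^sub>V adj L *\<^sub>V f)" for f
  proof -
    have "?g e f = cinner (adj M *\<^sub>V f) e * cinner e (adj L *\<^sub>V f)" for e
      by (simp add: cinner_adj_right cinner_bop_left mult.commute)
    then show ?thesis
      by (simp add: infsumI[OF parseval_cinner[OF is_onb_some_onb]]) (simp add: cinner_bop_left)
  qed
  ultimately show ?thesis
    unfolding tr_adj_comp by (simp add: tr_def)
qed

section \<open>Trace class operators\<close>

lemma positive_norm_sqrt_complex:
  "positive P \<Longrightarrow> cinner x (P *\<^sub>V x) = complex_of_real ((norm (sqrt_op P *\<^sub>V x))\<^sup>2)"
  by (simp only: cinner_positive cinner_self)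

lemma trace_class_positive:
  assumes "positive P"
  shows "trace_class P \<longleftrightarrow> hilbert_schmidt (sqrt_op P)"
proof -
  have "trace_class P \<longleftrightarrow> (\<lambda>e. complex_of_real ((norm (sqrt_op P *\<^sub>V e))\<^sup>2)) summable_on some_onb"
    by (simp only: trace_class_def abs_op_positive[OF assms] positive_norm_sqrt_complex[OF assms])
  also have "\<dots> \<longleftrightarrow> hilbert_schmidt (sqrt_op P)"
  proof
    assume "(\<lambda>e. complex_of_real ((norm (sqrt_op P *\<^sub>V e))\<^sup>2)) summable_on some_onb"
    from summable_on_Re[OF this] show "hilbert_schmidt (sqrt_op P)"
      by (simp add: hilbert_schmidt_def)
  next
    assume "hilbert_schmidt (sqrt_op P)"
    then show "(\<lambda>e. complex_of_real ((norm (sqrt_op P *\<^sub>V e))\<^sup>2)) summable_on some_onb"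
      unfolding hilbert_schmidt_def by (rule summable_on_of_real)
  qed
  finally show ?thesis .
qed

lemma tr_positive:
  assumes "positive P" "trace_class P"
  shows "tr P = complex_of_real (hs_norm_sq (sqrt_op P))"
  unfolding tr_def
proof (rule infsumI)
  show "((\<lambda>e. cinner e (P *\<^sub>V e)) has_sum complex_of_real (hs_norm_sq (sqrt_op P))) some_onb"
    unfolding positive_norm_sqrt_complex[OF assms(1)]
    using assms by (intro has_sum_of_real hilbert_schmidt_has_sum) (simp add: trace_class_positive)
qed

lemma trace_class_abs: "trace_class T \<longleftrightarrow> hilbert_schmidt (sqrt_op (abs_op T))"
  using trace_class_positive[OF positive_abs_op[of T]]
  by (simp add: trace_class_def abs_op_positive positive_abs_op)

lemma trace_norm_eq: "trace_class T \<Longrightarrow> trace_norm T = hs_norm_sq (sqrt_op (abs_op T))"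
  unfolding trace_norm_def
  by (subst tr_positive) (simp_all add: positive_abs_op trace_class_positive trace_class_abs abs_op_positive)

lemma trace_norm_positive: "positive P \<Longrightarrow> trace_norm P = Re (tr P)"
  by (simp add: trace_norm_def abs_op_positive)

lemma comp_bop_assoc: "(R o\<^sub>B S) o\<^sub>B T = R o\<^sub>B (S o\<^sub>B T)"
  by (rule bop_eqI) simp

lemma comp_bop_add_right: "R o\<^sub>B (S + T) = R o\<^sub>B S + R o\<^sub>B T"
  by (rule bop_eqI) (simp add: bop_add)

lemma comp_bop_diff_right: "R o\<^sub>B (S - T) = R o\<^sub>B S - R o\<^sub>B T"
  by (rule bop_eqI) (simp add: bop_diff)

lemma comp_bop_scaleC_right: "R o\<^sub>B (c *\<^sub>C T) = c *\<^sub>C (R o\<^sub>B T)"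
  by (rule bop_eqI) (simp add: bop_scaleC)

lemma comp_bop_id_left [simp]: "id_bop o\<^sub>B T = T"
  by (rule bop_eqI) simp

text \<open>\<open>abs_op T\<close> equals \<open>W o\<^sub>B T\<close> for some contraction
  \<open>W\<close>. Testing all \<open>W\<close> avoids the modulus of sums and products, which the
  moduli of the parts do not determine.\<close>

lemma trace_classI:
  assumes "\<And>W. (\<lambda>e. cinner e (W *\<^sub>V T *\<^sub>V e)) summable_on some_onb"
  shows "trace_class T"
  unfolding trace_class_def
  by (rule polar_decomposition[of T]) (use assms in \<open>metis (no_types, lifting) bop_apply_simps(7) summable_on_cong\<close>)

text \<open>If \<open>Q\<close> is the root of the modulus of \<open>T\<close>, then
  \<open>U o\<^sub>B T\<close> is the product of the Hilbert-Schmidt operators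
  \<open>U o\<^sub>B V o\<^sub>B Q\<close> and \<open>Q\<close>. The bound is Cauchy-Schwarz, since
  the trace norm of \<open>T\<close> is the squared Hilbert-Schmidt norm of
  \<open>Q\<close>.\<close>

lemma tr_comp_has_sum:
  fixes T :: "'a::complex_hilbert bop"
  assumes T: "trace_class T"
  shows "((\<lambda>e. cinner e (U *\<^sub>V T *\<^sub>V e)) has_sum tr (U o\<^sub>B T)) some_onb"
    and "(\<And>x. norm (U *\<^sub>V x) \<le> K * norm x) \<Longrightarrow> 0 \<le> K \<Longrightarrow> cmod (tr (U o\<^sub>B T)) \<le> K * trace_norm T"
proof -
  obtain V W where V: "contraction V" "T = V o\<^sub>B abs_op T" by (rule polar_decomposition[of T])
  let ?Q = "sqrt_op (abs_op T)"
  let ?L = "adj (U o\<^sub>B V o\<^sub>B ?Q)"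
  have Q: "hilbert_schmidt ?Q" using T by (simp add: trace_class_abs)
  have L': "hilbert_schmidt (U o\<^sub>B V o\<^sub>B ?Q)" by (rule hilbert_schmidt_comp_left[OF Q])
  then have L: "hilbert_schmidt ?L" by (rule hilbert_schmidt_adj)
  have "?Q o\<^sub>B ?Q = abs_op T" by (rule sqrt_op[OF positive_abs_op])
  then have UT: "adj ?L o\<^sub>B ?Q = U o\<^sub>B T"
    by (subst V(2)) (simp add: comp_bop_assoc)
  have "cinner (?L *\<^sub>V e) (?Q *\<^sub>V e) = cinner e (U *\<^sub>V T *\<^sub>V e)" for e
    using arg_cong[OF UT, of "\<lambda>R. cinner e (R *\<^sub>V e)"] by (simp add: cinner_adj_right flip: cinner_bop_left)
  then show "((\<lambda>e. cinner e (U *\<^sub>V T *\<^sub>V e)) has_sum tr (U o\<^sub>B T)) some_onb"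
    using hs_inner_has_sum[OF L Q] unfolding UT by simp
  assume K: "\<And>x. norm (U *\<^sub>V x) \<le> K * norm x" "0 \<le> K"
  have "norm ((U o\<^sub>B V o\<^sub>B ?Q) *\<^sub>V e) \<le> K * norm (?Q *\<^sub>V e)" for e
  proof -
    have "norm (V *\<^sub>V ?Q *\<^sub>V e) \<le> norm (?Q *\<^sub>V e)"
      using V(1) by (simp add: contraction_def)
    from mult_left_mono[OF this K(2)] show ?thesis
      using K(1)[of "V *\<^sub>V ?Q *\<^sub>V e"] by simp
  qed
  then have "hs_norm_sq ?L \<le> K\<^sup>2 * hs_norm_sq ?Q"
    unfolding hs_norm_sq_adj[OF L'] by (rule hilbert_schmidt_bound(2)[OF Q])
  then have "sqrt (hs_norm_sq ?L) \<le> K * sqrt (hs_norm_sq ?Q)"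
    using K(2) by (metis real_sqrt_abs real_sqrt_le_mono real_sqrt_mult abs_of_nonneg)
  then have "sqrt (hs_norm_sq ?L) * sqrt (hs_norm_sq ?Q) \<le> K * sqrt (hs_norm_sq ?Q) * sqrt (hs_norm_sq ?Q)"
    by (intro mult_right_mono) (simp_all add: hs_norm_sq_nonneg)
  then show "cmod (tr (U o\<^sub>B T)) \<le> K * trace_norm T"
    using hs_cauchy_schwarz[OF L Q, unfolded UT] T
    by (simp add: trace_norm_eq hs_norm_sq_nonneg mult.assoc)
qed

lemma tr_has_sum: "trace_class T \<Longrightarrow> ((\<lambda>e. cinner e (T *\<^sub>V e)) has_sum tr T) some_onb"
  using tr_comp_has_sum(1)[of T id_bop] by simp

lemma trace_norm_nonneg: "trace_class T \<Longrightarrow> 0 \<le> trace_norm T"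
  by (simp add: trace_norm_eq hs_norm_sq_nonneg)

lemma trace_class_comp_left: "trace_class T \<Longrightarrow> trace_class (U o\<^sub>B T)"
  by (rule trace_classI)
    (use tr_comp_has_sum(1)[of T] in \<open>metis (no_types, lifting) bop_apply_simps(7) has_sum_imp_summable summable_on_cong\<close>)

lemma trace_class_add: "trace_class S \<Longrightarrow> trace_class T \<Longrightarrow> trace_class (S + T)"
  by (rule trace_classI)
    (simp add: bop_add cinner_add_right summable_on_add has_sum_imp_summable[OF tr_comp_has_sum(1)])

lemma trace_class_scaleC: "trace_class T \<Longrightarrow> trace_class (c *\<^sub>C T)"
  by (rule trace_classI)
    (simp add: bop_scaleC cinner_scaleC_right summable_on_cmult_right has_sum_imp_summable[OF tr_comp_has_sum(1)])

lemma trace_class_diff: "trace_class S \<Longrightarrow> trace_class T \<Longrightarrow> trace_class (S - T)"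
proof -
  assume "trace_class S" "trace_class T"
  then have "trace_class (S + (-1) *\<^sub>C T)"
    by (intro trace_class_add trace_class_scaleC)
  also have "S + (-1) *\<^sub>C T = S - T"
    by (rule bop_eqI) (simp add: scaleC.minus_left scaleC_one)
  finally show ?thesis .
qed

lemma trace_class_0: "trace_class 0"
  by (rule trace_classI) (simp add: bop_zero cinner.zero_right)

lemma trace_class_sum: "(\<And>i. i \<in> I \<Longrightarrow> trace_class (F i)) \<Longrightarrow> trace_class (sum F I)"
  by (induction I rule: infinite_finite_induct) (auto simp: trace_class_0 trace_class_add)

lemma tr_add: "trace_class S \<Longrightarrow> trace_class T \<Longrightarrow> tr (S + T) = tr S + tr T"
  by (rule has_sum_unique[OF tr_has_sum])
    (simp_all add: trace_class_add cinner_add_right has_sum_add tr_has_sum)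

lemma tr_scaleC: "trace_class T \<Longrightarrow> tr (c *\<^sub>C T) = c * tr T"
  by (rule has_sum_unique[OF tr_has_sum])
    (simp_all add: trace_class_scaleC cinner_scaleC_right has_sum_cmult_right tr_has_sum)

lemma tr_diff: "trace_class S \<Longrightarrow> trace_class T \<Longrightarrow> tr (S - T) = tr S - tr T"
  using tr_add[of "S - T" T] trace_class_diff[of S T] by simp

lemma tr_0 [simp]: "tr 0 = 0"
  by (simp add: tr_def cinner.zero_right)

lemma comp_bop_sum_right: "R o\<^sub>B sum F I = (\<Sum>i\<in>I. R o\<^sub>B F i)"
  by (rule bop_eqI) (simp add: bop_apply_sum bop_sum)

lemma tr_sum: "(\<And>i. i \<in> I \<Longrightarrow> trace_class (F i)) \<Longrightarrow> tr (sum F I) = (\<Sum>i\<in>I. tr (F i))"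
  by (induction I rule: infinite_finite_induct) (auto simp: tr_add trace_class_sum)

lemma trace_class_adj_comp: "hilbert_schmidt L \<Longrightarrow> hilbert_schmidt M \<Longrightarrow> trace_class (adj L o\<^sub>B M)"
proof (rule trace_classI)
  fix W assume L: "hilbert_schmidt L" and M: "hilbert_schmidt M"
  show "(\<lambda>e. cinner e (W *\<^sub>V (adj L o\<^sub>B M) *\<^sub>V e)) summable_on some_onb"
    using has_sum_imp_summable[OF hs_inner_has_sum[OF hilbert_schmidt_comp_right[OF L, of "adj W"] M]]
    by (simp add: cinner_bop_left)
qed

lemma trace_norm_comp_le:
  assumes "trace_class T" "contraction V"
  shows "trace_norm (V o\<^sub>B T) \<le> trace_norm T"
proof -
  obtain W where W: "contraction W" "abs_op (V o\<^sub>B T) = W o\<^sub>B (V o\<^sub>B T)"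
    by (rule polar_decomposition[of "V o\<^sub>B T"])
  have "cmod (tr ((W o\<^sub>B V) o\<^sub>B T)) \<le> 1 * trace_norm T"
    using contraction_comp[OF W(1) assms(2)]
    by (intro tr_comp_has_sum(2) assms) (simp_all add: contraction_def)
  then show ?thesis
    unfolding trace_norm_def[of "V o\<^sub>B T"] W(2) comp_bop_assoc
    using complex_Re_le_cmod order_trans by fastforce
qed

section \<open>Operators |x><y| and the dual of a map on the trace class\<close>

definition rank_one :: "'a::complex_hilbert \<Rightarrow> 'a \<Rightarrow> 'a bop" where
  "rank_one x y = Bop (\<lambda>z. cinner y z *\<^sub>C x)"

lemma rank_one_apply [simp]: "rank_one x y *\<^sub>V z = cinner y z *\<^sub>C (x :: 'a::complex_hilbert)"
proof -
  have "bounded_linear (\<lambda>z. cinner y z *\<^sub>C x)"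
    by (rule bounded_linear_compose[OF scaleC.bounded_linear_left cinner.bounded_linear_right])
  then have "bounded_clinear (\<lambda>z. cinner y z *\<^sub>C x)"
    by (simp add: bounded_clinear_def cinner_scaleC_right scaleC_scaleC)
  then show ?thesis by (simp add: rank_one_def Bop_inverse)
qed

lemma comp_rank_one: "U o\<^sub>B rank_one x y = rank_one (U *\<^sub>V x) y"
  by (rule bop_eqI) (simp add: bop_scaleC)

lemma rank_one_add_left: "rank_one (x + y) z = rank_one x z + rank_one y z"
  by (rule bop_eqI) (simp add: scaleC_add_right)

lemma rank_one_add_right: "rank_one x (y + z) = rank_one x y + rank_one x z"
  by (rule bop_eqI) (simp add: cinner_add_left scaleC_add_left)

lemma rank_one_scaleC_left: "rank_one (c *\<^sub>C x) y = c *\<^sub>C rank_one x y"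
  by (rule bop_eqI) (simp add: scaleC_scaleC mult.commute)

lemma rank_one_scaleC_right: "rank_one x (c *\<^sub>C y) = cnj c *\<^sub>C rank_one x y"
  by (rule bop_eqI) (simp add: cinner_scaleC_left scaleC_scaleC)

lemma rank_one_has_sum: "((\<lambda>e. cinner e (rank_one x y *\<^sub>V e)) has_sum cinner y x) some_onb"
  using parseval_cinner[OF is_onb_some_onb, of y x] by (simp add: cinner_scaleC_right)

lemma trace_class_rank_one: "trace_class (rank_one x y)"
proof (rule trace_classI)
  fix W
  show "(\<lambda>e. cinner e (W *\<^sub>V rank_one x y *\<^sub>V e)) summable_on some_onb"
    using has_sum_imp_summable[OF rank_one_has_sum[of "W *\<^sub>V x" y]] by (simp add: bop_scaleC)
qed

lemma tr_comp_rank_one: "tr (U o\<^sub>B rank_one x y) = cinner y (U *\<^sub>V x)"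
  unfolding comp_rank_one tr_def by (rule infsumI) (rule rank_one_has_sum)

lemma tr_rank_one: "tr (rank_one x y) = cinner y x"
  unfolding tr_def by (rule infsumI) (rule rank_one_has_sum)

lemma trace_norm_rank_one_le: "trace_norm (rank_one x y) \<le> norm x * norm y"
proof -
  obtain W where W: "contraction W" "abs_op (rank_one x y) = W o\<^sub>B rank_one x y"
    by (rule polar_decomposition[of "rank_one x y"])
  have "trace_norm (rank_one x y) = Re (cinner y (W *\<^sub>V x))"
    unfolding trace_norm_def W(2) tr_comp_rank_one ..
  also have "\<dots> \<le> norm y * norm (W *\<^sub>V x)"
    using complex_Re_le_cmod cinner_cauchy_schwarz order_trans by blast
  also have "\<dots> \<le> norm y * norm x"
    using W(1) by (intro mult_left_mono) (auto simp: contraction_def)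
  finally show ?thesis by (simp add: mult.commute)
qed

lemma positive_rank_one: "positive (rank_one x x)"
proof -
  have "cinner z (rank_one x x *\<^sub>V z) = complex_of_real ((cmod (cinner x z))\<^sup>2)" for z
    by (simp only: rank_one_apply cinner_scaleC_right cinner_commute[of z x] complex_norm_square)
  then show ?thesis by (simp add: positive_iff del: of_real_power)
qed

text \<open>Finite rank operators are dense in the trace class: for positive \<open>P\<close> with root \<open>L\<close>, subtracting
  finitely many terms of \<open>P = \<Sum>|Le\<rangle>\<langle>Le|\<close> leaves a positive operator, whose trace norm is its trace.\<close>

lemma trace_class_functional_zero:
  fixes f :: "'a::complex_hilbert bop \<Rightarrow> complex"
  assumes add: "\<And>S T. trace_class S \<Longrightarrow> trace_class T \<Longrightarrow> f (S + T) = f S + f T"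
    and bound: "\<And>T. trace_class T \<Longrightarrow> cmod (f T) \<le> C * trace_norm T"
    and rank_one: "\<And>x y. f (rank_one x y) = 0" and T: "trace_class T"
  shows "f T = 0"
proof -
  let ?B = "some_onb :: 'a set"
  obtain V W where V: "contraction V" "T = V o\<^sub>B abs_op T" by (rule polar_decomposition[of T])
  define P where "P = abs_op T"
  define L where "L = sqrt_op P"
  have P: "positive P" "trace_class P"
    using T by (simp_all add: P_def positive_abs_op trace_class_abs trace_class_positive abs_op_positive)
  have L: "hilbert_schmidt L" "adj L = L"
    using P sqrt_op(1)[OF P(1)] by (auto simp: L_def trace_class_positive positive_adj)
  define PF where "PF F = (\<Sum>e\<in>F. rank_one (L *\<^sub>V e) (L *\<^sub>V e))" for F
  have tcF: "trace_class (PF F)" for F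
    by (simp add: PF_def trace_class_sum trace_class_rank_one)
  have f0: "f 0 = 0"
    using add[OF trace_class_0 trace_class_0] by simp
  have fsum: "f (V o\<^sub>B PF F) = 0" for F
  proof -
    have "f (\<Sum>e\<in>F. rank_one (V *\<^sub>V L *\<^sub>V e) (L *\<^sub>V e)) = 0"
      by (induction F rule: infinite_finite_induct)
        (simp_all add: f0 add trace_class_rank_one trace_class_sum rank_one)
    then show ?thesis
      by (simp add: PF_def comp_bop_sum_right comp_rank_one)
  qed
  have PF_cinner: "Re (cinner x (PF F *\<^sub>V x)) = (\<Sum>e\<in>F. (cmod (cinner e (L *\<^sub>V x)))\<^sup>2) \<and> Im (cinner x (PF F *\<^sub>V x)) = 0" for F x
  proof -
    have "cinner x (rank_one (L *\<^sub>V e) (L *\<^sub>V e) *\<^sub>V x) = complex_of_real ((cmod (cinner e (L *\<^sub>V x)))\<^sup>2)" for e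
    proof -
      have "cinner (L *\<^sub>V e) x = cinner e (L *\<^sub>V x)"
        by (simp add: cinner_bop_left L(2))
      moreover have "cinner x (L *\<^sub>V e) = cnj (cinner (L *\<^sub>V e) x)"
        by (rule cinner_commute)
      ultimately show ?thesis
        by (simp only: rank_one_apply cinner_scaleC_right complex_norm_square)
    qed
    then have "cinner x (PF F *\<^sub>V x) = (\<Sum>e\<in>F. complex_of_real ((cmod (cinner e (L *\<^sub>V x)))\<^sup>2))"
      unfolding PF_def bop_apply_sum cinner.sum_right by simp
    then show ?thesis by (simp del: of_real_power)
  qed
  \<comment> \<open>This is Bessel's inequality for \<open>L *\<^sub>V x\<close>.\<close>
  have PPF: "positive (P - PF F)" if "finite F" "F \<subseteq> ?B" for F
    unfolding positive_iff
  proof (intro allI conjI)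
    fix x
    show "0 \<le> Re (cinner x ((P - PF F) *\<^sub>V x))" "Im (cinner x ((P - PF F) *\<^sub>V x)) = 0"
      using PF_cinner[of x F] bessel(2)[OF is_onb_orthonormal[OF is_onb_some_onb] that, of "L *\<^sub>V x"] P(1)
      by (simp_all add: cinner.diff_right positive_norm_sqrt[OF P(1)] flip: L_def)
        (simp add: positive_iff)
  qed
  have tn: "trace_norm (P - PF F) = hs_norm_sq L - (\<Sum>e\<in>F. (norm (L *\<^sub>V e))\<^sup>2)" if "finite F" "F \<subseteq> ?B" for F
  proof -
    have "tr (PF F) = complex_of_real (\<Sum>e\<in>F. (norm (L *\<^sub>V e))\<^sup>2)"
      by (simp add: PF_def tr_sum trace_class_rank_one tr_rank_one cinner_self)
    then show ?thesis
      using P tcF by (simp add: trace_norm_positive PPF that tr_diff tr_positive flip: L_def)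
  qed
  \<comment> \<open>\<open>f\<close> vanishes on the finite rank part and sees only the remainder,
    whose trace norm tends to zero along the finite subsets of the basis.\<close>
  have fT: "f T = f (V o\<^sub>B (P - PF F))" for F
  proof -
    have "T = V o\<^sub>B (P - PF F) + V o\<^sub>B PF F"
      unfolding comp_bop_add_right[symmetric] using V(2) by (simp add: P_def)
    then have "f T = f (V o\<^sub>B (P - PF F)) + f (V o\<^sub>B PF F)"
      using P tcF by (metis add trace_class_comp_left trace_class_diff)
    then show ?thesis by (simp add: fsum)
  qed
  have le: "cmod (f T) \<le> \<bar>C\<bar> * (hs_norm_sq L - (\<Sum>e\<in>F. (norm (L *\<^sub>V e))\<^sup>2))" if "finite F" "F \<subseteq> ?B" for F
  proof -
    have tc: "trace_class (P - PF F)"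
      using P tcF by (intro trace_class_diff)
    have "cmod (f T) \<le> C * trace_norm (V o\<^sub>B (P - PF F))"
      unfolding fT[of F] by (intro bound trace_class_comp_left tc)
    also have "\<dots> \<le> \<bar>C\<bar> * trace_norm (V o\<^sub>B (P - PF F))"
      using trace_norm_nonneg[OF trace_class_comp_left[OF tc]] by (intro mult_right_mono) auto
    also have "\<dots> \<le> \<bar>C\<bar> * trace_norm (P - PF F)"
      by (intro mult_left_mono trace_norm_comp_le tc V) simp
    finally show ?thesis by (simp add: tn that)
  qed
  have "((\<lambda>F. \<bar>C\<bar> * (hs_norm_sq L - (\<Sum>e\<in>F. (norm (L *\<^sub>V e))\<^sup>2))) \<longlongrightarrow> \<bar>C\<bar> * (hs_norm_sq L - hs_norm_sq L))
      (finite_subsets_at_top ?B)"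
    using hilbert_schmidt_has_sum[OF L(1)] by (intro tendsto_intros) (simp add: has_sum_def)
  then have "cmod (f T) \<le> \<bar>C\<bar> * (hs_norm_sq L - hs_norm_sq L)"
    by (rule tendsto_lowerbound) (auto intro!: eventually_finite_subsets_at_top_weakI le)
  then show ?thesis by simp
qed

lemma tr_comp_functional_bound:
  fixes U :: "'a::complex_hilbert bop"
  obtains K where "0 \<le> K" "\<And>T. trace_class T \<Longrightarrow> cmod (tr (U o\<^sub>B T)) \<le> K * trace_norm T"
  using bop_bounded[of U] tr_comp_has_sum(2)[of _ U] by metis

text \<open>The form of the dual operator at \<open>y\<close> and \<open>x\<close> has to be the
  trace of \<open>X o\<^sub>B S (rank_one x y)\<close>, which is bounded because \<open>S\<close> is
  bounded in trace norm. Density of the finite rank operators extends the identity to the trace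
  class, and rank one operators give the uniqueness that \<open>dual_map\<close> demands.\<close>

theorem tr_dual_map:
  fixes S :: "'a::complex_hilbert bop \<Rightarrow> 'a bop"
  assumes S: "bounded_linear_tc S" and T: "trace_class T"
  shows "tr (X o\<^sub>B S T) = tr (dual_map S X o\<^sub>B T)"
proof -
  have S_tc: "trace_class (S T)" if "trace_class T" for T
    using S that by (auto simp: bounded_linear_tc_def)
  have S_add: "S (T + U) = S T + S U" if "trace_class T" "trace_class U" for T U
    using S that by (auto simp: bounded_linear_tc_def)
  have S_scale: "S (c *\<^sub>C T) = c *\<^sub>C S T" if "trace_class T" for c T
    using S that by (auto simp: bounded_linear_tc_def)
  obtain C0 where C0: "\<And>T. trace_class T \<Longrightarrow> trace_norm (S T) \<le> C0 * trace_norm T"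
    using S by (auto simp: bounded_linear_tc_def)
  obtain K where K: "0 \<le> K" "\<And>T. trace_class T \<Longrightarrow> cmod (tr (X o\<^sub>B T)) \<le> K * trace_norm T"
    using tr_comp_functional_bound by metis
  have XS: "cmod (tr (X o\<^sub>B S T)) \<le> K * C0 * trace_norm T" if "trace_class T" for T
    using K(2)[OF S_tc[OF that]] mult_left_mono[OF C0[OF that] K(1)] by simp
  have b_bound: "cmod (tr (X o\<^sub>B S (rank_one x y))) \<le> \<bar>K * C0\<bar> * norm y * norm x" for x y
  proof -
    have "cmod (tr (X o\<^sub>B S (rank_one x y))) \<le> \<bar>K * C0\<bar> * trace_norm (rank_one x y)"
      using XS[OF trace_class_rank_one[of x y]]
        mult_right_mono[OF abs_ge_self[of "K * C0"] trace_norm_nonneg[OF trace_class_rank_one[of x y]]]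
      by linarith
    also have "\<dots> \<le> \<bar>K * C0\<bar> * (norm x * norm y)"
      by (intro mult_left_mono trace_norm_rank_one_le) simp
    finally show ?thesis by (simp add: mult_ac)
  qed
  note simps = S_tc S_add S_scale trace_class_rank_one trace_class_comp_left trace_class_add trace_class_scaleC
    comp_bop_add_right comp_bop_scaleC_right tr_add tr_scaleC
  obtain Y where Y: "\<And>y x. cinner y (Y *\<^sub>V x) = tr (X o\<^sub>B S (rank_one x y))"
  proof (rule bop_of_form[of "\<lambda>y x. tr (X o\<^sub>B S (rank_one x y))" "\<bar>K * C0\<bar>"])
    show "cmod (tr (X o\<^sub>B S (rank_one x y))) \<le> \<bar>K * C0\<bar> * norm y * norm x" for x y
      by (rule b_bound)
    fix Y assume "\<And>y x. cinner y (Y *\<^sub>V x) = tr (X o\<^sub>B S (rank_one x y))"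
    then show thesis by (rule that)
  qed (simp_all add: rank_one_add_left rank_one_add_right rank_one_scaleC_left rank_one_scaleC_right simps)
  obtain K' where K': "0 \<le> K'" "\<And>T. trace_class T \<Longrightarrow> cmod (tr (Y o\<^sub>B T)) \<le> K' * trace_norm T"
    using tr_comp_functional_bound by metis
  have Y_dual: "tr (X o\<^sub>B S T) = tr (Y o\<^sub>B T)" if "trace_class T" for T
  proof -
    have "tr (X o\<^sub>B S T) - tr (Y o\<^sub>B T) = 0"
    proof (rule trace_class_functional_zero[where C = "K * C0 + K'"
          and f = "\<lambda>T. tr (X o\<^sub>B S T) - tr (Y o\<^sub>B T)"])
      show "cmod (tr (X o\<^sub>B S T) - tr (Y o\<^sub>B T)) \<le> (K * C0 + K') * trace_norm T" if "trace_class T" for T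
        using norm_triangle_ineq4[of "tr (X o\<^sub>B S T)" "tr (Y o\<^sub>B T)"] XS[OF that] K'(2)[OF that]
        by (simp add: distrib_right)
      show "tr (X o\<^sub>B S (rank_one x y)) - tr (Y o\<^sub>B rank_one x y) = 0" for x y
        by (simp add: tr_comp_rank_one Y)
    qed (use that in \<open>simp_all add: simps\<close>)
    then show ?thesis by simp
  qed
  have "dual_map S X = Y"
    unfolding dual_map_def
  proof (rule the_equality)
    show "\<forall>T. trace_class T \<longrightarrow> tr (X o\<^sub>B S T) = tr (Y o\<^sub>B T)"
      using Y_dual by blast
    fix Z assume Z: "\<forall>T. trace_class T \<longrightarrow> tr (X o\<^sub>B S T) = tr (Z o\<^sub>B T)"
    show "Z = Y"
    proof (rule bop_eqI_cinner)
      fix x y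
      show "cinner x (Z *\<^sub>V y) = cinner x (Y *\<^sub>V y)"
        unfolding tr_comp_rank_one[symmetric]
        using Z Y_dual trace_class_rank_one by metis
    qed
  qed
  then show ?thesis using Y_dual T by simp
qed

section \<open>Positive operator valued measures\<close>

lemma povm_positive: "is_povm P \<Longrightarrow> \<Delta> \<in> sets borel \<Longrightarrow> positive (P \<Delta>)"
  by (simp add: is_povm_def)

lemma povm_UNIV: "is_povm P \<Longrightarrow> P UNIV = id_bop"
  by (simp add: is_povm_def)

lemma povm_sums:
  "is_povm P \<Longrightarrow> range D \<subseteq> sets borel \<Longrightarrow> disjoint_family D \<Longrightarrow>
    (\<lambda>n. cinner x (P (D n) *\<^sub>V y)) sums cinner x (P (\<Union>n. D n) *\<^sub>V y)"
  by (simp add: is_povm_def)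

text \<open>A constant sequence of empty sets is disjoint with empty union, and a convergent series
  with constant terms has zero terms.\<close>

lemma povm_empty:
  assumes "is_povm P"
  shows "P {} = 0"
proof (rule bop_eqI_cinner)
  fix x y
  have "(\<lambda>n::nat. cinner x (P {} *\<^sub>V y)) sums cinner x (P {} *\<^sub>V y)"
    using povm_sums[OF assms, of "\<lambda>n. {}" x y] by (simp add: disjoint_family_on_def)
  then have "(\<lambda>n::nat. cinner x (P {} *\<^sub>V y)) \<longlonglongrightarrow> 0"
    by (intro summable_LIMSEQ_zero sums_summable)
  then show "cinner x (P {} *\<^sub>V y) = cinner x (0 *\<^sub>V y)"
    by (simp add: cinner.zero_right LIMSEQ_const_iff)
qed

lemma disjoint_family_binaryset: "A \<inter> B = {} \<Longrightarrow> disjoint_family (binaryset A B)"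
  by (auto simp: disjoint_family_on_def binaryset_def)

lemma povm_compl:
  assumes P: "is_povm P" and D: "\<Delta> \<in> sets borel"
  shows "P \<Delta> *\<^sub>V x + P (- \<Delta>) *\<^sub>V x = x"
proof (rule cinner_eqI)
  fix z
  let ?D = "binaryset \<Delta> (- \<Delta>)"
  have "(\<lambda>n. cinner z (P (?D n) *\<^sub>V x)) sums (cinner z (P \<Delta> *\<^sub>V x) + cinner z (P (- \<Delta>) *\<^sub>V x))"
    by (rule binaryset_sums[of "\<lambda>A. cinner z (P A *\<^sub>V x)"]) (simp add: povm_empty[OF P] cinner.zero_right)
  moreover have "(\<lambda>n. cinner z (P (?D n) *\<^sub>V x)) sums cinner z (P (\<Union>n. ?D n) *\<^sub>V x)"
    using D by (intro povm_sums[OF P] disjoint_family_binaryset) (auto simp: range_binaryset_eq)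
  ultimately have "cinner z (P \<Delta> *\<^sub>V x) + cinner z (P (- \<Delta>) *\<^sub>V x) = cinner z (P (\<Union>n. ?D n) *\<^sub>V x)"
    by (rule sums_unique2)
  then show "cinner z (P \<Delta> *\<^sub>V x + P (- \<Delta>) *\<^sub>V x) = cinner z x"
    by (simp add: UN_binaryset_eq povm_UNIV[OF P] cinner_add_right)
qed

lemma povm_le_id:
  assumes "is_povm P" "\<Delta> \<in> sets borel"
  shows "positive (id_bop - P \<Delta>)"
proof -
  have "(id_bop - P \<Delta>) = P (- \<Delta>)"
    by (rule bop_eqI) (use povm_compl[OF assms] in \<open>simp add: algebra_simps\<close>)
  then show ?thesis
    using assms by (auto intro: povm_positive)
qed

text \<open>Splitting \<open>R\<close> into two roots and moving one of them around the trace puts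
  \<open>X\<close> between equal vectors, so that positivity and additivity in \<open>X\<close> can
  be seen term by term.\<close>

lemma tr_comp_positive:
  assumes R: "positive R" "trace_class R"
  shows "((\<lambda>e. cinner (sqrt_op R *\<^sub>V e) (X *\<^sub>V sqrt_op R *\<^sub>V e)) has_sum tr (X o\<^sub>B R)) some_onb"
proof -
  let ?Q = "sqrt_op R"
  have Q: "hilbert_schmidt ?Q" "adj ?Q = ?Q" "?Q o\<^sub>B ?Q = R"
    using R sqrt_op[OF R(1)] by (simp_all add: trace_class_positive positive_adj)
  note XQ = hilbert_schmidt_comp_left[OF Q(1), of X]
  have "tr (X o\<^sub>B R) = tr (adj (adj (X o\<^sub>B ?Q)) o\<^sub>B ?Q)"
    by (simp add: comp_bop_assoc Q)
  also have "\<dots> = tr (adj ?Q o\<^sub>B (X o\<^sub>B ?Q))"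
    using tr_hs_commute[OF hilbert_schmidt_adj[OF XQ] Q(1)] by (simp add: Q)
  finally show ?thesis
    using hs_inner_has_sum[OF Q(1) XQ] by simp
qed

lemma tr_comp_positive_nonneg:
  fixes R X :: "'a::complex_hilbert bop"
  assumes "positive R" "trace_class R" "positive X"
  shows "0 \<le> Re (tr (X o\<^sub>B R))" "Im (tr (X o\<^sub>B R)) = 0"
proof -
  note s = tr_comp_positive[OF assms(1,2), of X]
  show "0 \<le> Re (tr (X o\<^sub>B R))"
    by (rule has_sum_nonneg[OF has_sum_Re[OF s]]) (simp add: positive_Re assms)
  have "((\<lambda>e. 0) has_sum Im (tr (X o\<^sub>B R))) (some_onb :: 'a set)"
    using has_sum_Im[OF s] assms(3) by (simp add: positive_iff)
  then show "Im (tr (X o\<^sub>B R)) = 0"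
    using has_sum_unique has_sum_0_simp by blast
qed

text \<open>After \<open>tr_comp_positive\<close> all terms are nonnegative, so the sum over the
  basis and the sum over the sets may be interchanged.\<close>

lemma povm_tr_sums:
  fixes R :: "'a::complex_hilbert bop"
  assumes P: "is_povm P" and R: "positive R" "trace_class R"
    and D: "range D \<subseteq> sets borel" "disjoint_family D"
  shows "(\<lambda>n. tr (P (D n) o\<^sub>B R)) sums tr (P (\<Union>n. D n) o\<^sub>B R)"
proof -
  let ?B = "some_onb :: 'a set"
  define a where "a \<Delta> e = Re (cinner (sqrt_op R *\<^sub>V e) (P \<Delta> *\<^sub>V sqrt_op R *\<^sub>V e))" for \<Delta> e
  have UD: "(\<Union>n. D n) \<in> sets borel" using D(1) by blast
  have Dn: "D n \<in> sets borel" for n using D(1) by blast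
  have a_nonneg: "0 \<le> a \<Delta> e" if "\<Delta> \<in> sets borel" for \<Delta> e
    using povm_positive[OF P that] by (simp add: a_def positive_Re)
  have a_tr: "(a \<Delta> has_sum Re (tr (P \<Delta> o\<^sub>B R))) ?B" for \<Delta>
    unfolding a_def by (intro has_sum_Re tr_comp_positive R)
  have a_row: "((\<lambda>n. a (D n) e) has_sum a (\<Union>n. D n) e) UNIV" for e
    unfolding a_def using a_nonneg[OF Dn, unfolded a_def]
    by (intro sums_nonneg_imp_has_sum sums_Re povm_sums[OF P D])
  have s: "(\<lambda>(e, n). a (D n) e) summable_on (?B \<times> UNIV)"
    by (rule summable_on_SigmaI[where g = "a (\<Union>n. D n)"])
      (use a_row a_nonneg[OF Dn] has_sum_imp_summable[OF a_tr] in auto)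
  have "((\<lambda>(e, n). a (D n) e) has_sum Re (tr (P (\<Union>n. D n) o\<^sub>B R))) (?B \<times> UNIV)"
    by (rule has_sum_SigmaI[OF _ a_tr s]) (simp add: a_row)
  then have "((\<lambda>(n, e). case (e, n) of (e, n) \<Rightarrow> a (D n) e) has_sum Re (tr (P (\<Union>n. D n) o\<^sub>B R))) (UNIV \<times> ?B)"
    by (subst has_sum_swap) simp
  then have "((\<lambda>n. Re (tr (P (D n) o\<^sub>B R))) has_sum Re (tr (P (\<Union>n. D n) o\<^sub>B R))) UNIV"
    by (rule has_sum_SigmaD) (simp add: a_tr)
  then have "(\<lambda>n. complex_of_real (Re (tr (P (D n) o\<^sub>B R)))) sums complex_of_real (Re (tr (P (\<Union>n. D n) o\<^sub>B R)))"
    by (intro sums_of_real has_sum_imp_sums)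
  moreover have "complex_of_real (Re (tr (P \<Delta> o\<^sub>B R))) = tr (P \<Delta> o\<^sub>B R)" if "\<Delta> \<in> sets borel" for \<Delta>
    using tr_comp_positive_nonneg[OF R povm_positive[OF P that]] by (simp add: complex_eq_iff)
  ultimately show ?thesis using Dn UD by simp
qed

section \<open>Instruments\<close>

lemma cp_instrument_bounded: "cp_instrument \<I> \<Longrightarrow> \<Delta> \<in> sets borel \<Longrightarrow> bounded_linear_tc (\<I> \<Delta>)"
  by (simp add: cp_instrument_def)

lemma cp_instrument_trace_class:
  "cp_instrument \<I> \<Longrightarrow> \<Delta> \<in> sets borel \<Longrightarrow> trace_class T \<Longrightarrow> trace_class (\<I> \<Delta> T)"
  using cp_instrument_bounded[of \<I> \<Delta>] by (auto simp: bounded_linear_tc_def)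

text \<open>This is complete positivity for one by one matrices.\<close>

lemma cp_instrument_positive:
  fixes \<I> :: "real set \<Rightarrow> 'a::complex_hilbert bop \<Rightarrow> 'a bop"
  assumes "cp_instrument \<I>" "\<Delta> \<in> sets borel" "trace_class R" "positive R"
  shows "positive (\<I> \<Delta> R)"
proof -
  have 1: "positive_matrix (Suc 0) (\<lambda>i j. S) \<longleftrightarrow> positive S" for S :: "'a bop"
  proof
    assume "positive_matrix (Suc 0) (\<lambda>i j. S)"
    then show "positive S"
      unfolding positive_matrix_def positive_def by (auto dest: spec[of _ "\<lambda>_. x" for x])
  qed (simp add: positive_matrix_def positive_def)
  have "completely_positive_tc (\<I> \<Delta>)"
    using assms by (simp add: cp_instrument_def)
  then have "positive_matrix (Suc 0) (\<lambda>i j. R) \<longrightarrow> positive_matrix (Suc 0) (\<lambda>i j. \<I> \<Delta> R)"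
    using assms(3) unfolding completely_positive_tc_def
    by (elim allE[of _ "Suc 0"] allE[of _ "\<lambda>i j. R"]) simp
  then show ?thesis using assms(4) by (simp add: 1)
qed

text \<open>Countable additivity is applied to \<open>\<Delta>\<close>, \<open>- \<Delta>\<close>
  and infinitely many empty sets; convergence in trace norm passes to traces against
  \<open>X\<close> by boundedness of that functional.\<close>

lemma cp_instrument_additive:
  fixes \<I> :: "real set \<Rightarrow> 'a::complex_hilbert bop \<Rightarrow> 'a bop"
  assumes \<I>: "cp_instrument \<I>" and D: "\<Delta> \<in> sets borel" and T: "trace_class T"
  shows "tr (X o\<^sub>B \<I> \<Delta> T) + tr (X o\<^sub>B \<I> (- \<Delta>) T) = tr (X o\<^sub>B \<I> UNIV T)"
proof -
  let ?D = "binaryset \<Delta> (- \<Delta>)"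
  let ?E = "\<lambda>n. (\<Sum>k<n. \<I> (?D k) T) - \<I> UNIV T"
  have D': "?D k \<in> sets borel" for k
    using D by (auto simp: binaryset_def)
  have tc: "trace_class (\<I> (?D k) T)" "trace_class (\<I> UNIV T)" for k
    using D' T by (auto intro: cp_instrument_trace_class[OF \<I>])
  have lim: "(\<lambda>n. trace_norm (?E n)) \<longlonglongrightarrow> 0"
    using \<I> T D' disjoint_family_binaryset[of \<Delta> "- \<Delta>"] unfolding cp_instrument_def
    by (elim conjE allE[of _ ?D] allE[of _ T]) (auto simp: UN_binaryset_eq image_subset_iff)
  obtain K where K: "0 \<le> K" "\<And>T. trace_class T \<Longrightarrow> cmod (tr (X o\<^sub>B T)) \<le> K * trace_norm T"
    using tr_comp_functional_bound by metis
  have "(\<lambda>n. K * trace_norm (?E n)) \<longlonglongrightarrow> 0"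
    using tendsto_mult_right_zero[OF lim] by simp
  then have lim': "(\<lambda>n. tr (X o\<^sub>B ?E n)) \<longlonglongrightarrow> 0"
    by (rule Lim_null_comparison[rotated])
      (intro always_eventually allI K(2) trace_class_diff trace_class_sum tc)
  \<comment> \<open>No axiom says directly that \<open>\<I> {} T\<close> vanishes. The errors after
    at least two terms are \<open>?s + of_nat n * c\<close> and tend to zero; consecutive
    differences give \<open>c = 0\<close>, and then \<open>?s = 0\<close>.\<close>
  define c where "c = tr (X o\<^sub>B \<I> {} T)"
  let ?s = "tr (X o\<^sub>B \<I> \<Delta> T) + tr (X o\<^sub>B \<I> (- \<Delta>) T) - tr (X o\<^sub>B \<I> UNIV T)"
  have E: "tr (X o\<^sub>B ?E (Suc (Suc n))) = ?s + of_nat n * c" for n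
  proof -
    have "tr (X o\<^sub>B ?E (Suc (Suc n))) = (\<Sum>k<Suc (Suc n). tr (X o\<^sub>B \<I> (?D k) T)) - tr (X o\<^sub>B \<I> UNIV T)"
      by (simp only: comp_bop_diff_right comp_bop_sum_right tr_diff tr_sum trace_class_comp_left
          trace_class_sum tc)
    also have "(\<Sum>k<Suc (Suc n). tr (X o\<^sub>B \<I> (?D k) T))
        = tr (X o\<^sub>B \<I> \<Delta> T) + tr (X o\<^sub>B \<I> (- \<Delta>) T) + of_nat n * c"
      by (induction n) (simp_all add: binaryset_def c_def algebra_simps)
    finally show ?thesis by simp
  qed
  have seq: "(\<lambda>n. ?s + of_nat n * c) \<longlonglongrightarrow> 0"
    using LIMSEQ_Suc[OF LIMSEQ_Suc[OF lim']] unfolding E .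
  have "(\<lambda>n. (?s + of_nat (Suc n) * c) - (?s + of_nat n * c)) \<longlonglongrightarrow> 0 - 0"
    by (intro tendsto_diff LIMSEQ_Suc[OF seq] seq)
  moreover have "(?s + of_nat (Suc n) * c) - (?s + of_nat n * c) = c" for n
    by (simp add: algebra_simps)
  ultimately have "(\<lambda>n::nat. c) \<longlonglongrightarrow> 0" by simp
  then have "c = 0" by (simp add: LIMSEQ_const_iff)
  then have "?s = 0" using seq by (simp add: LIMSEQ_const_iff)
  then show ?thesis by simp
qed

lemma cinner_dual_map:
  assumes "bounded_linear_tc S"
  shows "cinner y (dual_map S X *\<^sub>V x) = tr (X o\<^sub>B S (rank_one x y))"
  using tr_dual_map[OF assms trace_class_rank_one] by (simp add: tr_comp_rank_one)

lemma positive_dual_map: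
  assumes "cp_instrument \<I>" "\<Delta> \<in> sets borel" "positive X"
  shows "positive (dual_map (\<I> \<Delta>) X)"
  unfolding positive_iff cinner_dual_map[OF cp_instrument_bounded[OF assms(1,2)]]
  using tr_comp_positive_nonneg[OF cp_instrument_positive[OF assms(1,2) trace_class_rank_one positive_rank_one]
      cp_instrument_trace_class[OF assms(1,2) trace_class_rank_one] assms(3)]
  by blast

text \<open>\<open>precisely_measures\<close> speaks of states only, so \<open>x\<close> is
  normalized and its norm pulled out twice; the zero vector is treated apart.\<close>

lemma precise_measurement_tr:
  fixes \<I> :: "real set \<Rightarrow> 'a::complex_hilbert bop \<Rightarrow> 'a bop"
  assumes \<I>: "cp_instrument \<I>" and E: "precisely_measures \<I> E" and D: "\<Delta> \<in> sets borel"
  shows "tr (\<I> \<Delta> (rank_one x x)) = cinner x (E \<Delta> *\<^sub>V x)"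
proof (cases "x = 0")
  case True
  have "\<I> \<Delta> (0 *\<^sub>C rank_one x x) = 0 *\<^sub>C \<I> \<Delta> (rank_one x x)"
    using cp_instrument_bounded[OF \<I> D] trace_class_rank_one[where 'a = 'a] unfolding bounded_linear_tc_def by blast
  moreover have "0 *\<^sub>C R = 0" for R :: "'a bop"
    by (rule bop_eqI) (simp add: scaleC.zero_left)
  moreover have "rank_one x x = 0"
    using True by (intro bop_eqI) (simp add: scaleC.zero_right)
  ultimately show ?thesis
    using True by (simp add: cinner.zero_left)
next
  case False
  define u where "u = complex_of_real (1 / norm x) *\<^sub>C x"
  have x: "x = complex_of_real (norm x) *\<^sub>C u"
    using False by (simp add: u_def scaleC_scaleC scaleC_one)
  have "norm u = 1"
    using False by (simp add: u_def norm_scaleC norm_divide)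
  then have "state (rank_one u u)"
    by (simp add: state_def positive_rank_one trace_class_rank_one tr_rank_one cinner_self)
  then have u: "tr (\<I> \<Delta> (rank_one u u)) = cinner u (E \<Delta> *\<^sub>V u)"
    using E D by (simp add: precisely_measures_def tr_comp_rank_one)
  let ?c = "complex_of_real (norm x) * complex_of_real (norm x)"
  have "rank_one x x = ?c *\<^sub>C rank_one u u"
    by (subst (1 2) x) (simp only: rank_one_scaleC_left rank_one_scaleC_right scaleC_scaleC complex_cnj_complex_of_real)
  moreover have "\<I> \<Delta> (?c *\<^sub>C rank_one u u) = ?c *\<^sub>C \<I> \<Delta> (rank_one u u)"
    using cp_instrument_bounded[OF \<I> D] trace_class_rank_one[where 'a = 'a] unfolding bounded_linear_tc_def by blast
  ultimately have "tr (\<I> \<Delta> (rank_one x x)) = ?c * cinner u (E \<Delta> *\<^sub>V u)"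
    using u by (simp only: tr_scaleC cp_instrument_trace_class[OF \<I> D trace_class_rank_one])
  also have "\<dots> = cinner x (E \<Delta> *\<^sub>V x)"
    by (subst (3 4) x) (simp only: bop_scaleC cinner_scaleC_left cinner_scaleC_right complex_cnj_complex_of_real mult.assoc)
  finally show ?thesis .
qed

lemma positive_eq_0: "positive Y \<Longrightarrow> Re (cinner x (Y *\<^sub>V x)) = 0 \<Longrightarrow> Y *\<^sub>V x = 0"
  by (metis positive_norm_sqrt sqrt_op_apply bop_zero zero_eq_power2 norm_eq_zero)

text \<open>If \<open>0 \<le> X \<le> 1\<close>, the part of \<open>X\<close> that is pulled back along the outcomes in \<open>\<Delta>\<close> is dominated by the
  projection \<open>E(\<Delta>)\<close>, and the part along the other outcomes by its complement. Thus the sum of both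
  commutes with \<open>E(\<Delta>)\<close>.\<close>

theorem dual_map_commute:
  fixes \<I> :: "real set \<Rightarrow> 'a::complex_hilbert bop \<Rightarrow> 'a bop"
  assumes \<I>: "cp_instrument \<I>" and E: "is_pvm E" "precisely_measures \<I> E" and D: "\<Delta> \<in> sets borel"
    and X: "positive X" "positive (id_bop - X)"
  shows "E \<Delta> o\<^sub>B dual_map (\<I> UNIV) X = dual_map (\<I> UNIV) X o\<^sub>B E \<Delta>"
proof -
  let ?Y = "\<lambda>\<Delta>. dual_map (\<I> \<Delta>) X"
  have povm: "is_povm E" using E by (simp add: is_pvm_def)
  have D': "- \<Delta> \<in> sets borel" "UNIV \<in> sets borel" using D by auto
  have sum: "?Y UNIV *\<^sub>V x = ?Y \<Delta> *\<^sub>V x + ?Y (- \<Delta>) *\<^sub>V x" for x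
  proof -
    have "?Y UNIV = ?Y \<Delta> + ?Y (- \<Delta>)"
      by (rule bop_eqI_quadratic)
        (simp add: cinner_add_right cinner_dual_map cp_instrument_bounded[OF \<I>] D D'
          cp_instrument_additive[OF \<I> D trace_class_rank_one])
    then show ?thesis by simp
  qed
  \<comment> \<open>As \<open>X\<close> is at most the identity, the form of
    \<open>?Y \<Gamma>\<close> at \<open>x\<close> is at most the trace of \<open>?R\<close>, which
    is \<open>cinner x (E \<Gamma> *\<^sub>V x) = 0\<close> by precise measurement. A positive
    operator annihilates the zeros of its form.\<close>
  have zero: "?Y \<Gamma> *\<^sub>V x = 0" if G: "\<Gamma> \<in> sets borel" and x: "E \<Gamma> *\<^sub>V x = 0" for \<Gamma> x
  proof (rule positive_eq_0[OF positive_dual_map[OF \<I> G X(1)]])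
    let ?R = "\<I> \<Gamma> (rank_one x x)"
    have R: "positive ?R" "trace_class ?R"
      by (intro cp_instrument_positive[OF \<I> G] cp_instrument_trace_class[OF \<I> G] trace_class_rank_one
          positive_rank_one)+
    have tr0: "tr ?R = 0"
      unfolding precise_measurement_tr[OF \<I> E(2) G] x by (rule cinner.zero_right)
    have "?R - X o\<^sub>B ?R = (id_bop - X) o\<^sub>B ?R"
      by (rule bop_eqI) simp
    then have "tr ?R - tr (X o\<^sub>B ?R) = tr ((id_bop - X) o\<^sub>B ?R)"
      using tr_diff[OF R(2) trace_class_comp_left[OF R(2), of X]] by simp
    then have "Re (tr (X o\<^sub>B ?R)) \<le> 0"
      using tr_comp_positive_nonneg(1)[OF R X(2)] tr0 by (metis diff_0 minus_complex.sel(1) neg_0_le_iff_le zero_complex.sel(1))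
    then show "Re (cinner x (?Y \<Gamma> *\<^sub>V x)) = 0"
      using tr_comp_positive_nonneg(1)[OF R X(1)]
      by (simp add: cinner_dual_map cp_instrument_bounded[OF \<I> G])
  qed
  have EE: "E \<Delta> *\<^sub>V E \<Delta> *\<^sub>V x = E \<Delta> *\<^sub>V x" for x
    using E(1) D unfolding is_pvm_def by (metis bop_apply_simps(7))
  \<comment> \<open>On the range of \<open>E \<Delta>\<close> the part for \<open>- \<Delta>\<close>
    vanishes, and on its kernel the part for \<open>\<Delta>\<close> does. As the right side is
    self-adjoint, taking adjoints yields the commutation.\<close>
  have Y_E: "?Y UNIV o\<^sub>B E \<Delta> = ?Y \<Delta>"
  proof (rule bop_eqI)
    fix x
    have "?Y \<Delta> *\<^sub>V (x - E \<Delta> *\<^sub>V x) = 0"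
      by (rule zero[OF D]) (simp add: bop_diff EE)
    moreover have "?Y (- \<Delta>) *\<^sub>V E \<Delta> *\<^sub>V x = 0"
      using povm_compl[OF povm D, of "E \<Delta> *\<^sub>V x"] by (intro zero[OF D'(1)]) (simp add: EE)
    ultimately show "(?Y UNIV o\<^sub>B E \<Delta>) *\<^sub>V x = ?Y \<Delta> *\<^sub>V x"
      by (simp add: sum bop_diff)
  qed
  have "adj (?Y UNIV o\<^sub>B E \<Delta>) = E \<Delta> o\<^sub>B ?Y UNIV"
    using positive_adj[OF povm_positive[OF povm D]] positive_adj[OF positive_dual_map[OF \<I> D'(2) X(1)]]
    by (simp add: adj_comp)
  moreover have "adj (?Y \<Delta>) = ?Y \<Delta>"
    by (rule positive_adj[OF positive_dual_map[OF \<I> D X(1)]])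
  ultimately show ?thesis by (simp add: Y_E)
qed

lemma is_povm_disturbed_povm:
  fixes \<I> :: "real set \<Rightarrow> 'a::complex_hilbert bop \<Rightarrow> 'a bop"
  assumes \<I>: "cp_instrument \<I>" and E: "is_povm E"
  shows "is_povm (disturbed_povm \<I> E)"
proof -
  let ?P = "disturbed_povm \<I> E"
  have P_def: "?P \<Delta> = dual_map (\<I> UNIV) (E \<Delta>)" for \<Delta>
    by (simp add: disturbed_povm_def nonselective_def)
  have UNIV: "UNIV \<in> sets borel" by simp
  note bounded = cp_instrument_bounded[OF \<I> UNIV]
  have "?P UNIV = id_bop"
  proof (rule bop_eqI_quadratic)
    fix x
    have "tr (\<I> UNIV (rank_one x x)) = tr (rank_one x x)"
      using \<I> by (simp add: cp_instrument_def trace_class_rank_one)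
    then show "cinner x (?P UNIV *\<^sub>V x) = cinner x (id_bop *\<^sub>V x)"
      by (simp add: P_def cinner_dual_map[OF bounded] povm_UNIV[OF E] tr_rank_one)
  qed
  moreover have "(\<lambda>n. cinner x (?P (D n) *\<^sub>V y)) sums cinner x (?P (\<Union>n. D n) *\<^sub>V y)"
    if D: "range D \<subseteq> sets borel" "disjoint_family D" for D x y
  proof -
    \<comment> \<open>\<open>povm_tr_sums\<close> covers positive operators only, so additivity is
      shown on the diagonal and then polarized.\<close>
    have diag: "(\<lambda>n. cinner z (?P (D n) *\<^sub>V z)) sums cinner z (?P (\<Union>n. D n) *\<^sub>V z)" for z
      unfolding P_def cinner_dual_map[OF bounded]
      by (intro povm_tr_sums E D cp_instrument_positive[OF \<I>] cp_instrument_trace_class[OF \<I>]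
          trace_class_rank_one positive_rank_one UNIV)
    show ?thesis
      unfolding cinner_bop_polarization[of x _ y] by (intro sums_divide sums_add sums_diff sums_mult diag)
  qed
  ultimately show ?thesis
    unfolding is_povm_def
    by (auto simp: P_def intro!: positive_dual_map[OF \<I> UNIV] povm_positive[OF E])
qed

section \<open>Moments of positive operator valued measures\<close>

lemma sigma_algebra_borel_UNIV: "sigma_algebra UNIV (sets (borel :: real measure))"
  using sets.sigma_algebra_axioms[of "borel :: real measure"] by simp

lemma sets_measure_of_borel [simp, measurable_cong]:
  "sets (measure_of UNIV (sets (borel :: real measure)) f) = sets borel"
  by (rule sigma_algebra.sets_measure_of_eq[OF sigma_algebra_borel_UNIV])

text \<open>\<open>measure_of\<close> falls back to the zero measure when the set function is not a
  measure, so this check gives \<open>vector_measure\<close> and \<open>state_measure\<close> their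
  intended values.\<close>

lemma emeasure_measure_of_sums:
  fixes f :: "real set \<Rightarrow> real"
  assumes nonneg: "\<And>\<Delta>. \<Delta> \<in> sets borel \<Longrightarrow> 0 \<le> f \<Delta>" and empty: "f {} = 0"
    and sums: "\<And>D. range D \<subseteq> sets borel \<Longrightarrow> disjoint_family D \<Longrightarrow> (\<lambda>n. f (D n)) sums f (\<Union>n. D n)"
    and D: "\<Delta> \<in> sets borel"
  shows "emeasure (measure_of UNIV (sets borel) (\<lambda>\<Delta>. ennreal (f \<Delta>))) \<Delta> = ennreal (f \<Delta>)"
proof (rule emeasure_measure_of_sigma[OF sigma_algebra_borel_UNIV _ _ D])
  show "Sigma_Algebra.positive (sets borel) (\<lambda>\<Delta>. ennreal (f \<Delta>))"
    by (simp add: Sigma_Algebra.positive_def empty)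
  show "countably_additive (sets borel) (\<lambda>\<Delta>. ennreal (f \<Delta>))"
    unfolding countably_additive_def
  proof (intro allI impI)
    fix D :: "nat \<Rightarrow> real set" assume D: "range D \<subseteq> sets borel" "disjoint_family D"
    then show "(\<Sum>n. ennreal (f (D n))) = ennreal (f (\<Union>n. D n))"
      by (intro suminf_ennreal_eq nonneg sums) auto
  qed
qed

lemma povm_cinner_sums:
  "is_povm P \<Longrightarrow> range D \<subseteq> sets borel \<Longrightarrow> disjoint_family D \<Longrightarrow>
    (\<lambda>n. Re (cinner x (P (D n) *\<^sub>V x))) sums Re (cinner x (P (\<Union>n. D n) *\<^sub>V x))"
  by (intro sums_Re povm_sums)

lemma sets_vector_measure [simp, measurable_cong]: "sets (vector_measure P x) = sets borel"
  unfolding vector_measure_def by (rule sets_measure_of_borel)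

lemma space_vector_measure [simp]: "space (vector_measure P x) = UNIV"
  by (simp add: vector_measure_def space_measure_of_conv)

lemma emeasure_vector_measure:
  assumes P: "is_povm P" and D: "\<Delta> \<in> sets borel"
  shows "emeasure (vector_measure P x) \<Delta> = ennreal (Re (cinner x (P \<Delta> *\<^sub>V x)))"
  unfolding vector_measure_def
  by (rule emeasure_measure_of_sums)
    (simp_all add: P D positive_Re povm_positive povm_empty povm_cinner_sums cinner.zero_right)

lemma finite_vector_measure: "is_povm P \<Longrightarrow> finite_measure (vector_measure P x)"
  by (rule finite_measureI) (simp add: emeasure_vector_measure)

lemma state_measure:
  assumes P: "is_povm P" and R: "positive R" "trace_class R" and D: "\<Delta> \<in> sets borel"
  shows "emeasure (state_measure P R) \<Delta> = ennreal (Re (tr (P \<Delta> o\<^sub>B R)))"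
  unfolding state_measure_def
proof (rule emeasure_measure_of_sums[OF _ _ _ D])
  show "Re (tr (P {} o\<^sub>B R)) = 0"
  proof -
    have "(0 :: 'a bop) o\<^sub>B R = 0" by (rule bop_eqI) simp
    then show ?thesis by (simp add: povm_empty[OF P])
  qed
  show "0 \<le> Re (tr (P \<Delta> o\<^sub>B R))" if "\<Delta> \<in> sets borel" for \<Delta>
    by (intro tr_comp_positive_nonneg R povm_positive[OF P that])
qed (intro sums_Re povm_tr_sums P R)

section \<open>Densities of the measures <x|P|y>\<close>

lemma ex_density:
  assumes fin: "finite_measure M" "finite_measure N" and sets: "sets M = sets borel" "sets N = sets borel"
    and ac: "absolutely_continuous M N"
  shows "\<exists>h :: 'a::topological_space \<Rightarrow> real. h \<in> borel_measurable borel \<and> (\<forall>t. 0 \<le> h t) \<and> N = density M (\<lambda>t. ennreal (h t))"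
proof -
  note meas = measurable_cong_sets[OF sets(1) refl]
  obtain f :: "'a \<Rightarrow> ennreal" where f: "f \<in> borel_measurable M" "density M f = N"
    using finite_measure.Radon_Nikodym_finite_measure[OF fin(1,2) _ ac] sets by auto
  have "(\<integral>\<^sup>+t. f t \<partial>M) = emeasure N (space N)"
    using f emeasure_density[OF f(1), of "space M"] by (auto simp: cong: nn_integral_cong)
  then have "(\<integral>\<^sup>+t. f t \<partial>M) \<noteq> \<infinity>"
    using finite_measure.emeasure_finite[OF fin(2)] by (simp add: top.not_eq_extremum)
  then have "AE t in M. f t \<noteq> \<infinity>"
    by (rule nn_integral_PInf_AE[OF f(1)])
  then have "AE t in M. f t = ennreal (enn2real (f t))"
    by eventually_elim (simp add: top.not_eq_extremum)
  then have "density M f = density M (\<lambda>t. ennreal (enn2real (f t)))"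
    by (intro density_cong f) (use f(1) in measurable)
  then show ?thesis
    using f by (intro exI[of _ "\<lambda>t. enn2real (f t)"]) (auto simp flip: meas)
qed

text \<open>The set where \<open>g\<close> is negative is itself a test set, and the integral over
  it can only be zero.\<close>

lemma AE_nonneg_of_set_integrals:
  fixes g :: "'a \<Rightarrow> real"
  assumes g: "integrable M g" and nonneg: "\<And>A. A \<in> sets M \<Longrightarrow> 0 \<le> (LINT t:A|M. g t)"
  shows "AE t in M. 0 \<le> g t"
proof -
  have [measurable]: "g \<in> borel_measurable M" using g by simp
  let ?A = "{t \<in> space M. g t < 0}"
  let ?f = "\<lambda>t. indicator ?A t * (- g t)"
  have A: "?A \<in> sets M" by measurable
  have int: "integrable M ?f"
    using integrable_real_mult_indicator[OF A integrable_minus[OF g]] by (simp add: mult.commute)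
  have "integral\<^sup>L M ?f = - (LINT t:?A|M. g t)"
    by (simp add: set_lebesgue_integral_def)
  then have "integral\<^sup>L M ?f \<le> 0" using nonneg[OF A] by simp
  moreover have f0: "0 \<le> ?f t" for t by (auto simp: indicator_def)
  then have "0 \<le> integral\<^sup>L M ?f" by (intro integral_nonneg_AE AE_I2)
  ultimately have "AE t in M. ?f t = 0"
    using integral_nonneg_eq_0_iff_AE[OF int] f0 by auto
  then show ?thesis
    by (rule AE_mp) (auto intro!: AE_I2 simp: indicator_def split: if_splits)
qed

text \<open>A Hermitian form with diagonal entries \<open>a\<close> and \<open>b\<close> is tested
  at the vectors \<open>(c, 1)\<close>, and its determinant comes out nonnegative. Countably many
  \<open>c\<close> are used because the condition will hold almost everywhere for each
  \<open>c\<close> separately; continuity supplies the others.\<close>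

lemma hermitian_form_bound:
  fixes h :: complex and a b :: real
  assumes "countable C" and dense: "\<And>X :: complex set. open X \<Longrightarrow> X \<noteq> {} \<Longrightarrow> \<exists>d\<in>C. d \<in> X"
    and pos: "\<And>c. c \<in> C \<Longrightarrow> 0 \<le> (cmod c)\<^sup>2 * a + 2 * Re (cnj c * h) + b" and "0 \<le> a" "0 \<le> b"
  shows "(cmod h)\<^sup>2 \<le> a * b"
proof -
  have all: "0 \<le> (cmod c)\<^sup>2 * a + 2 * Re (cnj c * h) + b" for c
  proof (rule ccontr)
    assume neg: "\<not> ?thesis"
    let ?X = "{c. (cmod c)\<^sup>2 * a + 2 * Re (cnj c * h) + b < 0}"
    have "open ?X"
      by (intro open_Collect_less continuous_intros)
    moreover have "c \<in> ?X" using neg by (simp only: mem_Collect_eq not_le)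
    ultimately obtain d where "d \<in> C" "d \<in> ?X" using dense[of ?X] by blast
    then show False using pos[of d] by (simp only: mem_Collect_eq not_le flip: not_less)
  qed
  \<comment> \<open>This tests \<open>c = - s * h\<close>. For \<open>a > 0\<close> the best choice
    is \<open>s = 1 / a\<close>; for \<open>a = 0\<close> a large \<open>s\<close> gives a
    contradiction unless \<open>h = 0\<close>.\<close>
  have quad: "0 \<le> s\<^sup>2 * (cmod h)\<^sup>2 * a - 2 * s * (cmod h)\<^sup>2 + b" for s
  proof -
    have 1: "Re (cnj (- complex_of_real s * h) * h) = - (s * (cmod h)\<^sup>2)"
      by (simp add: cmod_power2) (simp add: power2_eq_square algebra_simps)
    have 2: "(cmod (- complex_of_real s * h))\<^sup>2 = s\<^sup>2 * (cmod h)\<^sup>2"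
      by (simp add: norm_mult power_mult_distrib)
    show ?thesis
      using all[of "- complex_of_real s * h"] unfolding 1 2 by (simp add: mult.assoc)
  qed
  show ?thesis
  proof (cases "a = 0")
    case False
    then have "a > 0" using \<open>0 \<le> a\<close> by simp
    have eq: "(1 / a)\<^sup>2 * (cmod h)\<^sup>2 * a - 2 * (1 / a) * (cmod h)\<^sup>2 + b = b - (cmod h)\<^sup>2 / a"
      using \<open>a > 0\<close> by (simp add: power2_eq_square field_simps)
    then show ?thesis
      using quad[of "1 / a"] \<open>a > 0\<close> unfolding eq by (simp add: field_simps)
  next
    case True
    have "(cmod h)\<^sup>2 = 0"
    proof (rule ccontr)
      assume "(cmod h)\<^sup>2 \<noteq> 0"
      then show False
        using quad[of "(b + 1) / (2 * (cmod h)\<^sup>2)"] True \<open>0 \<le> b\<close> by (simp add: field_simps)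
    qed
    then show ?thesis using True by simp
  qed
qed

text \<open>The right side of the hypothesis is minimal at \<open>s = sqrt V / sqrt X\<close>; if
  \<open>X\<close> or \<open>V\<close> vanishes, a large or a small \<open>s\<close> makes it
  arbitrarily small. This turns a weighted pointwise bound into Cauchy-Schwarz for
  integrals.\<close>

lemma le_sqrt_mult_of_scaled:
  fixes a X V :: real
  assumes le: "\<And>s. 0 < s \<Longrightarrow> a \<le> (s * X + V / s) / 2" and "0 \<le> X" "0 \<le> V"
  shows "a \<le> sqrt X * sqrt V"
proof (cases "X = 0 \<or> V = 0")
  case False
  then have pos: "sqrt X > 0" "sqrt V > 0" using assms by auto
  have "sqrt V / sqrt X * X = sqrt X * sqrt V"
    using pos \<open>0 \<le> X\<close> by (metis nonzero_mult_div_cancel_left real_div_sqrt times_divide_eq_left mult.commute times_divide_eq_right)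
  moreover have "V / (sqrt V / sqrt X) = sqrt X * sqrt V"
    using pos \<open>0 \<le> V\<close> by (simp add: real_div_sqrt divide_divide_eq_right mult.commute[of "sqrt X"] flip: times_divide_eq_left)
  ultimately show ?thesis
    using le[of "sqrt V / sqrt X"] pos by (simp add: mult.commute)
next
  case True
  have "a \<le> 0"
  proof (rule ccontr)
    assume "\<not> a \<le> 0"
    then have "a > 0" by simp
    show False
    proof (cases "X = 0")
      case True
      then show False
        using le[of "(V + 1) / a"] \<open>a > 0\<close> \<open>0 \<le> V\<close> mult_nonneg_nonneg[OF \<open>0 \<le> V\<close> less_imp_le[OF \<open>a > 0\<close>]] by (simp add: field_simps)
    next
      case False
      then have "V = 0" using \<open>X = 0 \<or> V = 0\<close> by simp
      then show False
        using le[of "a / (X + 1)"] \<open>a > 0\<close> \<open>0 \<le> X\<close> mult_nonneg_nonneg[OF \<open>0 \<le> X\<close> less_imp_le[OF \<open>a > 0\<close>]] by (simp add: field_simps)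
    qed
  qed
  then show ?thesis using True by auto
qed

text \<open>Cauchy-Schwarz for POVMs: relative to a measure dominating <z|P|z> for all
  \<open>z\<close> in the span of \<open>x\<close> and \<open>y\<close>, the squared modulus of the
  density of <x|P|y> is at most the product of the two diagonal densities. \<open>u\<close> is left
  free since it will be the identity as well as the error of a step function.\<close>

lemma povm_density:
  fixes P :: "real set \<Rightarrow> 'a::complex_hilbert bop"
  assumes P: "is_povm P"
  shows "\<exists>M h. sets M = sets borel \<and> finite_measure M \<and> integrable M h \<and>
    (\<forall>\<Delta>\<in>sets borel. cinner x (P \<Delta> *\<^sub>V y) = (LINT t:\<Delta>|M. h t)) \<and>
    (\<forall>u \<in> borel_measurable borel. integrable (vector_measure P y) (\<lambda>t. (u t)\<^sup>2) \<longrightarrow>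
      integrable M (\<lambda>t. complex_of_real (u t) * h t) \<and>
      cmod (LINT t|M. complex_of_real (u t) * h t) \<le> norm x * sqrt (LINT t|vector_measure P y. (u t)\<^sup>2))"
proof -
  define q where "q z \<Delta> = Re (cinner z (P \<Delta> *\<^sub>V z))" for z \<Delta>
  have q_nonneg: "0 \<le> q z \<Delta>" if "\<Delta> \<in> sets borel" for z \<Delta>
    using P that by (simp add: q_def positive_Re povm_positive)
  define M where "M = measure_of UNIV (sets borel) (\<lambda>\<Delta>. ennreal (q x \<Delta> + q y \<Delta>))"
  have sets_M [simp, measurable_cong]: "sets M = sets borel"
    unfolding M_def by (rule sets_measure_of_borel)
  have space_M [simp]: "space M = UNIV"
    by (simp add: M_def space_measure_of_conv)
  have em_M: "emeasure M \<Delta> = ennreal (q x \<Delta> + q y \<Delta>)" if "\<Delta> \<in> sets borel" for \<Delta>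
    unfolding M_def
  proof (rule emeasure_measure_of_sums[OF _ _ _ that])
    show "q x {} + q y {} = 0"
      by (simp add: q_def povm_empty[OF P] cinner.zero_right)
    show "(\<lambda>n. q x (D n) + q y (D n)) sums (q x (\<Union>n. D n) + q y (\<Union>n. D n))"
      if "range D \<subseteq> sets borel" "disjoint_family D" for D
      unfolding q_def by (intro sums_add povm_cinner_sums P that)
  qed (simp add: q_nonneg)
  have fin_M: "finite_measure M"
    by (rule finite_measureI) (simp add: em_M)
  \<comment> \<open>On a null set of \<open>M\<close> the operator \<open>P \<Delta>\<close>
    annihilates \<open>x\<close> and \<open>y\<close>, hence every combination; this is the absolute
    continuity.\<close>
  have ex_D: "\<exists>h. h \<in> borel_measurable borel \<and> (\<forall>t. 0 \<le> h t) \<and>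
      vector_measure P (a *\<^sub>C x + b *\<^sub>C y) = density M (\<lambda>t. ennreal (h t))" for a b
  proof (rule ex_density[OF fin_M finite_vector_measure[OF P] sets_M sets_vector_measure])
    show "absolutely_continuous M (vector_measure P (a *\<^sub>C x + b *\<^sub>C y))"
      unfolding absolutely_continuous_def
    proof
      fix \<Delta> assume "\<Delta> \<in> null_sets M"
      then have D: "\<Delta> \<in> sets borel" and "q x \<Delta> + q y \<Delta> \<le> 0"
        by (auto simp: null_sets_def em_M ennreal_eq_0_iff)
      then have "q x \<Delta> = 0" "q y \<Delta> = 0"
        using q_nonneg[OF D, of x] q_nonneg[OF D, of y] by auto
      then have "P \<Delta> *\<^sub>V x = 0" "P \<Delta> *\<^sub>V y = 0"
        using positive_eq_0[OF povm_positive[OF P D]] by (auto simp: q_def)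
      then show "\<Delta> \<in> null_sets (vector_measure P (a *\<^sub>C x + b *\<^sub>C y))"
        using D by (auto simp: null_sets_def emeasure_vector_measure[OF P D] bop_add bop_scaleC
            scaleC.zero_right cinner.zero_right)
    qed
  qed
  then obtain D where D [measurable]: "\<And>a b. D a b \<in> borel_measurable borel" and D_nonneg: "\<And>a b t. 0 \<le> D a b t"
    and D_density: "\<And>a b. vector_measure P (a *\<^sub>C x + b *\<^sub>C y) = density M (\<lambda>t. ennreal (D a b t))"
    by metis
  have D_meas [measurable]: "D a b \<in> borel_measurable M" for a b
    using D by simp
  have integral_D: "integrable M (\<lambda>t. D a b t * f t) \<longleftrightarrow> integrable (vector_measure P (a *\<^sub>C x + b *\<^sub>C y)) f"
      "(LINT t|M. D a b t * f t) = (LINT t|vector_measure P (a *\<^sub>C x + b *\<^sub>C y). f t)"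
    if "f \<in> borel_measurable borel" for a b and f :: "real \<Rightarrow> real"
    using that unfolding D_density
    by (subst integrable_density integral_density; simp add: D_nonneg)+
  have D_int [simp]: "integrable M (D a b)" for a b
  proof -
    interpret finite_measure "vector_measure P (a *\<^sub>C x + b *\<^sub>C y)"
      by (rule finite_vector_measure[OF P])
    show ?thesis using integral_D(1)[of "\<lambda>_. 1" a b] by simp
  qed
  have D_set: "(LINT t:\<Delta>|M. D a b t) = q (a *\<^sub>C x + b *\<^sub>C y) \<Delta>" if "\<Delta> \<in> sets borel" for a b \<Delta>
  proof -
    have "(LINT t:\<Delta>|M. D a b t) = (LINT t|vector_measure P (a *\<^sub>C x + b *\<^sub>C y). indicator \<Delta> t)"
      unfolding set_lebesgue_integral_def
      using integral_D(2)[of "indicator \<Delta>" a b] that by (simp add: mult.commute)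
    also have "\<dots> = q (a *\<^sub>C x + b *\<^sub>C y) \<Delta>"
      using that emeasure_vector_measure[OF P that] q_nonneg[OF that]
      by (simp add: measure_def q_def)
    finally show ?thesis .
  qed
  \<comment> \<open>Polarization is carried out on the densities themselves.\<close>
  define h where "h t = (complex_of_real (D 1 1 t) - complex_of_real (D 1 (-1) t)
    - \<i> * complex_of_real (D 1 \<i> t) + \<i> * complex_of_real (D 1 (-\<i>) t)) / 4" for t
  have h_int: "integrable M h"
    unfolding h_def by (intro Bochner_Integration.integrable_add Bochner_Integration.integrable_diff integrable_divide integrable_mult_right integrable_of_real D_int)
  have h_set: "(LINT t:\<Delta>|M. h t) = cinner x (P \<Delta> *\<^sub>V y)" if "\<Delta> \<in> sets borel" for \<Delta>
  proof -
    have si: "set_integrable M \<Delta> (\<lambda>t. complex_of_real (D a b t))" for a b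
      unfolding set_integrable_def
      using that by (intro integrable_mult_indicator integrable_of_real D_int) simp
    have val: "(LINT t:\<Delta>|M. complex_of_real (D a b t)) = cinner (a *\<^sub>C x + b *\<^sub>C y) (P \<Delta> *\<^sub>V (a *\<^sub>C x + b *\<^sub>C y))" for a b
      unfolding set_integral_complex_of_real D_set[OF that] q_def
      by (rule positive_of_real[OF povm_positive[OF P that]])
    have "(LINT t:\<Delta>|M. h t) = ((LINT t:\<Delta>|M. complex_of_real (D 1 1 t)) - (LINT t:\<Delta>|M. complex_of_real (D 1 (-1) t))
        - \<i> * (LINT t:\<Delta>|M. complex_of_real (D 1 \<i> t)) + \<i> * (LINT t:\<Delta>|M. complex_of_real (D 1 (-\<i>) t))) / 4"
      unfolding h_def
      by (simp only: set_integral_divide_zero set_integral_add set_integral_diff set_integral_mult_right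
          set_integrable_mult_right si simp_thms)
    also have "\<dots> = cinner x (P \<Delta> *\<^sub>V y)"
      unfolding val scaleC_one
      by (rule cinner_bop_polarization[symmetric])
    finally show ?thesis .
  qed
  have [measurable]: "h \<in> borel_measurable M" using h_int by simp
  \<comment> \<open>The expression is the density of <cx + y|P|cx + y>. The exceptional null set
    depends on \<open>c\<close>.\<close>
  have form: "AE t in M. 0 \<le> (cmod c)\<^sup>2 * D 1 0 t + 2 * Re (cnj c * h t) + D 0 1 t" for c
  proof (rule AE_nonneg_of_set_integrals)
    show "integrable M (\<lambda>t. (cmod c)\<^sup>2 * D 1 0 t + 2 * Re (cnj c * h t) + D 0 1 t)"
      by (intro Bochner_Integration.integrable_add integrable_mult_right integrable_Re D_int h_int)
    fix \<Delta> assume "\<Delta> \<in> sets M"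
    then have D': "\<Delta> \<in> sets borel" by simp
    have si: "set_integrable M \<Delta> (D a b)" "set_integrable M \<Delta> h" for a b
      unfolding set_integrable_def
      by (rule integrable_mult_indicator; use D' h_int in simp)+
    have re: "(LINT t:\<Delta>|M. Re (cnj c * h t)) = Re (cnj c * cinner x (P \<Delta> *\<^sub>V y))"
    proof -
      have "(LINT t:\<Delta>|M. Re (cnj c * h t)) = Re (LINT t:\<Delta>|M. cnj c * h t)"
        using set_integrable_mult_right[of "cnj c" M \<Delta> h] si(2)
        unfolding set_lebesgue_integral_def set_integrable_def
        by (subst integral_Re[symmetric]) (auto simp: algebra_simps)
      then show ?thesis by (simp add: h_set[OF D'])
    qed
    have sre: "set_integrable M \<Delta> (\<lambda>t. Re (cnj c * h t))"
      unfolding set_integrable_def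
      using D' by (intro integrable_mult_indicator integrable_Re integrable_mult_right h_int) simp
    have "(LINT t:\<Delta>|M. (cmod c)\<^sup>2 * D 1 0 t + 2 * Re (cnj c * h t) + D 0 1 t)
        = (cmod c)\<^sup>2 * q x \<Delta> + 2 * Re (cnj c * cinner x (P \<Delta> *\<^sub>V y)) + q y \<Delta>"
      by (simp only: set_integral_add set_integral_mult_right set_integrable_mult_right si sre re D_set[OF D']
          scaleC_one scaleC.zero_left add_0_left add_0_right simp_thms)
    also have "\<dots> = q (c *\<^sub>C x + y) \<Delta>"
    proof -
      have "cinner y (P \<Delta> *\<^sub>V x) = cnj (cinner x (P \<Delta> *\<^sub>V y))"
        by (metis positive_adj[OF povm_positive[OF P D']] cinner_bop_left cinner_commute)
      then have "cinner (c *\<^sub>C x + y) (P \<Delta> *\<^sub>V (c *\<^sub>C x + y)) = complex_of_real ((cmod c)\<^sup>2) * cinner x (P \<Delta> *\<^sub>V x)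
          + (cnj c * cinner x (P \<Delta> *\<^sub>V y) + cnj (cnj c * cinner x (P \<Delta> *\<^sub>V y))) + cinner y (P \<Delta> *\<^sub>V y)"
        by (simp add: bop_add bop_scaleC cinner_add_left cinner_add_right cinner_scaleC_left
            cinner_scaleC_right complex_norm_square algebra_simps del: of_real_power)
      then show ?thesis
        by (simp add: q_def complex_add_cnj del: of_real_power complex_cnj_mult)
    qed
    finally show "0 \<le> (LINT t:\<Delta>|M. (cmod c)\<^sup>2 * D 1 0 t + 2 * Re (cnj c * h t) + D 0 1 t)"
      using q_nonneg[OF D'] by simp
  qed
  obtain C :: "complex set" where C: "countable C" "\<And>X :: complex set. open X \<Longrightarrow> X \<noteq> {} \<Longrightarrow> \<exists>d\<in>C. d \<in> X"
    using countable_dense_exists by metis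
  have "AE t in M. \<forall>c\<in>C. 0 \<le> (cmod c)\<^sup>2 * D 1 0 t + 2 * Re (cnj c * h t) + D 0 1 t"
    using form C(1) by (subst AE_ball_countable) auto
  then have h_bound: "AE t in M. (cmod (h t))\<^sup>2 \<le> D 1 0 t * D 0 1 t"
    by eventually_elim (rule hermitian_form_bound[OF C]; simp add: D_nonneg)
  have X: "(LINT t|M. D 1 0 t) = (norm x)\<^sup>2"
    using D_set[of UNIV 1 0]
    by (simp add: set_lebesgue_integral_def q_def povm_UNIV[OF P] Re_cinner_self scaleC_one scaleC.zero_left)
  show ?thesis
  proof (intro exI conjI ballI impI)
    show "cinner x (P \<Delta> *\<^sub>V y) = (LINT t:\<Delta>|M. h t)" if "\<Delta> \<in> sets borel" for \<Delta>
      using h_set[OF that] by simp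
    fix u :: "real \<Rightarrow> real"
    assume u [measurable]: "u \<in> borel_measurable borel" and u2: "integrable (vector_measure P y) (\<lambda>t. (u t)\<^sup>2)"
    let ?V = "LINT t|vector_measure P y. (u t)\<^sup>2"
    have [measurable]: "u \<in> borel_measurable M" using u by simp
    have V: "integrable M (\<lambda>t. D 0 1 t * (u t)\<^sup>2)" "(LINT t|M. D 0 1 t * (u t)\<^sup>2) = ?V"
      using integral_D[of "\<lambda>t. (u t)\<^sup>2" 0 1] u2 by (simp_all add: scaleC_one scaleC.zero_left)
    \<comment> \<open>The arithmetic-geometric mean inequality with a free weight \<open>s\<close>,
      which is optimized only after integration.\<close>
    have le: "AE t in M. cmod (complex_of_real (u t) * h t) \<le> (s * D 1 0 t + D 0 1 t * (u t)\<^sup>2 / s) / 2"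
      if "s > 0" for s
      using h_bound
    proof eventually_elim
      case (elim t)
      let ?p = "sqrt (s * D 1 0 t)" and ?r = "\<bar>u t\<bar> * sqrt (D 0 1 t / s)"
      have "cmod (h t) \<le> sqrt (D 1 0 t * D 0 1 t)"
        using elim by (rule real_le_rsqrt)
      also have "\<dots> = sqrt (s * D 1 0 t) * sqrt (D 0 1 t / s)"
        using \<open>s > 0\<close> by (simp flip: real_sqrt_mult)
      finally have "cmod (complex_of_real (u t) * h t) \<le> ?p * ?r"
        using mult_left_mono[of _ _ "\<bar>u t\<bar>"] by (fastforce simp: norm_mult mult_ac)
      also have "\<dots> \<le> (?p\<^sup>2 + ?r\<^sup>2) / 2"
        using sum_squares_bound[of ?p ?r] by simp
      also have "\<dots> = (s * D 1 0 t + D 0 1 t * (u t)\<^sup>2 / s) / 2"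
        using \<open>s > 0\<close> D_nonneg by (simp add: power_mult_distrib)
      finally show ?case .
    qed
    have bound_int: "integrable M (\<lambda>t. (s * D 1 0 t + D 0 1 t * (u t)\<^sup>2 / s) / 2)" for s
      by (intro integrable_divide Bochner_Integration.integrable_add integrable_mult_right D_int V)
    show uh: "integrable M (\<lambda>t. complex_of_real (u t) * h t)"
    proof (rule Bochner_Integration.integrable_bound[OF bound_int[of 1]])
      show "AE t in M. norm (complex_of_real (u t) * h t) \<le> norm ((1 * D 1 0 t + D 0 1 t * (u t)\<^sup>2 / 1) / 2)"
        using le[OF zero_less_one] by eventually_elim simp
    qed measurable
    have "cmod (LINT t|M. complex_of_real (u t) * h t) \<le> sqrt ((norm x)\<^sup>2) * sqrt ?V"
    proof (rule le_sqrt_mult_of_scaled)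
      fix s :: real assume "0 < s"
      have "cmod (LINT t|M. complex_of_real (u t) * h t) \<le> (LINT t|M. cmod (complex_of_real (u t) * h t))"
        by (rule integral_norm_bound)
      also have "\<dots> \<le> (LINT t|M. (s * D 1 0 t + D 0 1 t * (u t)\<^sup>2 / s) / 2)"
        by (rule integral_mono_AE[OF integrable_norm[OF uh] bound_int le[OF \<open>0 < s\<close>]])
      also have "\<dots> = (s * (norm x)\<^sup>2 + ?V / s) / 2"
        using V X by simp
      finally show "cmod (LINT t|M. complex_of_real (u t) * h t) \<le> (s * (norm x)\<^sup>2 + ?V / s) / 2" .
    qed simp_all
    then show "cmod (LINT t|M. complex_of_real (u t) * h t) \<le> norm x * sqrt ?V"
      by simp
  qed (fact sets_M fin_M h_int)+
qed

text \<open>The identity on the line is approximated by \<open>\<lfloor>t(n + 1)\<rfloor> / (n + 1)\<close>, cut off to finitely many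
  values. The corresponding sums converge to integrals of the identity, for complex measures and POVMs
  alike. So the integrals inherit linearity and commutation from the sums.\<close>

definition step_index :: "nat \<Rightarrow> int set" where
  "step_index n = {- (int n + 1)\<^sup>2 .. (int n + 1)\<^sup>2}"

definition step_set :: "nat \<Rightarrow> int \<Rightarrow> real set" where
  "step_set n k = {t. \<lfloor>t * (real n + 1)\<rfloor> = k}"

definition step_value :: "nat \<Rightarrow> int \<Rightarrow> real" where
  "step_value n k = real_of_int k / (real n + 1)"

definition step_fun :: "nat \<Rightarrow> real \<Rightarrow> real" where
  "step_fun n t = (\<Sum>k\<in>step_index n. step_value n k * indicator (step_set n k) t)"

lemma step_set_borel [measurable]: "step_set n k \<in> sets borel"
  unfolding step_set_def by measurable

lemma finite_step_index [simp]: "finite (step_index n)"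
  by (simp add: step_index_def)

lemma step_fun_eq:
  "step_fun n t = (if \<lfloor>t * (real n + 1)\<rfloor> \<in> step_index n then step_value n \<lfloor>t * (real n + 1)\<rfloor> else 0)"
proof -
  have "step_fun n t = (\<Sum>k\<in>step_index n. if \<lfloor>t * (real n + 1)\<rfloor> = k then step_value n k else 0)"
    unfolding step_fun_def by (intro sum.cong) (auto simp: step_set_def)
  then show ?thesis by simp
qed

lemma step_fun_measurable [measurable]: "step_fun n \<in> borel_measurable borel"
  unfolding step_fun_def by measurable

lemma step_value_floor: "\<bar>step_value n \<lfloor>t * (real n + 1)\<rfloor> - t\<bar> \<le> 1 / (real n + 1)"
proof -
  have "\<bar>real_of_int \<lfloor>t * (real n + 1)\<rfloor> - t * (real n + 1)\<bar> \<le> 1" by linarith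
  moreover have "step_value n \<lfloor>t * (real n + 1)\<rfloor> - t
      = (real_of_int \<lfloor>t * (real n + 1)\<rfloor> - t * (real n + 1)) / (real n + 1)"
    by (simp add: step_value_def field_simps)
  ultimately show ?thesis
    by (simp add: abs_divide divide_le_cancel)
qed

lemma abs_step_fun_le: "\<bar>step_fun n t\<bar> \<le> \<bar>t\<bar> + 1"
proof -
  have "\<bar>step_value n \<lfloor>t * (real n + 1)\<rfloor> - t\<bar> \<le> 1"
    by (rule order_trans[OF step_value_floor]) simp
  then have "\<bar>step_value n \<lfloor>t * (real n + 1)\<rfloor>\<bar> \<le> \<bar>t\<bar> + 1"
    by linarith
  then show ?thesis by (simp add: step_fun_eq)
qed

lemma tendsto_step_fun: "(\<lambda>n. step_fun n t) \<longlonglongrightarrow> t"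
proof -
  have close: "\<bar>step_fun n t - t\<bar> \<le> 1 / (real n + 1)" if "n \<ge> nat \<lceil>\<bar>t\<bar>\<rceil>" for n
  proof -
    have "\<bar>t\<bar> \<le> real n" using that by linarith
    \<comment> \<open>On a grid of width \<open>1 / (n + 1)\<close> the cutoff of the indices at the
      square of \<open>n + 1\<close> reaches every \<open>t\<close> with absolute value up to
      \<open>n\<close>: range and resolution grow together.\<close>
    then have "\<bar>t * (real n + 1)\<bar> \<le> real n * (real n + 1)"
      by (simp add: abs_mult mult_right_mono)
    also have "\<dots> \<le> real_of_int ((int n + 1)\<^sup>2) - 1"
      by (simp add: power2_eq_square algebra_simps)
    finally have "\<lfloor>t * (real n + 1)\<rfloor> \<in> step_index n"
      unfolding step_index_def atLeastAtMost_iff le_floor_iff floor_le_iff of_int_minus by linarith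
    then show ?thesis
      using step_value_floor[of n t] by (simp add: step_fun_eq)
  qed
  have "(\<lambda>n. step_fun n t - t) \<longlonglongrightarrow> 0"
  proof (rule Lim_null_comparison)
    show "\<forall>\<^sub>F n in sequentially. norm (step_fun n t - t) \<le> 1 / (real n + 1)"
      by (rule eventually_sequentiallyI[of "nat \<lceil>\<bar>t\<bar>\<rceil>"]) (simp only: real_norm_def close)
    show "(\<lambda>n. 1 / (real n + 1)) \<longlonglongrightarrow> 0"
      using LIMSEQ_inverse_real_of_nat by (simp add: inverse_eq_divide add.commute)
  qed
  then show ?thesis by (simp add: LIM_zero_iff)
qed

lemma step_integral:
  assumes M: "sets M = sets borel" and h: "integrable M h"
    and \<nu>: "\<forall>\<Delta>\<in>sets borel. \<nu> \<Delta> = (LINT t:\<Delta>|M. h t)"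
  shows "integrable M (\<lambda>t. complex_of_real (step_fun n t) * h t)"
    and "(LINT t|M. complex_of_real (step_fun n t) * h t)
      = (\<Sum>k\<in>step_index n. complex_of_real (step_value n k) * \<nu> (step_set n k))"
proof -
  have eq: "complex_of_real (step_fun n t) * h t
      = (\<Sum>k\<in>step_index n. complex_of_real (step_value n k) * (indicat_real (step_set n k) t *\<^sub>R h t))" for t
    by (simp only: step_fun_def of_real_sum of_real_mult sum_distrib_right scaleR_conv_of_real mult.assoc)
  have int: "integrable M (\<lambda>t. complex_of_real (step_value n k) * (indicat_real (step_set n k) t *\<^sub>R h t))" for k
    using M by (intro integrable_mult_right integrable_mult_indicator h) simp
  show "integrable M (\<lambda>t. complex_of_real (step_fun n t) * h t)"
    unfolding eq by (intro Bochner_Integration.integrable_sum int)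
  show "(LINT t|M. complex_of_real (step_fun n t) * h t)
      = (\<Sum>k\<in>step_index n. complex_of_real (step_value n k) * \<nu> (step_set n k))"
    unfolding eq Bochner_Integration.integral_sum[OF int]
    by (intro sum.cong refl) (simp add: \<nu> set_lebesgue_integral_def del: mult_scaleR_right)
qed

text \<open>The sums involve \<nu> alone, so the integral cannot depend on the representing
  \<open>M\<close> and \<open>h\<close>. This is the uniqueness behind the description in
  \<open>povm_mean\<close>.\<close>

lemma has_cmeasure_integral_limit:
  assumes "has_cmeasure_integral (\<lambda>t. t) \<nu> I"
  shows "(\<lambda>n. \<Sum>k\<in>step_index n. complex_of_real (step_value n k) * \<nu> (step_set n k)) \<longlonglongrightarrow> I"
proof -
  obtain M h where M: "sets M = sets borel" and h: "integrable M h"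
    and \<nu>: "\<forall>\<Delta>\<in>sets borel. \<nu> \<Delta> = (LINT x:\<Delta>|M. h x)"
    and th: "integrable M (\<lambda>x. complex_of_real x * h x)" and I: "I = (LINT x|M. complex_of_real x * h x)"
    using assms unfolding has_cmeasure_integral_def by blast
  have "(\<lambda>n. LINT t|M. complex_of_real (step_fun n t) * h t) \<longlonglongrightarrow> (LINT t|M. complex_of_real t * h t)"
  proof (rule integral_dominated_convergence)
    show "integrable M (\<lambda>t. norm (complex_of_real t * h t) + norm (h t))"
      by (intro Bochner_Integration.integrable_add integrable_norm th h)
    show "AE t in M. (\<lambda>n. complex_of_real (step_fun n t) * h t) \<longlonglongrightarrow> complex_of_real t * h t"
      by (intro AE_I2 tendsto_mult tendsto_of_real tendsto_step_fun tendsto_const)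
    show "AE t in M. norm (complex_of_real (step_fun n t) * h t) \<le> norm (complex_of_real t * h t) + norm (h t)" for n
    proof (rule AE_I2)
      fix t
      show "norm (complex_of_real (step_fun n t) * h t) \<le> norm (complex_of_real t * h t) + norm (h t)"
        using mult_right_mono[OF abs_step_fun_le[of n t] norm_ge_zero[of "h t"]]
        by (simp add: norm_mult algebra_simps)
    qed
  qed (use th step_integral(1)[where \<nu> = \<nu>, OF M h \<nu>] in auto)
  then show ?thesis
    unfolding I step_integral(2)[where \<nu> = \<nu>, OF M h \<nu>] .
qed

definition povm_step :: "(real set \<Rightarrow> 'a::complex_hilbert bop) \<Rightarrow> nat \<Rightarrow> 'a bop" where
  "povm_step P n = (\<Sum>k\<in>step_index n. complex_of_real (step_value n k) *\<^sub>C P (step_set n k))"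

lemma cinner_povm_step:
  "cinner x (povm_step P n *\<^sub>V y) = (\<Sum>k\<in>step_index n. complex_of_real (step_value n k) * cinner x (P (step_set n k) *\<^sub>V y))"
  by (simp add: povm_step_def bop_apply_sum cinner.sum_right cinner_scaleC_right)

lemma povm_step_adj:
  assumes "is_povm P"
  shows "adj (povm_step P n) = povm_step P n"
proof (rule adj_eqI)
  fix x y
  have "cinner x (P (step_set n k) *\<^sub>V y) = cinner (P (step_set n k) *\<^sub>V x) y" for k
    by (subst cinner_bop_left) (simp add: positive_adj[OF povm_positive[OF assms step_set_borel]])
  then show "cinner x (povm_step P n *\<^sub>V y) = cinner (povm_step P n *\<^sub>V x) y"
    by (simp add: povm_step_def bop_apply_sum cinner.sum_right cinner.sum_left cinner_scaleC_right cinner_scaleC_left)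
qed

lemma povm_step_commute:
  assumes "\<And>\<Delta> \<Gamma>. \<Delta> \<in> sets borel \<Longrightarrow> \<Gamma> \<in> sets borel \<Longrightarrow> P \<Delta> o\<^sub>B Q \<Gamma> = Q \<Gamma> o\<^sub>B P \<Delta>"
  shows "povm_step P n *\<^sub>V povm_step Q m *\<^sub>V x = povm_step Q m *\<^sub>V povm_step P n *\<^sub>V x"
proof -
  have 1: "P \<Delta> *\<^sub>V Q \<Gamma> *\<^sub>V x = Q \<Gamma> *\<^sub>V P \<Delta> *\<^sub>V x" if "\<Delta> \<in> sets borel" "\<Gamma> \<in> sets borel" for \<Delta> \<Gamma> x
    using assms[OF that] by (metis bop_apply_simps(7))
  show ?thesis
    by (simp add: povm_step_def bop_apply_sum bop_sum bop_scaleC scaleC_scaleC scaleC.sum_right 1 mult.commute)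
      (rule sum.swap)
qed

text \<open>By \<open>povm_density\<close> the weak error of the step operators at \<open>y\<close>
  is at most \<open>norm x * sqrt (V n)\<close>, uniformly in the direction of \<open>x\<close>.
  Hence they converge in norm, although the mean is defined by weak integrals.\<close>

lemma povm_mean_limit:
  fixes P :: "real set \<Rightarrow> 'a::complex_hilbert bop"
  assumes P: "is_povm P" and dom: "(\<integral>\<^sup>+t. ennreal (t\<^sup>2) \<partial>vector_measure P y) < \<infinity>"
  shows "\<exists>z. povm_mean P y = Some z \<and> (\<lambda>n. povm_step P n *\<^sub>V y) \<longlonglongrightarrow> z \<and>
    ennreal ((norm z)\<^sup>2) \<le> (\<integral>\<^sup>+t. ennreal (t\<^sup>2) \<partial>vector_measure P y)"
proof -
  let ?\<mu> = "vector_measure P y"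
  interpret finite_measure ?\<mu> by (rule finite_vector_measure[OF P])
  have t2: "integrable ?\<mu> (\<lambda>t. t\<^sup>2)"
    using dom by (intro integrableI_nonneg) auto
  \<comment> \<open>The squares of \<open>2 * \<bar>t\<bar> + 1\<close> and
    \<open>2 * \<bar>t\<bar> - 1\<close> add up to the right side, a majorant that is independent of
    \<open>n\<close> and integrable for a finite measure.\<close>
  have bound: "(step_fun n t - t)\<^sup>2 \<le> 8 * t\<^sup>2 + 2" for n t
  proof -
    have "\<bar>step_fun n t - t\<bar> \<le> 2 * \<bar>t\<bar> + 1"
      using abs_step_fun_le[of n t] by linarith
    then have "(step_fun n t - t)\<^sup>2 \<le> (2 * \<bar>t\<bar> + 1)\<^sup>2"
      by (metis abs_ge_zero power2_abs power_mono)
    also have "\<dots> \<le> 8 * t\<^sup>2 + 2"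
      using zero_le_power2[of "2 * \<bar>t\<bar> - 1"] by (simp add: power2_eq_square algebra_simps)
    finally show ?thesis .
  qed
  have bound_int: "integrable ?\<mu> (\<lambda>t. 8 * t\<^sup>2 + 2)"
    by (intro Bochner_Integration.integrable_add integrable_mult_right t2) simp
  have d_int: "integrable ?\<mu> (\<lambda>t. (step_fun n t - t)\<^sup>2)" for n
    by (rule Bochner_Integration.integrable_bound[OF bound_int])
      (use bound in \<open>auto intro!: AE_I2 order_trans[OF bound]\<close>)
  define V where "V n = (LINT t|?\<mu>. (step_fun n t - t)\<^sup>2)" for n
  have "V \<longlonglongrightarrow> (LINT t|?\<mu>. 0)"
    unfolding V_def
  proof (rule integral_dominated_convergence[OF _ _ bound_int])
    show "AE t in ?\<mu>. (\<lambda>n. (step_fun n t - t)\<^sup>2) \<longlonglongrightarrow> 0"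
    proof (rule AE_I2)
      fix t
      show "(\<lambda>n. (step_fun n t - t)\<^sup>2) \<longlonglongrightarrow> 0"
        using tendsto_power[OF tendsto_diff[OF tendsto_step_fun[of t] tendsto_const[of t]], of 2] by simp
    qed
    show "AE t in ?\<mu>. norm ((step_fun n t - t)\<^sup>2) \<le> 8 * t\<^sup>2 + 2" for n
      using bound by (intro AE_I2) simp
  qed measurable
  then have "(\<lambda>n. sqrt (V n)) \<longlonglongrightarrow> sqrt 0"
    by (intro tendsto_real_sqrt) simp
  then have V0: "(\<lambda>n. sqrt (V n)) \<longlonglongrightarrow> 0" by simp
  have "\<exists>I. has_cmeasure_integral (\<lambda>t. t) (\<lambda>\<Delta>. cinner x (P \<Delta> *\<^sub>V y)) I \<and>
      cmod I \<le> norm x * sqrt (LINT t|?\<mu>. t\<^sup>2) \<and>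
      (\<forall>n. cmod (cinner x (povm_step P n *\<^sub>V y) - I) \<le> norm x * sqrt (V n))" for x
  proof -
    obtain M h where M: "sets M = sets borel" "finite_measure M" and h: "integrable M h"
      and \<nu>: "\<forall>\<Delta>\<in>sets borel. cinner x (P \<Delta> *\<^sub>V y) = (LINT t:\<Delta>|M. h t)"
      and u: "\<And>u. u \<in> borel_measurable borel \<Longrightarrow> integrable ?\<mu> (\<lambda>t. (u t)\<^sup>2) \<Longrightarrow>
        integrable M (\<lambda>t. complex_of_real (u t) * h t) \<and>
        cmod (LINT t|M. complex_of_real (u t) * h t) \<le> norm x * sqrt (LINT t|?\<mu>. (u t)\<^sup>2)"
      using povm_density[OF P, of x y] by blast
    have th: "integrable M (\<lambda>t. complex_of_real t * h t)"
        "cmod (LINT t|M. complex_of_real t * h t) \<le> norm x * sqrt (LINT t|?\<mu>. t\<^sup>2)"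
      using u[of "\<lambda>t. t"] t2 by auto
    have "cinner x (povm_step P n *\<^sub>V y) - (LINT t|M. complex_of_real t * h t)
        = (LINT t|M. complex_of_real (step_fun n t - t) * h t)" for n
    proof -
      have "cinner x (povm_step P n *\<^sub>V y) = (LINT t|M. complex_of_real (step_fun n t) * h t)"
        unfolding step_integral(2)[where \<nu> = "\<lambda>\<Delta>. cinner x (P \<Delta> *\<^sub>V y)", OF M(1) h \<nu>]
        by (rule cinner_povm_step)
      then show ?thesis
        using th(1) step_integral(1)[where \<nu> = "\<lambda>\<Delta>. cinner x (P \<Delta> *\<^sub>V y)", OF M(1) h \<nu>, of n] by (simp add: left_diff_distrib)
    qed
    then have "cmod (cinner x (povm_step P n *\<^sub>V y) - (LINT t|M. complex_of_real t * h t)) \<le> norm x * sqrt (V n)" for n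
      unfolding V_def using u[OF _ d_int[of n]] by simp
    moreover have "has_cmeasure_integral (\<lambda>t. t) (\<lambda>\<Delta>. cinner x (P \<Delta> *\<^sub>V y)) (LINT t|M. complex_of_real t * h t)"
      unfolding has_cmeasure_integral_def using M h \<nu> th(1) by blast
    ultimately show ?thesis using th(2) by blast
  qed
  then obtain I where I: "\<And>x. has_cmeasure_integral (\<lambda>t. t) (\<lambda>\<Delta>. cinner x (P \<Delta> *\<^sub>V y)) (I x)"
    and I_bound: "\<And>x. cmod (I x) \<le> norm x * sqrt (LINT t|?\<mu>. t\<^sup>2)"
    and I_close: "\<And>x n. cmod (cinner x (povm_step P n *\<^sub>V y) - I x) \<le> norm x * sqrt (V n)"
    by metis
  have V_nonneg: "0 \<le> V n" for n unfolding V_def by simp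
  have diff: "norm (povm_step P m *\<^sub>V y - povm_step P n *\<^sub>V y) \<le> sqrt (V m) + sqrt (V n)" for m n
  proof (rule norm_leI_cinner)
    fix x
    show "cmod (cinner x (povm_step P m *\<^sub>V y - povm_step P n *\<^sub>V y)) \<le> (sqrt (V m) + sqrt (V n)) * norm x"
      using I_close[of x m] I_close[of x n]
        norm_triangle_ineq4[of "cinner x (povm_step P m *\<^sub>V y) - I x" "cinner x (povm_step P n *\<^sub>V y) - I x"]
      by (simp add: cinner.diff_right algebra_simps)
  qed (simp add: V_nonneg)
  have "Cauchy (\<lambda>n. povm_step P n *\<^sub>V y)"
  proof (rule metric_CauchyI)
    fix \<epsilon> :: real assume "\<epsilon> > 0"
    then obtain N where N: "\<And>n. n \<ge> N \<Longrightarrow> sqrt (V n) < \<epsilon> / 2"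
      using LIMSEQ_D[OF V0, of "\<epsilon> / 2"] by (auto simp: V_nonneg)
    show "\<exists>M. \<forall>m\<ge>M. \<forall>n\<ge>M. dist (povm_step P m *\<^sub>V y) (povm_step P n *\<^sub>V y) < \<epsilon>"
    proof (intro exI allI impI)
      fix m n assume "m \<ge> N" "n \<ge> N"
      then show "dist (povm_step P m *\<^sub>V y) (povm_step P n *\<^sub>V y) < \<epsilon>"
        using diff[of m n] N[of m] N[of n] by (simp add: dist_norm)
    qed
  qed
  then obtain z where z: "(\<lambda>n. povm_step P n *\<^sub>V y) \<longlonglongrightarrow> z"
    using Cauchy_convergent convergent_def by blast
  have xz: "(\<lambda>n. cinner x (povm_step P n *\<^sub>V y)) \<longlonglongrightarrow> cinner x z" for x
    by (intro cinner.tendsto tendsto_const z)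
  have lim: "w = cinner x z" if "has_cmeasure_integral (\<lambda>t. t) (\<lambda>\<Delta>. cinner x (P \<Delta> *\<^sub>V y)) w" for x w
    using has_cmeasure_integral_limit[OF that, folded cinner_povm_step] xz by (rule LIMSEQ_unique)
  have "povm_mean P y = Some (THE z. \<forall>x. has_cmeasure_integral (\<lambda>t. t) (\<lambda>\<Delta>. cinner x (P \<Delta> *\<^sub>V y)) (cinner x z))"
    using dom by (simp add: povm_mean_def)
  also have "(THE z. \<forall>x. has_cmeasure_integral (\<lambda>t. t) (\<lambda>\<Delta>. cinner x (P \<Delta> *\<^sub>V y)) (cinner x z)) = z"
  proof (rule the_equality)
    show "\<forall>x. has_cmeasure_integral (\<lambda>t. t) (\<lambda>\<Delta>. cinner x (P \<Delta> *\<^sub>V y)) (cinner x z)"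
      using I by (simp add: lim[OF I, symmetric])
    fix w assume "\<forall>x. has_cmeasure_integral (\<lambda>t. t) (\<lambda>\<Delta>. cinner x (P \<Delta> *\<^sub>V y)) (cinner x w)"
    then show "w = z"
      using lim by (metis cinner_eqI)
  qed
  finally have mean: "povm_mean P y = Some z" .
  have "norm z \<le> sqrt (LINT t|?\<mu>. t\<^sup>2)"
  proof (rule norm_leI_cinner)
    show "cmod (cinner x z) \<le> sqrt (LINT t|?\<mu>. t\<^sup>2) * norm x" for x
      using I_bound[of x] lim[OF I[of x]] by (simp add: mult.commute)
  qed simp
  then have "(norm z)\<^sup>2 \<le> (LINT t|?\<mu>. t\<^sup>2)"
    by (metis norm_ge_zero power_mono real_sqrt_pow2 Bochner_Integration.integral_nonneg zero_le_power2)
  then have "ennreal ((norm z)\<^sup>2) \<le> ennreal (LINT t|?\<mu>. t\<^sup>2)"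
    by (rule ennreal_leI)
  also have "\<dots> = (\<integral>\<^sup>+t. ennreal (t\<^sup>2) \<partial>?\<mu>)"
    by (rule nn_integral_eq_integral[symmetric, OF t2]) simp
  finally show ?thesis using mean z by blast
qed

lemma povm_mean_SomeD:
  assumes "is_povm P" "povm_mean P y = Some z"
  shows "(\<lambda>n. povm_step P n *\<^sub>V y) \<longlonglongrightarrow> z"
proof -
  have "(\<integral>\<^sup>+t. ennreal (t\<^sup>2) \<partial>vector_measure P y) < \<infinity>"
    using assms(2) by (auto simp: povm_mean_def split: if_splits)
  from povm_mean_limit[OF assms(1) this] show ?thesis
    using assms(2) by auto
qed

lemma povm_mean_symmetric:
  assumes P: "is_povm P" and y: "povm_mean P y = Some z"
  shows "Im (cinner y z) = 0"
proof -
  have "(\<lambda>n. Im (cinner y (povm_step P n *\<^sub>V y))) \<longlonglongrightarrow> Im (cinner y z)"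
    by (intro tendsto_Im cinner.tendsto tendsto_const povm_mean_SomeD[OF P y])
  moreover have "Im (cinner y (povm_step P n *\<^sub>V y)) = 0" for n
    using povm_step_adj[OF P, of n] by (simp add: self_adjoint_iff_real)
  ultimately show ?thesis by (simp add: LIMSEQ_const_iff)
qed

text \<open>Commutation in a form that makes sense although \<open>w\<close> need not lie in the
  domain of the first mean. For step operators the number is a diagonal value of their self-adjoint
  product, and reality passes to the limit.\<close>

lemma povm_mean_commute:
  assumes P: "is_povm P" "povm_mean P y = Some v" and Q: "is_povm Q" "povm_mean Q y = Some w"
    and comm: "\<And>\<Delta> \<Gamma>. \<Delta> \<in> sets borel \<Longrightarrow> \<Gamma> \<in> sets borel \<Longrightarrow> P \<Delta> o\<^sub>B Q \<Gamma> = Q \<Gamma> o\<^sub>B P \<Delta>"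
  shows "Im (cinner v w) = 0"
proof -
  have "(\<lambda>n. Im (cinner (povm_step P n *\<^sub>V y) (povm_step Q n *\<^sub>V y))) \<longlonglongrightarrow> Im (cinner v w)"
    by (intro tendsto_Im cinner.tendsto povm_mean_SomeD P Q)
  moreover have "Im (cinner (povm_step P n *\<^sub>V y) (povm_step Q n *\<^sub>V y)) = 0" for n
  proof -
    let ?S = "povm_step P n" and ?T = "povm_step Q n"
    have "adj (?S o\<^sub>B ?T) = ?T o\<^sub>B ?S"
      by (simp add: adj_comp povm_step_adj P Q)
    also have "\<dots> = ?S o\<^sub>B ?T"
      by (rule bop_eqI) (simp add: povm_step_commute[OF comm])
    finally have "Im (cinner y (?S *\<^sub>V ?T *\<^sub>V y)) = 0"
      by (simp add: self_adjoint_iff_real)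
    then show ?thesis
      by (simp add: cinner_bop_left[of y ?S] povm_step_adj P)
  qed
  ultimately show ?thesis by (simp add: LIMSEQ_const_iff)
qed

section \<open>The uncertainty relation\<close>

text \<open>It compares second moments twice: for a single vector with a rescaled
  \<open>state_measure\<close>, and for finitely many basis vectors with
  \<open>state_measure\<close> itself.\<close>

lemma sum_nn_integral_le:
  fixes f :: "real \<Rightarrow> ennreal"
  assumes f: "f \<in> borel_measurable borel" and F: "finite F"
    and sets: "\<And>e. sets (\<mu> e) = sets borel" "sets \<nu> = sets borel"
    and le: "\<And>\<Delta>. \<Delta> \<in> sets borel \<Longrightarrow> (\<Sum>e\<in>F. emeasure (\<mu> e) \<Delta>) \<le> emeasure \<nu> \<Delta>"
  shows "(\<Sum>e\<in>F. \<integral>\<^sup>+t. f t \<partial>\<mu> e) \<le> (\<integral>\<^sup>+t. f t \<partial>\<nu>)"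
proof -
  have meas: "g \<in> borel_measurable borel \<Longrightarrow> g \<in> borel_measurable (\<mu> e)"
    "g \<in> borel_measurable borel \<Longrightarrow> g \<in> borel_measurable \<nu>" for g :: "real \<Rightarrow> ennreal" and e
    by (subst measurable_cong_sets[OF sets(1) refl] measurable_cong_sets[OF sets(2) refl], assumption)+
  \<comment> \<open>The finite sum is written as an integral over a counting measure, so that
    monotone convergence also moves the supremum through it.\<close>
  have "(\<integral>\<^sup>+e. (\<integral>\<^sup>+t. f t \<partial>\<mu> e) \<partial>count_space F) \<le> (\<integral>\<^sup>+t. f t \<partial>\<nu>)"
    using f
  proof (induction f rule: borel_measurable_induct)
    case (cong f g)
    then show ?case by (simp add: fun_eq_iff[symmetric])
  next
    case (set A)
    then show ?case
      using le[of A] F by (simp add: sets nn_integral_count_space_finite)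
  next
    case (mult u c)
    then show ?case
      by (simp add: nn_integral_cmult meas mult_left_mono)
  next
    case (add u v)
    then show ?case
      by (simp add: nn_integral_add meas add_mono)
  next
    case (seq U)
    have SUP_integral: "(\<integral>\<^sup>+t. (SUP i. U i) t \<partial>N) = (SUP i. \<integral>\<^sup>+t. U i t \<partial>N)"
      if "sets N = sets borel" for N
      unfolding SUP_apply
      by (rule nn_integral_monotone_convergence_SUP[OF seq(3)])
        (subst measurable_cong_sets[OF that refl], rule seq(1))
    have "(\<integral>\<^sup>+e. (\<integral>\<^sup>+t. (SUP i. U i) t \<partial>\<mu> e) \<partial>count_space F)
        = (\<integral>\<^sup>+e. (SUP i. \<integral>\<^sup>+t. U i t \<partial>\<mu> e) \<partial>count_space F)"
      by (simp only: SUP_integral[OF sets(1)])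
    also have "\<dots> = (SUP i. \<integral>\<^sup>+e. (\<integral>\<^sup>+t. U i t \<partial>\<mu> e) \<partial>count_space F)"
    proof (rule nn_integral_monotone_convergence_SUP)
      show "incseq (\<lambda>i e. \<integral>\<^sup>+t. U i t \<partial>\<mu> e)"
        using seq(3) by (auto simp: incseq_def le_fun_def intro!: nn_integral_mono)
    qed simp
    also have "\<dots> \<le> (SUP i. \<integral>\<^sup>+t. U i t \<partial>\<nu>)"
      using seq by (intro SUP_mono) blast
    also have "\<dots> = (\<integral>\<^sup>+t. (SUP i. U i) t \<partial>\<nu>)"
      by (simp only: SUP_integral[OF sets(2)])
    finally show ?case .
  qed
  then show ?thesis
    using F by (simp add: nn_integral_count_space_finite)
qed

lemma sets_state_measure [simp, measurable_cong]: "sets (state_measure P \<rho>) = sets borel"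
  unfolding state_measure_def by (rule sets_measure_of_borel)

lemma hilbert_schmidt_adj_comp:
  assumes "trace_class (adj R o\<^sub>B R)"
  shows "hilbert_schmidt R"
proof -
  have "(\<lambda>e. Re (cinner e ((adj R o\<^sub>B R) *\<^sub>V e))) summable_on some_onb"
    by (rule summable_on_Re[OF has_sum_imp_summable[OF tr_has_sum[OF assms]]])
  then show ?thesis
    by (simp add: hilbert_schmidt_def cinner_adj_right Re_cinner_self)
qed

lemma tr_adj_comp_self: "hilbert_schmidt R \<Longrightarrow> tr (adj R o\<^sub>B R) = complex_of_real (hs_norm_sq R)"
  unfolding tr_adj_comp cinner_self
  by (intro infsumI has_sum_of_real hilbert_schmidt_has_sum)

lemma tr_adj_comp_commute: "tr (adj M o\<^sub>B L) = cnj (tr (adj L o\<^sub>B M))"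
  unfolding tr_adj_comp infsum_cnj[symmetric] by (simp flip: cinner_commute)

lemma Im_tr_adj_comp:
  assumes "hilbert_schmidt L" "hilbert_schmidt M" "\<And>x. Im (cinner (L *\<^sub>V x) (M *\<^sub>V x)) = 0"
  shows "Im (tr (adj L o\<^sub>B M)) = 0"
  using has_sum_Im[OF hs_inner_has_sum[OF assms(1,2)]] assms(3) has_sum_unique[OF _ has_sum_0_simp]
  by simp

lemma hs_inner_diff_diff:
  assumes "hilbert_schmidt L" "hilbert_schmidt S" "hilbert_schmidt M" "hilbert_schmidt N"
  shows "tr (adj (L - complex_of_real a *\<^sub>C S) o\<^sub>B (M - complex_of_real b *\<^sub>C N))
    = tr (adj L o\<^sub>B M) - b * tr (adj L o\<^sub>B N) - a * tr (adj S o\<^sub>B M) + a * b * tr (adj S o\<^sub>B N)"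
proof -
  have "adj (L - complex_of_real a *\<^sub>C S) o\<^sub>B (M - complex_of_real b *\<^sub>C N)
      = ((adj L o\<^sub>B M - complex_of_real b *\<^sub>C (adj L o\<^sub>B N)) - complex_of_real a *\<^sub>C (adj S o\<^sub>B M))
        + (complex_of_real a * complex_of_real b) *\<^sub>C (adj S o\<^sub>B N)"
    by (rule bop_eqI)
      (simp add: adj_diff adj_scaleC bop_diff bop_scaleC scaleC.diff_right scaleC_scaleC algebra_simps)
  then show ?thesis
    using assms
    by (simp add: tr_add tr_diff tr_scaleC trace_class_add trace_class_diff trace_class_scaleC
        trace_class_adj_comp)
qed

lemma hs_norm_sq_diff:
  assumes "hilbert_schmidt L" "hilbert_schmidt S"
  shows "hs_norm_sq (L - complex_of_real a *\<^sub>C S)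
    = hs_norm_sq L - 2 * a * Re (tr (adj S o\<^sub>B L)) + a\<^sup>2 * hs_norm_sq S"
proof -
  have "complex_of_real (hs_norm_sq (L - complex_of_real a *\<^sub>C S))
      = tr (adj (L - complex_of_real a *\<^sub>C S) o\<^sub>B (L - complex_of_real a *\<^sub>C S))"
    by (intro tr_adj_comp_self[symmetric] hilbert_schmidt_diff hilbert_schmidt_scaleC assms)
  also have "\<dots> = complex_of_real (hs_norm_sq L) - a * cnj (tr (adj S o\<^sub>B L)) - a * tr (adj S o\<^sub>B L)
      + a * a * complex_of_real (hs_norm_sq S)"
    unfolding hs_inner_diff_diff[OF assms assms] tr_adj_comp_commute[of L S]
    by (simp add: tr_adj_comp_self assms)
  finally have "Re (complex_of_real (hs_norm_sq (L - complex_of_real a *\<^sub>C S)))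
      = Re (complex_of_real (hs_norm_sq L) - a * cnj (tr (adj S o\<^sub>B L)) - a * tr (adj S o\<^sub>B L)
      + a * a * complex_of_real (hs_norm_sq S))"
    by (rule arg_cong)
  then show ?thesis by (simp add: power2_eq_square)
qed

lemma times_sqrt_eqI: "(\<And>x. X (sqrt_op \<rho> *\<^sub>V x) = Some (R *\<^sub>V x)) \<Longrightarrow> times_sqrt X \<rho> = R"
  unfolding times_sqrt_def by (rule the_equality) (auto intro!: bop_eqI)

lemma state_sqrt:
  assumes "state \<rho>"
  shows "hilbert_schmidt (sqrt_op \<rho>)" "hs_norm_sq (sqrt_op \<rho>) = 1"
proof -
  have \<rho>: "positive \<rho>" "trace_class \<rho>" "tr \<rho> = 1" using assms by (simp_all add: state_def)
  then show "hilbert_schmidt (sqrt_op \<rho>)" by (simp add: trace_class_positive)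
  show "hs_norm_sq (sqrt_op \<rho>) = 1"
    using tr_positive[OF \<rho>(1,2)] \<rho>(3) by (metis of_real_eq_1_iff)
qed

text \<open>For a POVM with finite second moment in \<open>\<rho>\<close>, the domain of its mean contains the range of
  \<open>\<surd>\<rho>\<close>: \<open>\<langle>\<surd>\<rho>x|P(\<Delta>)|\<surd>\<rho>x\<rangle>\<close> is at most \<open>\<parallel>x\<parallel>\<^sup>2 Tr[P(\<Delta>)\<rho>]\<close>, since it is the
  value at \<open>x\<close> of a positive operator with that trace.\<close>

lemma povm_mean_times_sqrt:
  fixes P :: "real set \<Rightarrow> 'a::complex_hilbert bop"
  assumes P: "is_povm P" and \<rho>: "state \<rho>" and fin: "finite_povm_second_moment P \<rho>"
  obtains R where "\<And>x. povm_mean P (sqrt_op \<rho> *\<^sub>V x) = Some (R *\<^sub>V x)" "hilbert_schmidt R"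
    "hs_norm_sq R \<le> (LINT t|state_measure P \<rho>. t\<^sup>2)"
proof -
  let ?S = "sqrt_op \<rho>" and ?\<nu> = "state_measure P \<rho>" and ?B = "some_onb :: 'a set"
  have \<rho>': "positive \<rho>" "trace_class \<rho>" using \<rho> by (simp_all add: state_def)
  define I where "I = (\<integral>\<^sup>+t. ennreal (t\<^sup>2) \<partial>?\<nu>)"
  define W where "W = (LINT t|?\<nu>. t\<^sup>2)"
  have "I < \<infinity>" using fin by (simp add: finite_povm_second_moment_def I_def)
  then have I: "I = ennreal W" and "0 \<le> W"
    unfolding I_def W_def by (subst integral_eq_nn_integral; simp)+
  have q_sum: "((\<lambda>e. Re (cinner (?S *\<^sub>V e) (P \<Delta> *\<^sub>V ?S *\<^sub>V e))) has_sum Re (tr (P \<Delta> o\<^sub>B \<rho>))) ?B" for \<Delta>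
    by (intro has_sum_Re tr_comp_positive \<rho>')
  have q_nonneg: "0 \<le> Re (cinner z (P \<Delta> *\<^sub>V z))" if "\<Delta> \<in> sets borel" for z \<Delta>
    by (rule positive_Re[OF povm_positive[OF P that]])
  have q_le: "Re (cinner (?S *\<^sub>V x) (P \<Delta> *\<^sub>V ?S *\<^sub>V x)) \<le> (norm x)\<^sup>2 * Re (tr (P \<Delta> o\<^sub>B \<rho>))"
    if D: "\<Delta> \<in> sets borel" for x \<Delta>
  proof -
    let ?L = "sqrt_op (P \<Delta>) o\<^sub>B ?S"
    have q: "Re (cinner (?S *\<^sub>V z) (P \<Delta> *\<^sub>V ?S *\<^sub>V z)) = (norm (?L *\<^sub>V z))\<^sup>2" for z
      by (simp add: positive_norm_sqrt[OF povm_positive[OF P D]])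
    have L: "hilbert_schmidt ?L"
      unfolding hilbert_schmidt_def q[symmetric] by (rule has_sum_imp_summable[OF q_sum])
    have "hs_norm_sq ?L = Re (tr (P \<Delta> o\<^sub>B \<rho>))"
      unfolding hs_norm_sq_def q[symmetric] by (rule infsumI[OF q_sum])
    then show ?thesis
      using hilbert_schmidt_norm_le[OF L, of x] unfolding q by (simp add: mult.commute)
  qed
  have em_\<nu>: "emeasure ?\<nu> \<Delta> = ennreal (Re (tr (P \<Delta> o\<^sub>B \<rho>)))" if "\<Delta> \<in> sets borel" for \<Delta>
    by (rule state_measure[OF P \<rho>' that])
  have I_le: "(\<integral>\<^sup>+t. ennreal (t\<^sup>2) \<partial>vector_measure P (?S *\<^sub>V x)) \<le> ennreal ((norm x)\<^sup>2 * W)" for x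
  proof -
    let ?N = "scale_measure (ennreal ((norm x)\<^sup>2)) ?\<nu>"
    have "(\<Sum>e\<in>{x}. \<integral>\<^sup>+t. ennreal (t\<^sup>2) \<partial>vector_measure P (?S *\<^sub>V e)) \<le> (\<integral>\<^sup>+t. ennreal (t\<^sup>2) \<partial>?N)"
    proof (rule sum_nn_integral_le)
      show "(\<Sum>e\<in>{x}. emeasure (vector_measure P (?S *\<^sub>V e)) \<Delta>) \<le> emeasure ?N \<Delta>"
        if "\<Delta> \<in> sets borel" for \<Delta>
        using q_le[OF that, of x] that
        by (simp add: emeasure_vector_measure[OF P] em_\<nu> ennreal_leI flip: ennreal_mult')
    qed simp_all
    also have "\<dots> = ennreal ((norm x)\<^sup>2) * I"
      unfolding I_def by (rule nn_integral_scale_measure) simp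
    also have "\<dots> = ennreal ((norm x)\<^sup>2 * W)"
      unfolding I using \<open>0 \<le> W\<close> by (simp add: ennreal_mult')
    finally show ?thesis by simp
  qed
  have dom: "(\<integral>\<^sup>+t. ennreal (t\<^sup>2) \<partial>vector_measure P (?S *\<^sub>V x)) < \<infinity>" for x
    using I_le[of x] by (simp add: le_less_trans)
  obtain f where f: "\<And>x. povm_mean P (?S *\<^sub>V x) = Some (f x)"
    and f_lim: "\<And>x. (\<lambda>n. povm_step P n *\<^sub>V ?S *\<^sub>V x) \<longlonglongrightarrow> f x"
    and f_norm: "\<And>x. ennreal ((norm (f x))\<^sup>2) \<le> (\<integral>\<^sup>+t. ennreal (t\<^sup>2) \<partial>vector_measure P (?S *\<^sub>V x))"
    using povm_mean_limit[OF P dom] by metis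
  have "f (x + y) = f x + f y" for x y
    using LIMSEQ_unique[OF f_lim[of "x + y"]] tendsto_add[OF f_lim[of x] f_lim[of y]] by (simp add: bop_add)
  moreover have "f (c *\<^sub>C x) = c *\<^sub>C f x" for c x
    using LIMSEQ_unique[OF f_lim[of "c *\<^sub>C x"]] scaleC.tendsto[OF tendsto_const f_lim[of x]]
    by (simp add: bop_scaleC)
  moreover have "norm (f x) \<le> sqrt W * norm x" for x
  proof -
    have "(norm (f x))\<^sup>2 \<le> (norm x)\<^sup>2 * W"
      using order_trans[OF f_norm I_le] \<open>0 \<le> W\<close> by (simp add: ennreal_le_iff)
    then have "norm (f x) \<le> sqrt ((norm x)\<^sup>2 * W)"
      by (rule real_le_rsqrt)
    then show ?thesis by (simp add: real_sqrt_mult mult.commute)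
  qed
  ultimately obtain R where R: "\<And>x. R *\<^sub>V x = f x"
    using bop_of_fun by blast
  \<comment> \<open>Summing \<open>I_le\<close> over \<open>F\<close> would lose a factor of the
    size of \<open>F\<close>. Instead the measures of the vectors in \<open>F\<close> are added
    first, and their sum is at most \<open>state_measure P \<rho>\<close>.\<close>
  have partial: "(\<Sum>e\<in>F. (norm (R *\<^sub>V e))\<^sup>2) \<le> W" if F: "finite F" "F \<subseteq> ?B" for F
  proof -
    have "ennreal (\<Sum>e\<in>F. (norm (R *\<^sub>V e))\<^sup>2) = (\<Sum>e\<in>F. ennreal ((norm (f e))\<^sup>2))"
      by (simp add: R sum_ennreal)
    also have "\<dots> \<le> (\<Sum>e\<in>F. \<integral>\<^sup>+t. ennreal (t\<^sup>2) \<partial>vector_measure P (?S *\<^sub>V e))"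
      by (intro sum_mono f_norm)
    also have "\<dots> \<le> I"
      unfolding I_def
    proof (rule sum_nn_integral_le)
      show "(\<Sum>e\<in>F. emeasure (vector_measure P (?S *\<^sub>V e)) \<Delta>) \<le> emeasure ?\<nu> \<Delta>" if D: "\<Delta> \<in> sets borel" for \<Delta>
      proof -
        have "(\<Sum>e\<in>F. Re (cinner (?S *\<^sub>V e) (P \<Delta> *\<^sub>V ?S *\<^sub>V e))) \<le> Re (tr (P \<Delta> o\<^sub>B \<rho>))"
          using F q_nonneg[OF D] by (intro finite_sum_le_has_sum[OF q_sum]) auto
        then show ?thesis
          using q_nonneg[OF D] by (simp add: emeasure_vector_measure[OF P D] em_\<nu>[OF D] sum_ennreal ennreal_leI)
      qed
    qed (use F in simp_all)
    finally show ?thesis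
      unfolding I using \<open>0 \<le> W\<close> by (simp add: ennreal_le_iff)
  qed
  have hs: "hilbert_schmidt R"
    unfolding hilbert_schmidt_def
    by (rule nonneg_bdd_above_summable_on) (auto intro!: bdd_aboveI2[of _ _ W] partial)
  have "hs_norm_sq R \<le> W"
    using hilbert_schmidt_has_sum[OF hs] partial by (rule has_sum_le_finite_sums)
  then show ?thesis
    using that[of R] f R hs by (simp add: W_def)
qed

theorem mainTheorem5:
  fixes \<I> :: "real set \<Rightarrow> 'a::complex_hilbert bop \<Rightarrow> 'a bop"
    and A B :: "'a pop"
    and E\<^sub>A E\<^sub>B :: "real set \<Rightarrow> 'a bop"
    and \<rho> :: "'a bop"
  assumes "cp_instrument \<I>"
    and "self_adjoint A" and "is_spectral_measure A E\<^sub>A"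
    and "self_adjoint B" and "is_spectral_measure B E\<^sub>B"
    and "precisely_measures \<I> E\<^sub>A"
    and "state \<rho>"
    and "finite_second_moment A \<rho>"
    and "finite_second_moment B \<rho>"
    and "finite_povm_second_moment (disturbed_povm \<I> E\<^sub>B) \<rho>"
  shows "std_dev A \<rho> * rms_disturbance \<I> B E\<^sub>B \<rho> \<ge> 1 / 2 * cmod (tr_commutator A B \<rho>)"
proof -
  let ?S = "sqrt_op \<rho>" and ?C = "disturbed_povm \<I> E\<^sub>B"
  note \<I> = assms(1)
  have EA: "is_pvm E\<^sub>A" "is_povm E\<^sub>A" "povm_mean E\<^sub>A = A"
    and EB: "is_povm E\<^sub>B" "povm_mean E\<^sub>B = B"
    using assms(3,5) by (auto simp: is_spectral_measure_def is_pvm_def)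
  have C: "is_povm ?C" by (rule is_povm_disturbed_povm[OF \<I> EB(1)])
  note S = state_sqrt[OF assms(7)]
  obtain RA where RA: "\<And>x. A (?S *\<^sub>V x) = Some (RA *\<^sub>V x)" and hsA: "hilbert_schmidt RA"
    using assms(8) hilbert_schmidt_adj_comp unfolding finite_second_moment_def by blast
  obtain RB where RB: "\<And>x. B (?S *\<^sub>V x) = Some (RB *\<^sub>V x)" and hsB: "hilbert_schmidt RB"
    using assms(9) hilbert_schmidt_adj_comp unfolding finite_second_moment_def by blast
  obtain RC where RC: "\<And>x. povm_mean ?C (?S *\<^sub>V x) = Some (RC *\<^sub>V x)" and hsC: "hilbert_schmidt RC"
    and RC_le: "hs_norm_sq RC \<le> (LINT t|state_measure ?C \<rho>. t\<^sup>2)"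
    using povm_mean_times_sqrt[OF C assms(7,10)] by blast
  have ts: "times_sqrt A \<rho> = RA" "times_sqrt B \<rho> = RB" "times_sqrt (povm_mean ?C) \<rho> = RC"
    "times_sqrt Some \<rho> = ?S"
    by (intro times_sqrt_eqI RA RB RC refl)+
  have comm: "E\<^sub>A \<Delta> o\<^sub>B ?C \<Gamma> = ?C \<Gamma> o\<^sub>B E\<^sub>A \<Delta>" if "\<Delta> \<in> sets borel" "\<Gamma> \<in> sets borel" for \<Delta> \<Gamma>
    unfolding disturbed_povm_def nonselective_def
    by (intro dual_map_commute \<I> EA assms(6) that povm_positive[OF EB(1)] povm_le_id[OF EB(1)])
  have Im_AC: "Im (tr (adj RA o\<^sub>B RC)) = 0"
    by (intro Im_tr_adj_comp hsA hsC povm_mean_commute[OF EA(2) _ C RC comm]) (simp_all add: EA RA)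
  have Im_SB: "Im (tr (adj ?S o\<^sub>B RB)) = 0"
    by (intro Im_tr_adj_comp S hsB povm_mean_symmetric[OF EB(1)]) (simp add: EB RB)
  have Im_SC: "Im (tr (adj ?S o\<^sub>B RC)) = 0"
    by (intro Im_tr_adj_comp S hsC povm_mean_symmetric[OF C] RC)
  define a where "a = Re (tr (adj ?S o\<^sub>B RA))"
  define L where "L = RA - complex_of_real a *\<^sub>C ?S"
  \<comment> \<open>The factor 1 gives the difference the shape of \<open>hs_norm_sq_diff\<close>
    and \<open>hs_inner_diff_diff\<close>.\<close>
  define D where "D = RB - complex_of_real 1 *\<^sub>C RC"
  have hsL: "hilbert_schmidt L" and hsD: "hilbert_schmidt D"
    by (auto simp: L_def D_def intro!: hilbert_schmidt_diff hilbert_schmidt_scaleC hsA hsB hsC S)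
  \<comment> \<open>The squared norm of \<open>L\<close> is the second moment minus twice the square
    of \<open>a\<close> plus once that square, because the root of a state has Hilbert-Schmidt norm
    one.\<close>
  have "std_dev A \<rho> = sqrt (hs_norm_sq L)"
    by (simp add: std_dev_def tr_mean_def tr_prod_def ts L_def hs_norm_sq_diff hsA S tr_adj_comp_self
        power2_eq_square flip: a_def)
  moreover have "hs_norm_sq D = hs_norm_sq RB - 2 * Re (tr (adj RC o\<^sub>B RB)) + hs_norm_sq RC"
    unfolding D_def hs_norm_sq_diff[OF hsB hsC] by simp
  \<comment> \<open>Only an inequality: \<open>RC_le\<close> replaces the squared norm of
    \<open>RC\<close> by the second moment of \<open>?C\<close>, which may be larger.\<close>
  then have "sqrt (hs_norm_sq D) \<le> rms_disturbance \<I> B E\<^sub>B \<rho>"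
    using RC_le
    by (simp add: rms_disturbance_def povm_distance_def tr_prod_def ts hsB
        tr_adj_comp_self tr_adj_comp_commute[of RB RC])
  ultimately have "sqrt (hs_norm_sq L) * sqrt (hs_norm_sq D) \<le> std_dev A \<rho> * rms_disturbance \<I> B E\<^sub>B \<rho>"
    by (simp add: mult_left_mono hs_norm_sq_nonneg)
  moreover have "\<bar>Im (tr (adj L o\<^sub>B D))\<bar> \<le> sqrt (hs_norm_sq L) * sqrt (hs_norm_sq D)"
    using abs_Im_le_cmod hs_cauchy_schwarz[OF hsL hsD] by (rule order_trans)
  \<comment> \<open>Of the four terms in the expansion only the one with \<open>RA\<close> and
    \<open>RB\<close> can have an imaginary part.\<close>
  moreover have "Im (tr (adj L o\<^sub>B D)) = Im (tr (adj RA o\<^sub>B RB))"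
    unfolding L_def D_def hs_inner_diff_diff[OF hsA S(1) hsB hsC] by (simp add: Im_AC Im_SB Im_SC)
  moreover have "cmod (tr_commutator A B \<rho>) = 2 * \<bar>Im (tr (adj RA o\<^sub>B RB))\<bar>"
  proof -
    have "tr_commutator A B \<rho> = tr (adj RA o\<^sub>B RB) - cnj (tr (adj RA o\<^sub>B RB))"
      by (simp add: tr_commutator_def tr_prod_def ts tr_adj_comp_commute[of RB RA])
    then show ?thesis
      by (simp add: complex_diff_cnj norm_mult)
  qed
  ultimately show ?thesis by simp
qed

end
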